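(* Let $\mathcal T_{q,t}$ be an equivalence class for $\sim_{q,t}$ on $\mathrm{Std}_{d,n}$, let $\boldsymbol k=\mathrm{res}(\mathcal T_{q,t})=((i_1,j_1),\dots,(i_n,j_n))\in\mathcal K_n$, and let $1\le a<n$. Then the following hold in $\mathcal Y_{d,n}(q)$ (for all indices for which the expressions are defined): 1. $\Phi_a e(\boldsymbol k)=e(\sigma_a\boldsymbol k)\Phi_a$. 2. $\Phi_aX_b=X_b\Phi_a$ if $b\ne a,a+1$. 3. $\Phi_a\Phi_b=\Phi_b\Phi_a$ if $|a-b|>1$. 4. $\Phi_aX_{a+1}e(\boldsymbol k)=X_a\Phi_ae(\boldsymbol k)$ if ($i_a\ne i_{a+1}$ and $j_a=j_{a+1}$) or $j_a\ne j_{a+1}$; and $\Phi_aX_{a+1}e(\boldsymbol k)=(X_a\Phi_a+qX_{a+1}-X_a)e(\boldsymbol k)$ if $i_a=i_{a+1}$, $j_a=j_{a+1}$. 5. $X_{a+1}\Phi_ae(\boldsymbol k)=\Phi_aX_ae(\boldsymbol k)$ if ($i_a\ne i_{a+1}$ and $j_a=j_{a+1}$) or $j_a\ne j_{a+1}$; and $X_{a+1}\Phi_ae(\boldsymbol k)=(\Phi_aX_a+qX_{a+1}-X_a)e(\boldsymbol k)$ if $i_a=i_{a+1}$, $j_a=j_{a+1}$. 6. $\Phi_a^2e(\boldsymbol k)=\begin{cases}\dfrac{(qX_a-X_{a+1})(X_a-qX_{a+1})}{(X_a-X_{a+1})^2}e(\boldsymbol k)&\text{if }i_a\ne i_{a+1},\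 j_a=j_{a+1},\\(q+1)\Phi_ae(\boldsymbol k)&\text{if }i_a=i_{a+1},\ j_a=j_{a+1},\\ q\,e(\boldsymbol k)&\text{if }j_a\ne j_{a+1}.\end{cases}$ 7. (for $a\le n-2$) $\Phi_a\Phi_{a+1}\Phi_ae(\boldsymbol k)=\begin{cases}(\Phi_{a+1}\Phi_a\Phi_{a+1}+q\Phi_a-q\Phi_{a+1})e(\boldsymbol k)&\text{if }i_a=i_{a+1}=i_{a+2},\ j_a=j_{a+1}=j_{a+2},\\(\Phi_{a+1}\Phi_a\Phi_{a+1}+Z_a)e(\boldsymbol k)&\text{if }i_a=i_{a+2}\ne i_{a+1},\ j_a=j_{a+1}=j_{a+2},\\ \Phi_{a+1}\Phi_a\Phi_{a+1}e(\boldsymbol k)&\text{otherwise,}\end{cases}$ where $Z_a=(1-q)^2\dfrac{(X_aX_{a+2}-X_{a+1}^2)(X_aX_{a+1}-qX_{a+1}X_{a+2})}{(X_a-X_{a+1})^2(X_{a+1}-X_{a+2})^2}$.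
   Context: **Yokonuma–Hecke algebra.** $n,d$ are positive integers, $\Bbbk$ is a field with $d$ coprime to $\mathrm{char}\,\Bbbk$ containing a primitive $d$-th root of unity $\xi$, and $q\in\Bbbk^\times$, $q\neq1$. $\mathcal Y_{d,n}(q)$ is the $\Bbbk$-algebra generated by $g_1,\dots,g_{n-1},t_1,\dots,t_n$ with relations $t_a^d=1$; $t_at_b=t_bt_a$; $t_ag_b=g_bt_{\sigma_b(a)}$; $g_a^2=q+(q-1)e_ag_a$; $g_ag_bg_a=g_bg_ag_b$ if $|a-b|=1$; $g_ag_b=g_bg_a$ if $|a-b|>1$, where $\sigma_b=(b,b+1)$ and $e_a=\frac1d\sum_{r=0}^{d-1}t_a^rt_{a+1}^{-r}$. Put $X_1=1$, $X_{a+1}=q^{-1}g_aX_ag_a$; the elements $X_1,\dots,X_n,t_1,\dots,t_n$ commute and each $X_a$ is invertible. **Idempotents.** Let $e=\min\{m\ge1:1+q+\dots+q^{m-1}=0\}$ ($e=0$ if none), $I=\mathbb Z/e\mathbb Z$, $J=\mathbb Z/d\mathbb Z$, $\mathcal K_n=(I\times J)^n$, with $\sigma_a$ acting by swapping the entries in places $a,a+1$. For $\boldsymbol k=((i_1,j_1),\dots,(i_n,j_n))$, the $e(\boldsymbol k)\in\mathcal Y_{d,n}(q)$ are the orthogonal idempotents with sum $1$ (finitely many nonzero) such that $e(\boldsymbol k)\mathcal Y_{d,n}(q)=\{x:(X_a-q^{i_a})^Nx=(t_a-\xi^{j_a})x=0\ \text{for all }a,\ N\gg0\}$. **Classes.**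 $\mathrm{Std}_{d,n}$ is the set of standard multitableaux of $d$-multipartitions of $n$ (bijective fillings by $1,\dots,n$, increasing along rows and columns in each component). For $\mathbf t\in\mathrm{Std}_{d,n}$ with $a$ ($1\le a\le n$) in row $r$, column $c$ of component $p$, put $c_{\mathbf t}(a)=q^{c-r}$ and $c_{\mathbf t}(n+a)=\xi^p$. $\mathbf s\sim_{q,t}\mathbf t$ iff $c_{\mathbf s}(a)=c_{\mathbf t}(a)$ for all $1\le a\le2n$. For a class $\mathcal T_{q,t}$, $\mathrm{res}(\mathcal T_{q,t})=((i_1,j_1),\dots,(i_n,j_n))\in\mathcal K_n$ is determined by $c_{\mathbf t}(a)=q^{i_a}$, $c_{\mathbf t}(n+a)=\xi^{j_a}$ for $\mathbf t\in\mathcal T_{q,t}$. **Intertwiners.** If $i_a\neq i_{a+1}$, then $1-X_aX_{a+1}^{-1}$ (equivalently $X_a-X_{a+1}$) acts invertibly on $e(\boldsymbol k)\mathcal Y_{d,n}(q)$; fractions such as $(1-X_aX_{a+1}^{-1})^{-1}e(\boldsymbol k)$ are understood via this inverse. For $1\le a<n$, $$\Phi_a=g_a+(1-q)\sum_{\substack{\boldsymbol k\in\mathcal K_n\\ i_a\ne i_{a+1},\ j_a=j_{a+1}}}(1-X_aX_{a+1}^{-1})^{-1}e(\boldsymbol k)+\sum_{\substack{\boldsymbol k\in\mathcal K_n\\ i_a=i_{a+1},\ j_a=j_{a+1}}}e(\boldsymbol k).$$ *)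

theory Defs
  imports
    "HOL-Algebra.QuotRing"
    "HOL-Algebra.Coset"
    "HOL-Library.Poly_Mapping"
    "HOL-Library.FuncSet"
    "HOL-Combinatorics.Transposition"
begin

section \<open>Free algebras\<close>

datatype 'x free_monoid = Word (letters: "'x list")

instantiation free_monoid :: (type) monoid_add
begin

definition zero_free_monoid :: "'a free_monoid"
  where "0 = Word []"

definition plus_free_monoid :: "'a free_monoid \<Rightarrow> 'a free_monoid \<Rightarrow> 'a free_monoid"
  where "u + v = Word (letters u @ letters v)"

instance
  by standard (simp_all add: zero_free_monoid_def plus_free_monoid_def)

end

text \<open>
  A finitely supported function from words to scalars is a noncommutative polynomial; the
  product that \<^type>\<open>poly_mapping\<close> carries over a (not necessarily commutative) additive monoid
  is then the concatenation product.
\<close>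

type_synonym ('x, 'k) nc_poly = "'x free_monoid \<Rightarrow>\<^sub>0 'k"

definition nc_gen :: "'x \<Rightarrow> ('x, 'k::comm_ring_1) nc_poly"
  where "nc_gen x = Poly_Mapping.single (Word [x]) 1"

definition nc_const :: "'k::comm_ring_1 \<Rightarrow> ('x, 'k) nc_poly"
  where "nc_const c = Poly_Mapping.single 0 c"

definition free_algebra :: "'x set \<Rightarrow> ('x, 'k::comm_ring_1) nc_poly ring"
  where "free_algebra S =
    \<lparr>carrier = {f. \<forall>w\<in>Poly_Mapping.keys f. set (letters w) \<subseteq> S},
     mult = (*), one = 1, zero = 0, add = (+)\<rparr>"


section \<open>The Yokonuma--Hecke algebra\<close>

datatype yh_gen = G nat | T nat

definition yh_gens :: "nat \<Rightarrow> yh_gen set"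
  where "yh_gens n = G ` {1..<n} \<union> T ` {1..n}"

text \<open>
  In the free algebra the generators \<open>t\<^sub>a\<close> are not invertible.  Since the relation \<open>t\<^sub>a\<^sup>d = 1\<close> is
  imposed, \<open>t ^ (d - r)\<close> represents \<open>t\<^sup>-\<^sup>r\<close> for \<open>0 \<le> r < d\<close>.
\<close>

definition yh_e :: "nat \<Rightarrow> nat \<Rightarrow> (yh_gen, 'k::field) nc_poly"
  where "yh_e d a =
    nc_const (1 / of_nat d) * (\<Sum>r<d. nc_gen (T a) ^ r * nc_gen (T (a + 1)) ^ (d - r))"

text \<open>A relation \<open>u = v\<close> is encoded as the element \<open>u - v\<close>.\<close>

definition yh_relators :: "nat \<Rightarrow> nat \<Rightarrow> 'k::field \<Rightarrow> (yh_gen, 'k) nc_poly set"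
  where "yh_relators d n q =
    (let g = (\<lambda>a. nc_gen (G a)); t = (\<lambda>a. nc_gen (T a)) in
      {t a ^ d - 1 | a. a \<in> {1..n}} \<union>
      {t a * t b - t b * t a | a b. a \<in> {1..n} \<and> b \<in> {1..n}} \<union>
      {t a * g b - g b * t (transpose b (b + 1) a) | a b. a \<in> {1..n} \<and> b \<in> {1..<n}} \<union>
      {g a ^ 2 - (nc_const q + nc_const (q - 1) * yh_e d a * g a) | a. a \<in> {1..<n}} \<union>
      {g a * g b * g a - g b * g a * g b | a b.
         a \<in> {1..<n} \<and> b \<in> {1..<n} \<and> \<bar>int a - int b\<bar> = 1} \<union>
      {g a * g b - g b * g a | a b.
         a \<in> {1..<n} \<and> b \<in> {1..<n} \<and> \<bar>int a - int b\<bar> > 1})"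

definition yh_ideal :: "nat \<Rightarrow> nat \<Rightarrow> 'k::field \<Rightarrow> (yh_gen, 'k) nc_poly set"
  where "yh_ideal d n q = genideal (free_algebra (yh_gens n)) (yh_relators d n q)"

definition yh_algebra :: "nat \<Rightarrow> nat \<Rightarrow> 'k::field \<Rightarrow> (yh_gen, 'k) nc_poly set ring"
  where "yh_algebra d n q = free_algebra (yh_gens n) Quot yh_ideal d n q"

definition yh_class :: "nat \<Rightarrow> nat \<Rightarrow> 'k::field \<Rightarrow> (yh_gen, 'k) nc_poly \<Rightarrow> (yh_gen, 'k) nc_poly set"
  where "yh_class d n q f = yh_ideal d n q +>\<^bsub>free_algebra (yh_gens n)\<^esub> f"

definition yh_g :: "nat \<Rightarrow> nat \<Rightarrow> 'k::field \<Rightarrow> nat \<Rightarrow> (yh_gen, 'k) nc_poly set"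
  where "yh_g d n q a = yh_class d n q (nc_gen (G a))"

definition yh_t :: "nat \<Rightarrow> nat \<Rightarrow> 'k::field \<Rightarrow> nat \<Rightarrow> (yh_gen, 'k) nc_poly set"
  where "yh_t d n q a = yh_class d n q (nc_gen (T a))"

text \<open>
  The structure map of the algebra: a scalar multiple \<open>c x\<close> is the product of
  \<open>yh_const d n q c\<close> and \<open>x\<close>.
\<close>

definition yh_const :: "nat \<Rightarrow> nat \<Rightarrow> 'k::field \<Rightarrow> 'k \<Rightarrow> (yh_gen, 'k) nc_poly set"
  where "yh_const d n q c = yh_class d n q (nc_const c)"

text \<open>The value at \<open>0\<close> is a dummy; the indices that matter are \<open>1, \<dots>, n\<close>.\<close>

fun yh_X :: "nat \<Rightarrow> nat \<Rightarrow> 'k::field \<Rightarrow> nat \<Rightarrow> (yh_gen, 'k) nc_poly set"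
  where
    "yh_X d n q 0 = \<one>\<^bsub>yh_algebra d n q\<^esub>"
  | "yh_X d n q (Suc 0) = \<one>\<^bsub>yh_algebra d n q\<^esub>"
  | "yh_X d n q (Suc (Suc a)) =
       yh_const d n q (inverse q) \<otimes>\<^bsub>yh_algebra d n q\<^esub> yh_g d n q (Suc a)
         \<otimes>\<^bsub>yh_algebra d n q\<^esub> yh_X d n q (Suc a) \<otimes>\<^bsub>yh_algebra d n q\<^esub> yh_g d n q (Suc a)"


section \<open>The idempotents\<close>

definition primitive_root_of_unity :: "nat \<Rightarrow> 'k::field \<Rightarrow> bool"
  where "primitive_root_of_unity d \<xi> \<longleftrightarrow> \<xi> ^ d = 1 \<and> (\<forall>m. 0 < m \<and> m < d \<longrightarrow> \<xi> ^ m \<noteq> 1)"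

definition quantum_char :: "'k::field \<Rightarrow> nat"
  where "quantum_char q =
    (if \<exists>m\<ge>1. (\<Sum>i<m. q ^ i) = 0 then LEAST m. m \<ge> 1 \<and> (\<Sum>i<m. q ^ i) = 0 else 0)"

text \<open>
  The integers modulo \<open>m\<close>, each class being given by its canonical representative.  As
  \<open>z mod 0 = z\<close>, the case \<open>m = 0\<close> yields all integers.
\<close>

definition zmod_reps :: "nat \<Rightarrow> int set"
  where "zmod_reps m = {z. z mod int m = z}"

definition yh_K :: "nat \<Rightarrow> nat \<Rightarrow> 'k::field \<Rightarrow> (nat \<Rightarrow> int \<times> int) set"
  where "yh_K d n q = {1..n} \<rightarrow>\<^sub>E zmod_reps (quantum_char q) \<times> zmod_reps d"

definition swap_places :: "nat \<Rightarrow> (nat \<Rightarrow> int \<times> int) \<Rightarrow> (nat \<Rightarrow> int \<times> int)"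
  where "swap_places a k = k \<circ> transpose a (a + 1)"

definition yh_weight_space ::
  "nat \<Rightarrow> nat \<Rightarrow> 'k::field \<Rightarrow> 'k \<Rightarrow> (nat \<Rightarrow> int \<times> int) \<Rightarrow> (yh_gen, 'k) nc_poly set set"
  where "yh_weight_space d n q \<xi> k =
    (let Y = yh_algebra d n q in
      {x \<in> carrier Y. \<exists>N0::nat. \<forall>N\<ge>N0. \<forall>a\<in>{1..n}.
         (yh_X d n q a \<ominus>\<^bsub>Y\<^esub> yh_const d n q (q powi fst (k a))) [^]\<^bsub>Y\<^esub> N \<otimes>\<^bsub>Y\<^esub> x = \<zero>\<^bsub>Y\<^esub> \<and>
         (yh_t d n q a \<ominus>\<^bsub>Y\<^esub> yh_const d n q (\<xi> powi snd (k a))) \<otimes>\<^bsub>Y\<^esub> x = \<zero>\<^bsub>Y\<^esub>})"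

text \<open>
  The index set is infinite if \<open>quantum_char q = 0\<close>, and \<^const>\<open>finsum\<close> over an infinite set is
  zero by convention, so sums are taken over the indices with nonzero summand only.
\<close>

definition yh_idempotent_family ::
  "nat \<Rightarrow> nat \<Rightarrow> 'k::field \<Rightarrow> 'k \<Rightarrow> ((nat \<Rightarrow> int \<times> int) \<Rightarrow> (yh_gen, 'k) nc_poly set) \<Rightarrow> bool"
  where "yh_idempotent_family d n q \<xi> E \<longleftrightarrow>
    (let Y = yh_algebra d n q; K = yh_K d n q in
      E \<in> K \<rightarrow>\<^sub>E carrier Y \<and>
      (\<forall>k\<in>K. \<forall>l\<in>K. E k \<otimes>\<^bsub>Y\<^esub> E l = (if k = l then E k else \<zero>\<^bsub>Y\<^esub>)) \<and>
      finite {k \<in> K. E k \<noteq> \<zero>\<^bsub>Y\<^esub>} \<and>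
      finsum Y E {k \<in> K. E k \<noteq> \<zero>\<^bsub>Y\<^esub>} = \<one>\<^bsub>Y\<^esub> \<and>
      (\<forall>k\<in>K. E k <#\<^bsub>Y\<^esub> carrier Y = yh_weight_space d n q \<xi> k))"

text \<open>
  The weight spaces determine the family: if \<open>E\<close> and \<open>F\<close> are two such families, then
  \<open>E k \<otimes> F l\<close> is \<open>F k\<close> for \<open>k = l\<close> and zero otherwise, whence \<open>E k = E k \<otimes> (\<Sum>l. F l) = F k\<close>.
\<close>

definition yh_idem ::
  "nat \<Rightarrow> nat \<Rightarrow> 'k::field \<Rightarrow> 'k \<Rightarrow> (nat \<Rightarrow> int \<times> int) \<Rightarrow> (yh_gen, 'k) nc_poly set"
  where "yh_idem d n q \<xi> = (THE E. yh_idempotent_family d n q \<xi> E)"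


section \<open>Standard multitableaux\<close>

definition is_partition :: "nat list \<Rightarrow> bool"
  where "is_partition \<mu> \<longleftrightarrow> sorted_wrt (\<ge>) \<mu> \<and> 0 \<notin> set \<mu>"

definition multipartitions :: "nat \<Rightarrow> nat \<Rightarrow> nat list list set"
  where "multipartitions d n =
    {\<mu>. length \<mu> = d \<and> (\<forall>\<nu>\<in>set \<mu>. is_partition \<nu>) \<and> sum_list (map sum_list \<mu>) = n}"

text \<open>A node is a triple (row, column, component), each counted from 1.\<close>

definition nodes :: "nat list list \<Rightarrow> (nat \<times> nat \<times> nat) set"
  where "nodes \<mu> = {(r, c, p). 1 \<le> p \<and> p \<le> length \<mu> \<and> 1 \<le> r \<and> r \<le> length (\<mu> ! (p - 1)) \<and>
                       1 \<le> c \<and> c \<le> \<mu> ! (p - 1) ! (r - 1)}"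

text \<open>A multitableau is a pair of its shape and its filling.\<close>

type_synonym multitableau = "nat list list \<times> (nat \<times> nat \<times> nat \<Rightarrow> nat)"

definition std_multitableaux :: "nat \<Rightarrow> nat \<Rightarrow> multitableau set"
  where "std_multitableaux d n =
    {(\<mu>, f). \<mu> \<in> multipartitions d n \<and> f \<in> extensional (nodes \<mu>) \<and> bij_betw f (nodes \<mu>) {1..n} \<and>
       (\<forall>r c p. (r, c, p) \<in> nodes \<mu> \<and> (r, c + 1, p) \<in> nodes \<mu> \<longrightarrow> f (r, c, p) < f (r, c + 1, p)) \<and>
       (\<forall>r c p. (r, c, p) \<in> nodes \<mu> \<and> (r + 1, c, p) \<in> nodes \<mu> \<longrightarrow> f (r, c, p) < f (r + 1, c, p))}"

definition node_of :: "multitableau \<Rightarrow> nat \<Rightarrow> nat \<times> nat \<times> nat"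
  where "node_of t a = the_inv_into (nodes (fst t)) (snd t) a"

definition tab_content :: "nat \<Rightarrow> 'k::field \<Rightarrow> 'k \<Rightarrow> multitableau \<Rightarrow> nat \<Rightarrow> 'k"
  where "tab_content n q \<xi> t a =
    (if a \<le> n then (case node_of t a of (r, c, p) \<Rightarrow> q powi (int c - int r))
     else (case node_of t (a - n) of (r, c, p) \<Rightarrow> \<xi> ^ p))"

definition tab_equiv :: "nat \<Rightarrow> nat \<Rightarrow> 'k::field \<Rightarrow> 'k \<Rightarrow> (multitableau \<times> multitableau) set"
  where "tab_equiv d n q \<xi> =
    {(s, t). s \<in> std_multitableaux d n \<and> t \<in> std_multitableaux d n \<and>
       (\<forall>a\<in>{1..2 * n}. tab_content n q \<xi> s a = tab_content n q \<xi> t a)}"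

definition tab_residue ::
  "nat \<Rightarrow> nat \<Rightarrow> 'k::field \<Rightarrow> 'k \<Rightarrow> multitableau set \<Rightarrow> (nat \<Rightarrow> int \<times> int)"
  where "tab_residue d n q \<xi> \<T> =
    (THE k. k \<in> yh_K d n q \<and>
       (\<forall>t\<in>\<T>. \<forall>a\<in>{1..n}. tab_content n q \<xi> t a = q powi fst (k a) \<and>
                         tab_content n q \<xi> t (n + a) = \<xi> powi snd (k a)))"


section \<open>The intertwiners\<close>

text \<open>
  \<open>u\<^sup>-\<^sup>1f\<close> for an idempotent \<open>f\<close> such that \<open>u\<close> acts invertibly on \<open>fR\<close> by left multiplication: the
  image of \<open>f\<close> under the inverse of that action.
\<close>

definition local_inv :: "('r, 'm) ring_scheme \<Rightarrow> 'r \<Rightarrow> 'r \<Rightarrow> 'r"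
  where "local_inv R u f = the_inv_into (f <#\<^bsub>R\<^esub> carrier R) (\<lambda>x. u \<otimes>\<^bsub>R\<^esub> x) f"

definition yh_Phi ::
  "nat \<Rightarrow> nat \<Rightarrow> 'k::field \<Rightarrow> 'k \<Rightarrow> nat \<Rightarrow> (yh_gen, 'k) nc_poly set"
  where "yh_Phi d n q \<xi> a =
    (let Y = yh_algebra d n q; X = yh_X d n q; E = yh_idem d n q \<xi>;
         supp = {k \<in> yh_K d n q. E k \<noteq> \<zero>\<^bsub>Y\<^esub>} in
      yh_g d n q a
      \<oplus>\<^bsub>Y\<^esub> yh_const d n q (1 - q) \<otimes>\<^bsub>Y\<^esub>
           finsum Y (\<lambda>k. local_inv Y (\<one>\<^bsub>Y\<^esub> \<ominus>\<^bsub>Y\<^esub> X a \<otimes>\<^bsub>Y\<^esub> inv\<^bsub>Y\<^esub> X (a + 1)) (E k))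
             {k \<in> supp. fst (k a) \<noteq> fst (k (a + 1)) \<and> snd (k a) = snd (k (a + 1))}
      \<oplus>\<^bsub>Y\<^esub> finsum Y E
             {k \<in> supp. fst (k a) = fst (k (a + 1)) \<and> snd (k a) = snd (k (a + 1))})"

end

theory Submission
  imports Defs "HOL.Vector_Spaces"
begin

text \<open>
  On a weight space the intertwiner is \<open>\<Phi>\<^sub>a e(k) = g\<^sub>a e(k) + \<beta>\<^sub>a\<^sub>,\<^sub>a\<^sub>+\<^sub>1(k)\<close>, where the
  coefficient \<open>\<beta>\<^sub>x\<^sub>y(k)\<close> is \<open>(1 - q) X\<^sub>y / (X\<^sub>y - X\<^sub>x)\<close>, the idempotent \<open>e(k)\<close>, or zero,
  according as the places \<open>x\<close> and \<open>y\<close> of \<open>k\<close> have equal second but different first entries, are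
  equal, or have different second entries. The coefficients lie in the commutative algebra
  generated by the \<open>X\<^sub>b\<close> and \<open>t\<^sub>b\<close>, and \<open>g\<^sub>a\<close> satisfies the exchange rules
  \<open>g\<^sub>a X\<^sub>a = X\<^sub>a\<^sub>+\<^sub>1 g\<^sub>a - (q - 1) e\<^sub>a X\<^sub>a\<^sub>+\<^sub>1\<close> and
  \<open>g\<^sub>a X\<^sub>a\<^sub>+\<^sub>1 = X\<^sub>a g\<^sub>a + (q - 1) e\<^sub>a X\<^sub>a\<^sub>+\<^sub>1\<close>, whose correction terms the coefficients absorb
  (\<open>\<Phi>_X_defect\<close>). If the places \<open>a\<close> and \<open>a + 1\<close> of \<open>k\<close> are equal, a correction in \<open>X\<^sub>a\<close> and
  \<open>X\<^sub>a\<^sub>+\<^sub>1\<close> remains, but it has the same weight. So \<open>\<Phi>\<^sub>a\<close> maps the weight \<open>k\<close> to the weight \<open>\<sigma>\<^sub>a k\<close>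
  in all cases (\<open>weight_\<Phi>\<close>, \<open>\<Phi>_E_swap\<close>).

  An operator that carries the weight \<open>k\<close> to \<open>k'\<close> and moves \<open>X\<^sub>x\<close>, \<open>X\<^sub>y\<close> to \<open>X\<^sub>x\<^sub>'\<close>, \<open>X\<^sub>y\<^sub>'\<close> also
  moves \<open>\<beta>\<^sub>x\<^sub>y(k)\<close> to \<open>\<beta>\<^sub>x\<^sub>'\<^sub>y\<^sub>'(k')\<close>, since differences of the \<open>X\<close> can be cancelled where their
  eigenvalues differ (\<open>\<beta>_transport\<close>). This gives the commutation of distant intertwiners. If the
  places \<open>a\<close> and \<open>b = a + 1\<close> of \<open>k\<close> differ, it also gives
  \<open>\<Phi>\<^sub>a\<^sup>2 e(k) = q e(k) + \<beta>\<^sub>a\<^sub>b \<beta>\<^sub>b\<^sub>a\<close>, because \<open>\<beta>\<^sub>a\<^sub>b + \<beta>\<^sub>b\<^sub>a\<close> cancels the linear term of the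
  quadratic relation.

  For the braid relation, products of intertwiners are expanded into words in the \<open>g\<close> followed
  by coefficients. If the three places \<open>a\<close>, \<open>b = a + 1\<close>, \<open>r = a + 2\<close> of \<open>k\<close> are pairwise
  different, the claim comes down to the partial fraction identity
  \<open>\<beta>\<^sub>a\<^sub>b \<beta>\<^sub>b\<^sub>r = \<beta>\<^sub>a\<^sub>r (\<beta>\<^sub>a\<^sub>b + \<beta>\<^sub>b\<^sub>r - (1 - q))\<close>. If exactly two of them coincide, some
  intertwiner is \<open>g + 1\<close>, and coefficients have to be moved past \<open>g\<close> at equal places, which
  yields quadratic terms (\<open>\<beta>_g_first\<close>, \<open>\<beta>_g_second\<close>). These cancel if the equal places are
  adjacent. If they are the outer ones, then \<open>(\<beta>\<^sub>a\<^sub>b - \<beta>\<^sub>b\<^sub>r) \<beta>\<^sub>a\<^sub>b \<beta>\<^sub>b\<^sub>r + \<beta>\<^sub>a\<^sub>b \<beta>\<^sub>b\<^sub>a - \<beta>\<^sub>b\<^sub>r \<beta>\<^sub>r\<^sub>b\<close>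
  survives, and this is \<open>Z\<^sub>a e(k)\<close> (\<open>braid_outer_equal\<close>, \<open>braid_fraction\<close>). If all three
  coincide, both intertwiners are \<open>g + 1\<close> throughout, and the quadratic relation gives the
  claim.

  The weight idempotents exist because every \<open>X\<^sub>a\<close> is a root of a product of linear factors whose
  roots are powers of \<open>q\<close> (\<open>X_split\<close>). This is shown by induction on \<open>a\<close> with the
  denominator-free intertwiner \<open>g\<^sub>a (X\<^sub>a\<^sub>+\<^sub>1 - X\<^sub>a) + (1 - q) e\<^sub>a X\<^sub>a\<^sub>+\<^sub>1\<close>, whose square is a
  polynomial in \<open>X\<^sub>a\<close> and \<open>X\<^sub>a\<^sub>+\<^sub>1\<close> on the images of \<open>e\<^sub>a\<close> and \<open>1 - e\<^sub>a\<close>.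

  All of this takes place in an arbitrary unital ring containing elements that satisfy the
  defining relations. It is applied to the images of the generators under an injective
  homomorphism from the quotient of the free algebra to a ring of linear maps (\<open>class_rep_inj\<close>),
  and the relations are then pulled back.
\<close>

section \<open>Commuting eigenvalue problems in an algebra\<close>

locale central_algebra =
  fixes c :: "'k::field \<Rightarrow> 'r::ring_1"
  assumes c_add: "c (x + y) = c x + c y"
    and c_mult: "c (x * y) = c x * c y"
    and c_1: "c 1 = 1"
    and c_comm: "c x * r = r * c x"
begin

lemma c_0: "c 0 = 0"
  using c_add[of 0 0] by simp

lemma c_minus: "c (- x) = - c x"
  using c_add[of x "- x"] by (simp add: c_0 add_eq_0_iff)

lemma c_diff: "c (x - y) = c x - c y"
  using c_add[of x "- y"] by (simp add: c_minus)

lemma c_sum: "c (sum f S) = (\<Sum>s\<in>S. c (f s))"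
  by (induction S rule: infinite_finite_induct) (simp_all add: c_0 c_add)

lemma c_comm_left: "r * (c x * s) = c x * (r * s)"
  by (metis c_comm mult.assoc)

lemma c_cancel: "x \<noteq> 0 \<Longrightarrow> c x * r = c x * s \<Longrightarrow> r = s"
  by (metis c_1 c_mult left_inverse mult.assoc mult_1)

lemma c_eq_0: "x \<noteq> 0 \<Longrightarrow> c x * r = 0 \<Longrightarrow> r = 0"
  using c_cancel[of x r 0] by simp

text \<open>
  Used to record that a constructed element is a polynomial in given elements: it then commutes
  with whatever commutes with these, and lies in every subalgebra that contains them.
\<close>

inductive_set subalgebra :: "'r set \<Rightarrow> 'r set" for B :: "'r set" where
  gen: "b \<in> B \<Longrightarrow> b \<in> subalgebra B"
| scalar: "c x \<in> subalgebra B"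
| add: "x \<in> subalgebra B \<Longrightarrow> y \<in> subalgebra B \<Longrightarrow> x + y \<in> subalgebra B"
| mult: "x \<in> subalgebra B \<Longrightarrow> y \<in> subalgebra B \<Longrightarrow> x * y \<in> subalgebra B"

lemma subalgebra_0: "0 \<in> subalgebra B"
  using subalgebra.scalar[of 0] by (simp add: c_0)

lemma subalgebra_1: "1 \<in> subalgebra B"
  using subalgebra.scalar[of 1] by (simp add: c_1)

lemma subalgebra_minus: "x \<in> subalgebra B \<Longrightarrow> - x \<in> subalgebra B"
  using subalgebra.mult[OF subalgebra.scalar[of "- 1"], of x] by (simp add: c_minus c_1)

lemma subalgebra_diff: "x \<in> subalgebra B \<Longrightarrow> y \<in> subalgebra B \<Longrightarrow> x - y \<in> subalgebra B"
  using subalgebra.add[of x B "- y"] by (simp add: subalgebra_minus)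

lemma subalgebra_power: "x \<in> subalgebra B \<Longrightarrow> x ^ m \<in> subalgebra B"
  by (induction m) (simp_all add: subalgebra_1 subalgebra.mult)

lemma subalgebra_sum: "(\<And>s. s \<in> S \<Longrightarrow> f s \<in> subalgebra B) \<Longrightarrow> sum f S \<in> subalgebra B"
  by (induction S rule: infinite_finite_induct) (simp_all add: subalgebra_0 subalgebra.add)

lemmas subalgebra_closed = subalgebra.scalar subalgebra.add subalgebra.mult
  subalgebra_0 subalgebra_1 subalgebra_minus subalgebra_diff subalgebra_power

lemma subalgebra_commute:
  assumes "x \<in> subalgebra B" and "\<And>b. b \<in> B \<Longrightarrow> y * b = b * y"
  shows "y * x = x * y"
  using assms(1)
proof induction
  case (mult x x')
  then show ?case by (metis mult.assoc)
qed (simp_all add: assms(2) c_comm distrib_left distrib_right)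

text \<open>
  An invertible scalar plus a difference of nilpotents is invertible. Instead of a geometric
  series, the preimage \<open>w\<close> of \<open>z\<close> is obtained by induction on the nilpotency exponents: the
  equation \<open>(\<gamma> + p - r) w = z\<close> means \<open>w = \<gamma>\<^sup>-\<^sup>1 (z - p w + r w)\<close>, where \<open>p w\<close> and
  \<open>r w\<close> are the preimages of \<open>p z\<close> and \<open>r z\<close>.
\<close>

lemma solve_invertible:
  assumes "\<gamma> \<noteq> 0" and "p * r = r * p"
  shows "p ^ N * z = 0 \<Longrightarrow> r ^ M * z = 0 \<Longrightarrow>
    \<exists>h\<in>subalgebra {p, r}. (c \<gamma> + p - r) * (h * z) = z"
proof (induction "N + M" arbitrary: N M z)
  case 0
  then show ?case by (auto intro: subalgebra_0)
next
  case (Suc m)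
  show ?case
  proof (cases "N = 0 \<or> M = 0")
    case True
    then have "z = 0" using Suc.prems by auto
    then show ?thesis by (auto intro: subalgebra_0)
  next
    case False
    then obtain N' M' where NM: "N = Suc N'" "M = Suc M'" by (metis not0_implies_Suc)
    have comm: "r ^ M * p = p * r ^ M" "p ^ N * r = r * p ^ N"
      using assms(2) by (metis power_commuting_commutes)+
    have "\<exists>h\<in>subalgebra {p, r}. (c \<gamma> + p - r) * (h * (p * z)) = p * z"
    proof (rule Suc.hyps(1)[of N' M])
      show "p ^ N' * (p * z) = 0" using Suc.prems(1) NM by (metis mult.assoc power_Suc2)
      show "r ^ M * (p * z) = 0" using Suc.prems(2) comm(1) by (metis mult.assoc mult_zero_right)
    qed (use Suc NM in auto)
    then obtain h' where h': "h' \<in> subalgebra {p, r}" "(c \<gamma> + p - r) * (h' * (p * z)) = p * z"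
      by blast
    have "\<exists>h\<in>subalgebra {p, r}. (c \<gamma> + p - r) * (h * (r * z)) = r * z"
    proof (rule Suc.hyps(1)[of N M'])
      show "r ^ M' * (r * z) = 0" using Suc.prems(2) NM by (metis mult.assoc power_Suc2)
      show "p ^ N * (r * z) = 0" using Suc.prems(1) comm(2) by (metis mult.assoc mult_zero_right)
    qed (use Suc NM in auto)
    then obtain h'' where h'': "h'' \<in> subalgebra {p, r}" "(c \<gamma> + p - r) * (h'' * (r * z)) = r * z"
      by blast
    let ?h = "c (inverse \<gamma>) * (1 - h' * p + h'' * r)"
    have "(c \<gamma> + p - r) * (?h * z) =
        c (inverse \<gamma>) * ((c \<gamma> + p - r) * (z - h' * (p * z) + h'' * (r * z)))"
      by (simp add: c_comm_left mult.assoc distrib_right left_diff_distrib)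
    also have "(c \<gamma> + p - r) * (z - h' * (p * z) + h'' * (r * z)) = (c \<gamma> + p - r) * z - p * z + r * z"
      by (simp only: distrib_left right_diff_distrib h' h'')
    also have "\<dots> = c \<gamma> * z"
      by (simp add: distrib_right left_diff_distrib)
    also have "c (inverse \<gamma>) * (c \<gamma> * z) = z"
      using assms(1) by (metis c_1 c_mult left_inverse mult.assoc mult_1)
    finally show ?thesis
      using h'(1) h''(1) by (intro bexI[of _ ?h]) (auto intro!: subalgebra_closed intro: subalgebra.gen)
  qed
qed

lemma linear_factors_commute: "(x - c \<alpha>) * (x - c \<beta>) = (x - c \<beta>) * (x - c \<alpha>)"
  by (simp add: left_diff_distrib right_diff_distrib c_comm[of _ x] c_comm[of \<alpha> "c \<beta>"])

lemma eigenvalues_disjoint: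
  assumes "\<alpha> \<noteq> \<beta>"
  shows "(x - c \<alpha>) ^ N * z = 0 \<Longrightarrow> (x - c \<beta>) ^ M * z = 0 \<Longrightarrow> z = 0"
proof (induction "N + M" arbitrary: N M z)
  case 0
  then show ?case by auto
next
  case (Suc m)
  show ?case
  proof (cases "N = 0 \<or> M = 0")
    case True
    then show ?thesis using Suc.prems by auto
  next
    case False
    then obtain N' M' where NM: "N = Suc N'" "M = Suc M'" by (metis not0_implies_Suc)
    have comm0: "(x - c \<alpha>) * (x - c \<beta>) = (x - c \<beta>) * (x - c \<alpha>)"
      by (rule linear_factors_commute)
    have comm: "(x - c \<beta>) ^ M * (x - c \<alpha>) = (x - c \<alpha>) * (x - c \<beta>) ^ M"
      "(x - c \<alpha>) ^ N * (x - c \<beta>) = (x - c \<beta>) * (x - c \<alpha>) ^ N"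
      using comm0 by (metis power_commuting_commutes)+
    have 1: "(x - c \<alpha>) * z = 0"
    proof (rule Suc.hyps(1)[of N' M])
      show "(x - c \<alpha>) ^ N' * ((x - c \<alpha>) * z) = 0"
        using Suc.prems(1) NM by (metis mult.assoc power_Suc2)
      show "(x - c \<beta>) ^ M * ((x - c \<alpha>) * z) = 0"
        using Suc.prems(2) comm(1) by (metis mult.assoc mult_zero_right)
    qed (use Suc NM in auto)
    have 2: "(x - c \<beta>) * z = 0"
    proof (rule Suc.hyps(1)[of N M'])
      show "(x - c \<beta>) ^ M' * ((x - c \<beta>) * z) = 0"
        using Suc.prems(2) NM by (metis mult.assoc power_Suc2)
      show "(x - c \<alpha>) ^ N * ((x - c \<beta>) * z) = 0"
        using Suc.prems(1) comm(2) by (metis mult.assoc mult_zero_right)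
    qed (use Suc NM in auto)
    have "c (\<alpha> - \<beta>) * z = 0"
      using 1 2 by (simp add: c_diff left_diff_distrib)
    then show ?thesis using assms c_eq_0 by (metis right_minus_eq)
  qed
qed

text \<open>
  The decomposition into generalised eigenvectors, with every component a polynomial in \<open>x\<close>. When
  the root \<open>\<beta>\<close> is added, the components of \<open>(x - \<beta>) y\<close> for the other roots are divided by
  \<open>x - \<beta>\<close>, which is invertible there, and the rest of \<open>y\<close> becomes the component for \<open>\<beta>\<close>. This
  handles repeated roots without a coprimality argument.
\<close>

lemma primary_decomposition:
  "y \<in> subalgebra {x} \<Longrightarrow> prod_list (map (\<lambda>\<alpha>. x - c \<alpha>) L) * y = 0 \<Longrightarrow>
    \<exists>f. \<exists>N. (\<forall>\<alpha>. f \<alpha> \<in> subalgebra {x} \<and> (x - c \<alpha>) ^ N * f \<alpha> = 0) \<and>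
      (\<forall>\<alpha>. \<alpha> \<notin> set L \<longrightarrow> f \<alpha> = 0) \<and> y = (\<Sum>\<alpha>\<in>set L. f \<alpha>)"
proof (induction L arbitrary: y)
  case Nil
  then show ?case by (intro exI[of _ "\<lambda>_. 0"] exI[of _ 1]) (auto intro: subalgebra_0)
next
  case (Cons \<beta> L)
  have "prod_list (map (\<lambda>\<alpha>. x - c \<alpha>) L) * (x - c \<beta>) = (x - c \<beta>) * prod_list (map (\<lambda>\<alpha>. x - c \<alpha>) L)"
    by (induction L) (simp_all, metis linear_factors_commute mult.assoc)
  then have "prod_list (map (\<lambda>\<alpha>. x - c \<alpha>) L) * ((x - c \<beta>) * y) = 0"
    using Cons.prems(2) by (simp add: mult.assoc[symmetric])
  moreover have "(x - c \<beta>) * y \<in> subalgebra {x}"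
    using Cons.prems(1) by (auto intro: subalgebra_closed subalgebra.gen)
  ultimately obtain f N where f: "\<And>\<alpha>. f \<alpha> \<in> subalgebra {x}" "\<And>\<alpha>. (x - c \<alpha>) ^ N * f \<alpha> = 0"
    "\<And>\<alpha>. \<alpha> \<notin> set L \<Longrightarrow> f \<alpha> = 0" "(x - c \<beta>) * y = (\<Sum>\<alpha>\<in>set L. f \<alpha>)"
    using Cons.IH[of "(x - c \<beta>) * y"] by metis
  have "\<exists>h\<in>subalgebra {x}. (x - c \<beta>) * (h * f \<alpha>) = f \<alpha>" if "\<alpha> \<noteq> \<beta>" for \<alpha>
  proof -
    have "(x - c \<alpha>) * 0 = 0 * (x - c \<alpha>)" by simp
    moreover have "(0::'r) ^ 1 * f \<alpha> = 0" by simp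
    moreover have "\<alpha> - \<beta> \<noteq> 0" using that by simp
    ultimately obtain h where h: "h \<in> subalgebra {x - c \<alpha>, 0}"
        "(c (\<alpha> - \<beta>) + (x - c \<alpha>) - 0) * (h * f \<alpha>) = f \<alpha>"
      using solve_invertible[of "\<alpha> - \<beta>" "x - c \<alpha>" 0 N "f \<alpha>" 1] f(2) by blast
    have "h \<in> subalgebra {x}"
      using h(1) by induction (auto intro: subalgebra_closed subalgebra.gen)
    then show ?thesis using h(2) by (auto simp: c_diff)
  qed
  then obtain h where h: "\<And>\<alpha>. \<alpha> \<noteq> \<beta> \<Longrightarrow> h \<alpha> \<in> subalgebra {x}"
    "\<And>\<alpha>. \<alpha> \<noteq> \<beta> \<Longrightarrow> (x - c \<beta>) * (h \<alpha> * f \<alpha>) = f \<alpha>"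
    by metis
  define F where "F \<alpha> = (if \<alpha> = \<beta> then y - (\<Sum>\<alpha>\<in>set L - {\<beta>}. h \<alpha> * f \<alpha>) else h \<alpha> * f \<alpha>)" for \<alpha>
  have F_mem: "F \<alpha> \<in> subalgebra {x}" for \<alpha>
    unfolding F_def using h(1) f(1) Cons.prems(1)
    by (auto intro!: subalgebra_closed subalgebra_sum)
  have "(x - c \<beta>) * F \<beta> = f \<beta>"
  proof -
    have "(x - c \<beta>) * F \<beta> = (\<Sum>\<alpha>\<in>set L. f \<alpha>) - (\<Sum>\<alpha>\<in>set L - {\<beta>}. f \<alpha>)"
      unfolding F_def using h(2) by (simp add: right_diff_distrib sum_distrib_left f(4))
    also have "\<dots> = f \<beta>"
      using f(3)[of \<beta>] by (cases "\<beta> \<in> set L") (simp_all add: sum.remove[of "set L" \<beta>])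
    finally show ?thesis .
  qed
  then have F_\<beta>: "(x - c \<beta>) ^ Suc N * F \<beta> = 0"
    by (simp only: power_Suc2 mult.assoc f(2))
  have F_pow: "(x - c \<alpha>) ^ Suc N * F \<alpha> = 0" for \<alpha>
  proof (cases "\<alpha> = \<beta>")
    case False
    have "h \<alpha> * x = x * h \<alpha>"
      using subalgebra_commute[OF h(1)[OF False], of x] by auto
    then have "h \<alpha> * (x - c \<alpha>) = (x - c \<alpha>) * h \<alpha>"
      by (simp add: left_diff_distrib right_diff_distrib c_comm)
    then have "h \<alpha> * (x - c \<alpha>) ^ N = (x - c \<alpha>) ^ N * h \<alpha>"
      by (metis power_commuting_commutes)
    then have "(x - c \<alpha>) ^ N * (h \<alpha> * f \<alpha>) = 0"
      by (metis f(2) mult.assoc mult_zero_right)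
    then show ?thesis using False by (simp add: F_def mult.assoc)
  qed (use F_\<beta> in simp)
  have "y = (\<Sum>\<alpha>\<in>set (\<beta> # L). F \<alpha>)"
  proof -
    have "(\<Sum>\<alpha>\<in>set (\<beta> # L). F \<alpha>) = F \<beta> + (\<Sum>\<alpha>\<in>set L - {\<beta>}. F \<alpha>)"
      by (simp add: sum.insert_remove)
    also have "(\<Sum>\<alpha>\<in>set L - {\<beta>}. F \<alpha>) = (\<Sum>\<alpha>\<in>set L - {\<beta>}. h \<alpha> * f \<alpha>)"
      by (rule sum.cong) (auto simp: F_def)
    finally show ?thesis by (simp add: F_def)
  qed
  moreover have "F \<alpha> = 0" if "\<alpha> \<notin> set (\<beta> # L)" for \<alpha>
    using that f(3) by (simp add: F_def)
  ultimately show ?case using F_mem F_pow by blast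
qed

end

section \<open>The Yokonuma--Hecke relations\<close>

text \<open>
  If one element intertwines several pairs, it intertwines their products; applied repeatedly,
  this moves an element through a word.
\<close>

lemma intertwine_mult:
  fixes y :: "'a::semigroup_mult"
  assumes "y * u = u' * y'" and "y' * v = v' * y''"
  shows "y * (u * v) = u' * v' * y''"
  by (simp only: assms mult.assoc[symmetric]) (simp only: assms mult.assoc)

locale yokonuma_hecke = central_algebra c for c :: "'k::field \<Rightarrow> 'r::ring_1" +
  fixes d n :: nat and q \<xi> :: 'k and g t :: "nat \<Rightarrow> 'r"
  assumes d_pos: "d \<ge> 1" and d_char: "of_nat d \<noteq> (0::'k)"
    and \<xi>_primitive: "primitive_root_of_unity d \<xi>"
    and q_neq_0: "q \<noteq> 0" and q_neq_1: "q \<noteq> 1"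
    and t_order: "a \<in> {1..n} \<Longrightarrow> t a ^ d = 1"
    and t_t: "a \<in> {1..n} \<Longrightarrow> b \<in> {1..n} \<Longrightarrow> t a * t b = t b * t a"
    and t_g: "a \<in> {1..n} \<Longrightarrow> b \<in> {1..<n} \<Longrightarrow> t a * g b = g b * t (transpose b (b + 1) a)"
    and g_quadratic: "a \<in> {1..<n} \<Longrightarrow> g a * g a =
      c q + c (q - 1) * (c (1 / of_nat d) * (\<Sum>r<d. t a ^ r * t (a + 1) ^ (d - r))) * g a"
    and g_braid: "a \<in> {1..<n} \<Longrightarrow> a + 1 \<in> {1..<n} \<Longrightarrow>
      g a * g (a + 1) * g a = g (a + 1) * g a * g (a + 1)"
    and g_far: "a \<in> {1..<n} \<Longrightarrow> b \<in> {1..<n} \<Longrightarrow> a + 1 < b \<Longrightarrow> g a * g b = g b * g a"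
begin

definition e :: "nat \<Rightarrow> 'r"
  where "e a = c (1 / of_nat d) * (\<Sum>r<d. t a ^ r * t (a + 1) ^ (d - r))"

fun X :: "nat \<Rightarrow> 'r"
  where
    "X 0 = 1"
  | "X (Suc 0) = 1"
  | "X (Suc (Suc a)) = c (inverse q) * g (Suc a) * X (Suc a) * g (Suc a)"

text \<open>
  The quadratic relation makes \<open>q\<^sup>-\<^sup>1 h\<^sub>a\<close> the inverse of \<open>g\<^sub>a\<close>.
\<close>

definition h :: "nat \<Rightarrow> 'r" where "h a = g a - c (q - 1) * e a"

fun X_inv :: "nat \<Rightarrow> 'r"
  where
    "X_inv 0 = 1"
  | "X_inv (Suc 0) = 1"
  | "X_inv (Suc (Suc a)) = c (inverse q) * h (Suc a) * X_inv (Suc a) * h (Suc a)"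

lemmas c_left =
  c_comm_left[of "g a" for a] c_comm_left[of "h a" for a] c_comm_left[of "t a" for a]
  c_comm_left[of "e a" for a] c_comm_left[of "X a" for a] c_comm_left[of "X_inv a" for a]

lemma e_commute:
  assumes "y * t a = t a * y" and "y * t (a + 1) = t (a + 1) * y"
  shows "y * e a = e a * y"
proof -
  have p: "y * t a ^ r = t a ^ r * y" "y * t (a + 1) ^ r = t (a + 1) ^ r * y" for r
    using power_commuting_commutes[of "t a" y r] power_commuting_commutes[of "t (a + 1)" y r] assms
    by auto
  have "y * (t a ^ r * t (a + 1) ^ s) = t a ^ r * (t (a + 1) ^ s * y)" for r s
    by (simp only: p mult.assoc[symmetric]) (simp only: p mult.assoc)
  then show ?thesis
    unfolding e_def by (simp add: sum_distrib_left sum_distrib_right c_comm_left mult.assoc)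
qed

lemma t_power_commute:
  assumes "a \<in> {1..n}" "b \<in> {1..n}"
  shows "t a ^ r * t b ^ s = t b ^ s * t a ^ r"
  using power_commuting_commutes[OF power_commuting_commutes[OF t_t[OF assms], symmetric], of s r]
  by simp

text \<open>
  Substituting \<open>d - r\<close> for \<open>r\<close> swaps the roles of \<open>t\<^sub>a\<close> and \<open>t\<^sub>a\<^sub>+\<^sub>1\<close>; as the sum runs over
  \<open>r < d\<close>, the range is first shifted by one, using \<open>t\<^sup>d = 1\<close>.
\<close>

lemma e_flip:
  assumes "a \<in> {1..<n}"
  shows "e a = c (1 / of_nat d) * (\<Sum>r<d. t (a + 1) ^ r * t a ^ (d - r))"
proof -
  have a: "a \<in> {1..n}" "a + 1 \<in> {1..n}" using assms by auto
  let ?F = "\<lambda>r. t a ^ r * t (a + 1) ^ (d - r)"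
  have "(\<Sum>r<d. ?F (Suc r)) - (\<Sum>r<d. ?F r) = ?F d - ?F 0"
    by (subst sum_subtractf[symmetric]) (rule sum_lessThan_telescope)
  also have "\<dots> = 0" using t_order[OF a(1)] t_order[OF a(2)] by simp
  finally have "(\<Sum>r<d. ?F r) = (\<Sum>r<d. ?F (Suc r))" by simp
  also have "\<dots> = (\<Sum>r<d. ?F (Suc (d - Suc r)))"
    by (rule sum.nat_diff_reindex[symmetric])
  also have "\<dots> = (\<Sum>r<d. t (a + 1) ^ r * t a ^ (d - r))"
    using t_power_commute[OF a] by (intro sum.cong) (simp_all add: Suc_diff_Suc)
  finally show ?thesis by (simp add: e_def)
qed

lemma e_g:
  assumes "a \<in> {1..<n}"
  shows "e a * g a = g a * e a"
proof -
  have a: "a \<in> {1..n}" "a + 1 \<in> {1..n}" using assms by auto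
  have 1: "t a * g a = g a * t (a + 1)" "t (a + 1) * g a = g a * t a"
    using t_g[OF a(1) assms] t_g[OF a(2) assms] by simp_all
  have p1: "t a ^ r * g a = g a * t (a + 1) ^ r" for r
    by (induction r) (simp_all only: power_Suc mult.assoc power_0 mult_1 mult_1_right,
        simp only: 1 mult.assoc[symmetric])
  have p2: "t (a + 1) ^ r * g a = g a * t a ^ r" for r
    by (induction r) (simp_all only: power_Suc mult.assoc power_0 mult_1 mult_1_right,
        simp only: 1 mult.assoc[symmetric])
  have "t a ^ r * t (a + 1) ^ s * g a = g a * (t (a + 1) ^ r * t a ^ s)" for r s
    by (simp only: p2 mult.assoc) (simp only: p1 mult.assoc[symmetric])
  then have "e a * g a = g a * (c (1 / of_nat d) * (\<Sum>r<d. t (a + 1) ^ r * t a ^ (d - r)))"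
    unfolding e_def by (simp add: sum_distrib_left sum_distrib_right c_comm_left mult.assoc)
  then show ?thesis by (simp only: e_flip[OF assms])
qed

text \<open>
  Multiplication by \<open>t\<^sub>a t\<^sub>a\<^sub>+\<^sub>1\<^sup>-\<^sup>1\<close> permutes the summands of \<open>e\<^sub>a\<close> cyclically.
\<close>

lemma t_e:
  assumes "a \<in> {1..<n}"
  shows "t a * e a = t (a + 1) * e a"
proof -
  have a: "a \<in> {1..n}" "a + 1 \<in> {1..n}" using assms by auto
  let ?F = "\<lambda>r. t a ^ r * t (a + 1) ^ (d + 1 - r)"
  have "t (a + 1) * (t a ^ r * t (a + 1) ^ (d - r)) = ?F r" if "r < d" for r
  proof -
    have "t (a + 1) * t a ^ r = t a ^ r * t (a + 1)"
      using t_power_commute[OF a(2) a(1), of 1 r] by simp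
    then have "t (a + 1) * (t a ^ r * t (a + 1) ^ (d - r)) = t a ^ r * (t (a + 1) * t (a + 1) ^ (d - r))"
      by (simp only: mult.assoc[symmetric])
    then show ?thesis using that by (simp add: Suc_diff_le)
  qed
  then have F: "t (a + 1) * (\<Sum>r<d. t a ^ r * t (a + 1) ^ (d - r)) = (\<Sum>r<d. ?F r)"
    by (simp add: sum_distrib_left)
  have "t a * (\<Sum>r<d. t a ^ r * t (a + 1) ^ (d - r)) = (\<Sum>r<d. ?F (Suc r))"
    by (simp add: sum_distrib_left mult.assoc)
  then have "t a * e a - t (a + 1) * e a = c (1 / of_nat d) * (\<Sum>r<d. ?F (Suc r) - ?F r)"
    using F unfolding e_def
    by (simp add: c_left sum_subtractf right_diff_distrib)
  also have "(\<Sum>r<d. ?F (Suc r) - ?F r) = ?F d - ?F 0"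
    by (rule sum_lessThan_telescope)
  also have "\<dots> = 0" using t_order[OF a(1)] t_order[OF a(2)] by simp
  finally show ?thesis by simp
qed

lemma e_idem:
  assumes "a \<in> {1..<n}"
  shows "e a * e a = e a"
proof -
  have a: "a \<in> {1..n}" "a + 1 \<in> {1..n}" using assms by auto
  have 1: "t a ^ r * e a = t (a + 1) ^ r * e a" for r
  proof (induction r)
    case (Suc r)
    have "t a ^ Suc r * e a = t a ^ r * (t (a + 1) * e a)"
      by (simp only: power_Suc2 mult.assoc t_e[OF assms])
    also have "\<dots> = t (a + 1) * (t a ^ r * e a)"
      using t_power_commute[OF a, of r 1] by (simp only: mult.assoc[symmetric] power_one_right)
    finally show ?case by (simp only: Suc mult.assoc power_Suc)
  qed simp
  have "t a ^ r * t (a + 1) ^ (d - r) * e a = e a" if "r < d" for r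
  proof -
    have "t a ^ r * t (a + 1) ^ (d - r) * e a = t (a + 1) ^ (d - r) * (t a ^ r * e a)"
      by (simp only: t_power_commute[OF a] mult.assoc)
    also have "\<dots> = t (a + 1) ^ d * e a"
      using that by (simp add: 1 mult.assoc[symmetric] flip: power_add)
    finally show ?thesis using t_order[OF a(2)] by simp
  qed
  then have "(\<Sum>r<d. t a ^ r * t (a + 1) ^ (d - r)) * e a = of_nat d * e a"
    by (simp add: sum_distrib_right)
  also have "of_nat d = c (of_nat d)"
    using c_sum[of "\<lambda>_. 1" "{..<d}"] by (simp add: c_1)
  finally have "e a * e a = c (1 / of_nat d) * (c (of_nat d) * e a)"
    by (subst e_def) (simp add: mult.assoc)
  then show ?thesis using d_char by (simp add: c_1 flip: mult.assoc c_mult)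
qed

lemma g_square: "a \<in> {1..<n} \<Longrightarrow> g a * g a = c q + c (q - 1) * (g a * e a)"
  using g_quadratic[of a, folded e_def] e_g[of a] by (simp only: mult.assoc)

lemma t_X: "a \<in> {1..n} \<Longrightarrow> b \<in> {1..n} \<Longrightarrow> t b * X a = X a * t b"
proof (induction a arbitrary: b rule: X.induct)
  case (3 a)
  let ?a = "Suc a" and ?b = "transpose (Suc a) (Suc (Suc a)) b"
  have a: "?a \<in> {1..<n}" "?a \<in> {1..n}" and b: "?b \<in> {1..n}"
    using 3 by (auto simp: transpose_def)
  have 1: "t b * g ?a = g ?a * t ?b" "t ?b * g ?a = g ?a * t b"
    using t_g[OF 3(3) a(1)] t_g[OF b a(1)] by simp_all
  have "t b * (g ?a * X ?a * g ?a) = g ?a * X ?a * g ?a * t b"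
    using intertwine_mult[OF intertwine_mult[OF 1(1) 3(1)[OF a(2) b]] 1(2)] by (simp only: mult.assoc)
  then show ?case
    by (simp add: mult.assoc c_left)
qed simp_all

lemma e_X: "a \<in> {1..<n} \<Longrightarrow> b \<in> {1..n} \<Longrightarrow> X b * e a = e a * X b"
  by (rule e_commute) (simp_all add: t_X)

lemma g_far': "a \<in> {1..<n} \<Longrightarrow> b \<in> {1..<n} \<Longrightarrow> a + 1 < b \<or> b + 1 < a \<Longrightarrow> g a * g b = g b * g a"
  using g_far[of a b] g_far[of b a] by auto

text \<open>
  The one case that does not follow from the commutation of distant generators is \<open>a = b + 2\<close>,
  where \<open>g\<^sub>b\<close> passes through \<open>g\<^sub>b\<^sub>+\<^sub>1 g\<^sub>b X\<^sub>b g\<^sub>b g\<^sub>b\<^sub>+\<^sub>1\<close>: the braid relation turns it into \<open>g\<^sub>b\<^sub>+\<^sub>1\<close>,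
  which commutes with \<open>X\<^sub>b\<close>, and then back.
\<close>

lemma g_X: "b \<in> {1..<n} \<Longrightarrow> a \<in> {1..n} \<Longrightarrow> a \<noteq> b \<Longrightarrow> a \<noteq> b + 1 \<Longrightarrow> g b * X a = X a * g b"
proof (induction a arbitrary: b rule: less_induct)
  case (less a)
  show ?case
  proof (cases "a = 1")
    case False
    then obtain a' where a': "a = Suc (Suc a')"
      using less.prems(2) by (cases a rule: X.cases) auto
    let ?a = "Suc a'"
    have Xa: "X a = c (inverse q) * (g ?a * (X ?a * g ?a))" using a' by (simp add: mult.assoc)
    show ?thesis
    proof (cases "b = a'")
      case False
      have A: "g b * g ?a = g ?a * g b"
      proof (rule g_far')
        show "b \<in> {1..<n}" by (rule less.prems)
        show "?a \<in> {1..<n}" using less.prems a' by auto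
        show "b + 1 < ?a \<or> ?a + 1 < b" using less.prems a' False by arith
      qed
      have B: "g b * X ?a = X ?a * g b" by (rule less.IH) (use less.prems a' False in auto)
      have "g b * (g ?a * (X ?a * g ?a)) = g ?a * (X ?a * g ?a) * g b"
        by (rule intertwine_mult[OF A intertwine_mult[OF B A]])
      then show ?thesis by (simp add: Xa c_left mult.assoc)
    next
      case True
      then obtain b' where b: "b = Suc b'" "?a = b + 1" using less.prems by (cases b) auto
      have X: "X ?a = c (inverse q) * (g b * (X b * g b))" using b True by (simp add: mult.assoc)
      have 1: "g (b + 1) * X b = X b * g (b + 1)"
        by (rule less.IH) (use less.prems a' True in auto)
      have br: "g b * (g (b + 1) * g b) = g (b + 1) * (g b * g (b + 1))"
        using g_braid[of b] less.prems a' True by (simp add: mult.assoc)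
      have "g b * (g (b + 1) * (g b * (X b * (g b * g (b + 1))))) =
          g (b + 1) * (g b * (X b * (g (b + 1) * (g b * g (b + 1)))))"
        using arg_cong[OF 1, of "\<lambda>x. g (b + 1) * (g b * (x * (g b * g (b + 1))))"]
          arg_cong[OF br, of "\<lambda>x. x * (X b * (g b * g (b + 1)))"]
        by (simp only: mult.assoc)
      also have "\<dots> = g (b + 1) * (g b * (X b * (g b * g (b + 1)))) * g b"
        using br by (simp only: mult.assoc)
      finally show ?thesis
        unfolding Xa b(2) X[unfolded b(2)] by (simp add: c_left mult.assoc)
    qed
  qed simp
qed

lemma X_X: "a \<in> {1..n} \<Longrightarrow> b \<in> {1..n} \<Longrightarrow> X a * X b = X b * X a"
proof -
  have less: "a < b \<Longrightarrow> 1 \<le> a \<Longrightarrow> b \<le> n \<Longrightarrow> X a * X b = X b * X a" for a b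
  proof (induction a rule: X.induct)
    case (3 a)
    have A: "X b * g (Suc a) = g (Suc a) * X b" using 3 by (intro g_X[symmetric]) auto
    have B: "X b * X (Suc a) = X (Suc a) * X b" using 3 by auto
    have "X b * (g (Suc a) * (X (Suc a) * g (Suc a))) = g (Suc a) * (X (Suc a) * g (Suc a)) * X b"
      by (rule intertwine_mult[OF A intertwine_mult[OF B A]])
    then show ?case by (simp add: c_left mult.assoc)
  qed simp_all
  assume ab: "a \<in> {1..n}" "b \<in> {1..n}"
  consider "a < b" | "a = b" | "b < a" by linarith
  then show "X a * X b = X b * X a"
  proof cases
    case 1
    show ?thesis by (rule less[OF 1]) (use ab in auto)
  next
    case 3
    show ?thesis by (rule less[OF 3, symmetric]) (use ab in auto)
  qed simp
qed

lemma g_X_g: "a \<ge> 1 \<Longrightarrow> g a * X a * g a = c q * X (a + 1)"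
  by (cases a) (simp_all add: c_1 q_neq_0 flip: mult.assoc c_mult)

lemma g_h:
  assumes "a \<in> {1..<n}"
  shows "g a * h a = c q" and "h a * g a = c q"
  using g_square[OF assms] e_g[OF assms]
  by (simp_all add: h_def left_diff_distrib right_diff_distrib c_left mult.assoc)

text \<open>
  Both exchange rules come from cancelling one factor \<open>g\<^sub>a\<close> in \<open>g\<^sub>a X\<^sub>a g\<^sub>a = q X\<^sub>a\<^sub>+\<^sub>1\<close>, on the
  right here and on the left in the next lemma.
\<close>

lemma g_X_same:
  assumes "a \<in> {1..<n}"
  shows "g a * X a = X (a + 1) * g a - c (q - 1) * (e a * X (a + 1))"
proof -
  have "c q * (X (a + 1) * h a) = g a * X a * (g a * h a)"
    using g_X_g[of a] assms by (simp add: mult.assoc[symmetric])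
  then have "c q * (X (a + 1) * h a) = c q * (g a * X a)"
    by (simp add: g_h[OF assms] c_comm)
  then have "X (a + 1) * h a = g a * X a" by (rule c_cancel[OF q_neq_0])
  then show ?thesis
    using e_X[OF assms, of "a + 1"] assms by (simp add: h_def right_diff_distrib c_left)
qed

lemma g_X_next:
  assumes "a \<in> {1..<n}"
  shows "g a * X (a + 1) = X a * g a + c (q - 1) * (e a * X (a + 1))"
proof -
  have "c q * (h a * X (a + 1)) = h a * g a * X a * g a"
    using g_X_g[of a] assms by (simp add: mult.assoc c_left)
  then have "c q * (h a * X (a + 1)) = c q * (X a * g a)"
    by (simp add: g_h[OF assms] mult.assoc)
  then have "h a * X (a + 1) = X a * g a" by (rule c_cancel[OF q_neq_0])
  then show ?thesis by (simp add: h_def left_diff_distrib mult.assoc diff_eq_eq)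
qed

lemma X_X_inv: "a \<in> {1..n} \<Longrightarrow> X a * X_inv a = 1 \<and> X_inv a * X a = 1"
proof (induction a rule: X.induct)
  case (3 a)
  let ?a = "Suc a" and ?i = "c (inverse q)"
  have a: "?a \<in> {1..<n}" and IH: "X ?a * X_inv ?a = 1" "X_inv ?a * X ?a = 1" using 3 by auto
  have i: "?i * c q = 1" "c q * ?i = 1" using q_neq_0 by (simp_all add: c_1 flip: c_mult)
  have "X (Suc ?a) * X_inv (Suc ?a) = ?i * (?i * (g ?a * (X ?a * ((g ?a * h ?a) * (X_inv ?a * h ?a)))))"
    by (simp add: mult.assoc c_left)
  also have "\<dots> = ?i * (?i * (c q * (g ?a * ((X ?a * X_inv ?a) * h ?a))))"
    by (simp only: g_h[OF a] c_left mult.assoc)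
  also have "\<dots> = ?i * ((?i * c q) * (g ?a * h ?a))" by (simp add: IH mult.assoc)
  also have "\<dots> = 1" by (simp add: g_h[OF a] i)
  finally have 1: "X (Suc ?a) * X_inv (Suc ?a) = 1" .
  have "X_inv (Suc ?a) * X (Suc ?a) = ?i * (?i * (h ?a * (X_inv ?a * ((h ?a * g ?a) * (X ?a * g ?a)))))"
    by (simp add: mult.assoc c_left)
  also have "\<dots> = ?i * (?i * (c q * (h ?a * ((X_inv ?a * X ?a) * g ?a))))"
    by (simp only: g_h[OF a] c_left mult.assoc)
  also have "\<dots> = ?i * ((?i * c q) * (h ?a * g ?a))" by (simp add: IH mult.assoc)
  also have "\<dots> = 1" by (simp add: g_h[OF a] i)
  finally show ?case using 1 by simp
qed simp_all

end

section \<open>Roots of unity and residues\<close>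

lemma power_eq_1_iff_dvd:
  fixes \<zeta> :: "'a::monoid_mult"
  assumes "m > 0" and "\<zeta> ^ m = 1" and "\<And>r. 0 < r \<Longrightarrow> r < m \<Longrightarrow> \<zeta> ^ r \<noteq> 1"
  shows "\<zeta> ^ N = 1 \<longleftrightarrow> m dvd N"
proof -
  have "\<zeta> ^ N = \<zeta> ^ (m * (N div m) + N mod m)" by simp
  also have "\<dots> = \<zeta> ^ (N mod m)"
    by (simp only: power_add power_mult assms(2) power_one mult_1)
  finally show ?thesis
    using assms(1) assms(3)[of "N mod m"] by (auto simp: dvd_eq_mod_eq_0)
qed

lemma primitive_root_power_eq_1_iff:
  "d \<ge> 1 \<Longrightarrow> primitive_root_of_unity d \<xi> \<Longrightarrow> \<xi> ^ N = 1 \<longleftrightarrow> d dvd N"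
  by (rule power_eq_1_iff_dvd) (auto simp: primitive_root_of_unity_def)

text \<open>
  As \<open>(1 + q + \<dots> + q\<^sup>m\<^sup>-\<^sup>1) (q - 1) = q\<^sup>m - 1\<close> and \<open>q \<noteq> 1\<close>, the quantum characteristic
  is the multiplicative order of \<open>q\<close>, with zero for infinite order.
\<close>

lemma quantum_char_power_eq_1_iff:
  fixes q :: "'k::field"
  assumes "q \<noteq> 1"
  shows "q ^ N = 1 \<longleftrightarrow> quantum_char q dvd N"
proof -
  have sum0: "(\<Sum>i<m. q ^ i) = 0 \<longleftrightarrow> q ^ m = 1" for m
    using assms power_diff_1_eq[of q m] by auto
  show ?thesis
  proof (cases "\<exists>m\<ge>1. q ^ m = 1")
    case True
    define m where "m = (LEAST m. m \<ge> 1 \<and> q ^ m = 1)"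
    have "m \<ge> 1 \<and> q ^ m = 1" unfolding m_def using True by (metis (mono_tags, lifting) LeastI)
    moreover have "q ^ r \<noteq> 1" if "0 < r" "r < m" for r
      using not_less_Least[of r "\<lambda>m. m \<ge> 1 \<and> q ^ m = 1"] that by (auto simp: m_def)
    moreover have "quantum_char q = m"
      using True by (simp add: quantum_char_def sum0 m_def)
    ultimately show ?thesis by (metis power_eq_1_iff_dvd less_eq_Suc_le One_nat_def)
  next
    case False
    then have "quantum_char q = 0" by (auto simp: quantum_char_def sum0)
    moreover have "N = 0" if "q ^ N = 1"
      using False that by (metis One_nat_def Suc_le_eq neq0_conv)
    ultimately show ?thesis by auto
  qed
qed

lemma powi_eq_iff:
  fixes \<zeta> :: "'k::field"
  assumes "\<zeta> \<noteq> 0" and "\<And>N. \<zeta> ^ N = 1 \<longleftrightarrow> m dvd N"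
  shows "\<zeta> powi x = \<zeta> powi y \<longleftrightarrow> int m dvd x - y"
proof -
  have 1: "\<zeta> powi z = 1 \<longleftrightarrow> int m dvd z" for z
  proof (cases "z \<ge> 0")
    case True
    then obtain N where "z = int N" by (rule nonneg_int_cases)
    then show ?thesis using assms(2)[of N] by simp
  next
    case False
    then obtain N where "z = - int N" by (metis int_cases2 of_nat_0_le_iff)
    then show ?thesis using assms(2)[of N] by (simp add: power_int_minus)
  qed
  have "\<zeta> powi x = \<zeta> powi (x - y) * \<zeta> powi y"
    using assms(1) by (metis diff_add_cancel power_int_add)
  then show ?thesis using 1[of "x - y"] assms(1) by auto
qed

lemma zmod_reps_eq:
  assumes "x \<in> zmod_reps m" and "y \<in> zmod_reps m" and "int m dvd x - y"
  shows "x = y"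
  using assms by (metis (mono_tags, lifting) mem_Collect_eq mod_eq_dvd_iff zmod_reps_def)

lemma mod_in_zmod_reps: "x mod int m \<in> zmod_reps m"
  by (simp add: zmod_reps_def)

lemma zmod_reps_nonzero: "m > 0 \<Longrightarrow> zmod_reps m = {0..<int m}"
  unfolding zmod_reps_def by (auto simp: zmod_trivial_iff)

section \<open>Decompositions of one indexed by places\<close>

text \<open>
  The factors are elements of a noncommutative ring, so the order of the product is fixed.
\<close>

primrec ordered_prod :: "(nat \<Rightarrow> 's \<Rightarrow> 'r::monoid_mult) \<Rightarrow> nat \<Rightarrow> (nat \<Rightarrow> 's) \<Rightarrow> 'r" where
  "ordered_prod P 0 k = 1"
| "ordered_prod P (Suc m) k = ordered_prod P m k * P (Suc m) (k (Suc m))"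

lemma ordered_prod_cong: "(\<And>a. a \<in> {1..m} \<Longrightarrow> k a = l a) \<Longrightarrow> ordered_prod P m k = ordered_prod P m l"
  by (induction m) auto

lemma sum_ordered_prod:
  fixes P :: "nat \<Rightarrow> 's \<Rightarrow> 'r::ring_1"
  assumes "\<And>a. a \<in> {1..m} \<Longrightarrow> (\<Sum>s\<in>S. P a s) = 1"
  shows "(\<Sum>k\<in>{1..m} \<rightarrow>\<^sub>E S. ordered_prod P m k) = 1"
  using assms
proof (induction m)
  case (Suc m)
  have ins: "{1..Suc m} = insert (Suc m) {1..m}" by auto
  have "(\<Sum>k\<in>{1..Suc m} \<rightarrow>\<^sub>E S. ordered_prod P (Suc m) k) =
      (\<Sum>(s, k)\<in>S \<times> ({1..m} \<rightarrow>\<^sub>E S). ordered_prod P (Suc m) (k(Suc m := s)))"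
    unfolding ins PiE_insert_eq
    by (subst sum.reindex[OF inj_combinator]) (auto simp: comp_def case_prod_unfold)
  also have "\<dots> = (\<Sum>(s, k)\<in>S \<times> ({1..m} \<rightarrow>\<^sub>E S). ordered_prod P m k * P (Suc m) s)"
  proof (rule sum.cong)
    fix x assume "x \<in> S \<times> ({1..m} \<rightarrow>\<^sub>E S)"
    obtain s k where x: "x = (s, k)" by (cases x)
    have "ordered_prod P m (k(Suc m := s)) = ordered_prod P m k" by (rule ordered_prod_cong) auto
    then show "(case x of (s, k) \<Rightarrow> ordered_prod P (Suc m) (k(Suc m := s))) =
        (case x of (s, k) \<Rightarrow> ordered_prod P m k * P (Suc m) s)" by (simp add: x)
  qed simp
  also have "\<dots> = (\<Sum>s\<in>S. \<Sum>k\<in>{1..m} \<rightarrow>\<^sub>E S. ordered_prod P m k * P (Suc m) s)"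
    by (simp add: sum.cartesian_product)
  also have "\<dots> = (\<Sum>k\<in>{1..m} \<rightarrow>\<^sub>E S. ordered_prod P m k) * (\<Sum>s\<in>S. P (Suc m) s)"
    by (subst sum.swap) (simp add: sum_product)
  also have "\<dots> = 1" using Suc by simp
  finally show ?case .
qed simp

lemma ordered_prod_eq_0: "a \<in> {1..m} \<Longrightarrow> P a (k a) = 0 \<Longrightarrow> ordered_prod P m k = (0::'r::ring_1)"
  by (induction m) (auto simp: le_Suc_eq)

section \<open>The spectrum of the Jucys--Murphy elements\<close>

lemma assoc_left: "u * v = w \<Longrightarrow> u * (v * x) = w * (x::'a::semigroup_mult)"
  by (metis mult.assoc)

text \<open>
  With \<open>u = X\<^sub>a\<close> and \<open>v = X\<^sub>a\<^sub>+\<^sub>1\<close>, the element \<open>\<Psi>\<close> is the intertwiner multiplied by \<open>v - u\<close>, so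
  it is defined before anything is known about invertibility. It exchanges \<open>u\<close> and \<open>v\<close>, and its
  square no longer involves \<open>g\<close> on either of the images of \<open>e\<close> and \<open>1 - e\<close>.
\<close>

lemma clear_intertwiner:
  fixes Q e u v g :: "'a::ring_1"
  assumes central: "u * Q = Q * u" "v * Q = Q * v" "g * Q = Q * g" "e * Q = Q * e"
    and comm: "v * u = u * v" "u * e = e * u" "v * e = e * v" "g * e = e * g"
    and e: "e * e = e"
    and gg: "g * g = Q + (Q - 1) * (e * g)"
    and gu: "g * u = v * g - (Q - 1) * (e * v)"
    and gv: "g * v = u * g + (Q - 1) * (e * v)"
    and \<Psi>: "\<Psi> = g * (v - u) + (1 - Q) * (e * v)"
  shows "v * \<Psi> = \<Psi> * u" and "u * \<Psi> = \<Psi> * v"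
    and "\<Psi> * \<Psi> * e = - ((Q * u - v) * (u - Q * v)) * e"
    and "\<Psi> * \<Psi> * (1 - e) = - Q * ((v - u) * (v - u)) * (1 - e)"
proof -
  note rules = assms(1-12) assms(1-12)[THEN assoc_left] \<Psi>
  show "v * \<Psi> = \<Psi> * u" "u * \<Psi> = \<Psi> * v"
    by (simp_all add: rules mult.assoc distrib_left distrib_right left_diff_distrib right_diff_distrib)
  show "\<Psi> * \<Psi> * e = - ((Q * u - v) * (u - Q * v)) * e"
    by (simp add: rules mult.assoc distrib_left distrib_right left_diff_distrib right_diff_distrib)
  show "\<Psi> * \<Psi> * (1 - e) = - Q * ((v - u) * (v - u)) * (1 - e)"
    by (simp add: rules mult.assoc distrib_left distrib_right left_diff_distrib right_diff_distrib)
qed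

context central_algebra
begin

text \<open>
  The value at \<open>x\<close> of the monic polynomial whose list of roots is \<open>L\<close>.
\<close>

definition split_prod :: "'k list \<Rightarrow> 'r \<Rightarrow> 'r"
  where "split_prod L x = prod_list (map (\<lambda>\<alpha>. x - c \<alpha>) L)"

lemma split_prod_simps [simp]:
  "split_prod [] x = 1" "split_prod (\<alpha> # L) x = (x - c \<alpha>) * split_prod L x"
  "split_prod (L @ L') x = split_prod L x * split_prod L' x"
  by (simp_all add: split_prod_def)

lemma split_prod_in: "x \<in> subalgebra B \<Longrightarrow> split_prod L x \<in> subalgebra B"
  by (induction L) (auto intro!: subalgebra_closed)

lemma split_prod_intertwine:
  assumes "v * y = y * u"
  shows "split_prod L v * y = y * split_prod L u"
proof (induction L)
  case (Cons \<alpha> L)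
  have "(v - c \<alpha>) * y = y * (u - c \<alpha>)"
    by (simp add: left_diff_distrib right_diff_distrib assms c_comm)
  then show ?case by (simp add: mult.assoc Cons) (simp flip: mult.assoc)
qed simp

text \<open>
  Where \<open>v\<close> acts as \<open>\<alpha> u\<close>, scaling the roots of a polynomial in \<open>u\<close> by \<open>\<alpha>\<close> gives a polynomial in
  \<open>v\<close>, up to a power of \<open>\<alpha>\<close>.
\<close>

lemma split_prod_scaled:
  assumes "u * v = v * u" and "v * y = c \<alpha> * (u * y)"
  shows "split_prod (map ((*) \<alpha>) L) v * y = c (\<alpha> ^ length L) * (split_prod L u * y)"
proof (induction L)
  case Nil
  then show ?case by (simp add: c_1)
next
  case (Cons \<beta> L)
  let ?p = "split_prod L u" and ?m = "c (\<alpha> ^ length L)"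
  have pv: "?p * v = v * ?p" and pu: "?p * u = u * ?p"
    using split_prod_intertwine[OF assms(1), of L] split_prod_intertwine[OF refl[of "u * u"], of L] by simp_all
  have "split_prod (map ((*) \<alpha>) (\<beta> # L)) v * y = (v - c (\<alpha> * \<beta>)) * (?m * (?p * y))"
    by (simp add: mult.assoc Cons)
  also have "\<dots> = ?m * ((v - c (\<alpha> * \<beta>)) * (?p * y))" by (rule c_comm_left)
  also have "(v - c (\<alpha> * \<beta>)) * (?p * y) = ?p * (v * y) - c (\<alpha> * \<beta>) * (?p * y)"
    by (simp add: left_diff_distrib pv flip: mult.assoc)
  also have "\<dots> = c \<alpha> * ((u - c \<beta>) * (?p * y))"
    by (simp add: assms(2) left_diff_distrib right_diff_distrib c_comm_left[of ?p] c_mult mult.assoc)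
       (simp add: pu flip: mult.assoc)
  finally show ?case
    by (simp add: c_mult mult.assoc c_comm_left[of "c \<alpha>"])
qed

end

lemma sum_powers_root:
  fixes x :: "'k::field"
  assumes "x ^ d = 1" and "x \<noteq> 1"
  shows "(\<Sum>r<d. x ^ r) = 0"
  using power_diff_1_eq[of x d] assms by auto

context yokonuma_hecke
begin

text \<open>
  Let \<open>u = X\<^sub>a\<close> be annihilated by the polynomial with roots \<open>L\<close>, and let \<open>F\<close> be the value of that
  polynomial at \<open>v = X\<^sub>a\<^sub>+\<^sub>1\<close>. Since \<open>v \<Psi> = \<Psi> u\<close>, it kills \<open>\<Psi>\<close>, hence also \<open>\<Psi>\<^sup>2\<close>, which up to a
  nonzero scalar is a product of linear forms: \<open>q u - v\<close> and \<open>u - q v\<close> on the image of \<open>e\<close>,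
  and twice \<open>v - u\<close> on the image of \<open>1 - e\<close>. Where such a form \<open>v - \<alpha> u\<close> vanishes, \<open>v\<close> is
  annihilated by the polynomial with roots \<open>\<alpha> L\<close>, so each linear form can be traded for such a
  factor. All roots of the resulting polynomial lie in \<open>q L\<close>, \<open>q\<^sup>-\<^sup>1 L\<close> or \<open>L\<close>.
\<close>

lemma X_split: "a \<in> {1..n} \<Longrightarrow> \<exists>L. set L \<subseteq> range (\<lambda>i::int. q powi i) \<and> split_prod L (X a) = 0"
proof (induction a rule: X.induct)
  case 1
  then show ?case by simp
next
  case 2
  show ?case
    by (rule exI[of _ "[1]"]) (auto simp: c_1 intro: image_eqI[of _ _ 0])
next
  case (3 a')
  define a b where "a = Suc a'" and "b = a + 1"
  have a: "a \<in> {1..<n}" "a \<in> {1..n}" "b \<in> {1..n}" using 3(2) by (auto simp: a_def b_def)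
  obtain L where L: "set L \<subseteq> range (\<lambda>i::int. q powi i)" "split_prod L (X a) = 0"
    using 3 a(2) by (auto simp: a_def)
  let ?u = "X a" and ?v = "X b" and ?Q = "c q"
  define \<Psi> where "\<Psi> = g a * (?v - ?u) + (1 - ?Q) * (e a * ?v)"
  have Q1: "c (q - 1) = ?Q - 1" by (simp add: c_diff c_1)
  have \<Psi>: "?v * \<Psi> = \<Psi> * ?u" "\<Psi> * \<Psi> * e a = - ((?Q * ?u - ?v) * (?u - ?Q * ?v)) * e a"
    "\<Psi> * \<Psi> * (1 - e a) = - ?Q * ((?v - ?u) * (?v - ?u)) * (1 - e a)"
    by (rule clear_intertwiner[of ?u ?Q ?v "g a" "e a"];
        use X_X[OF a(3) a(2)] e_X[OF a(1) a(2)] e_X[OF a(1) a(3)] e_g[OF a(1)] e_idem[OF a(1)]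
          g_square[OF a(1)] g_X_same[OF a(1), folded b_def] g_X_next[OF a(1), folded b_def] \<Psi>_def c_comm Q1 in simp)+
  let ?S = "subalgebra {?u, ?v, e a}"
  have S: "?u \<in> ?S" "?v \<in> ?S" "e a \<in> ?S" by (auto intro: subalgebra.gen)
  have gen_comm: "y * z = z * y" if "y \<in> {?u, ?v, e a}" "z \<in> {?u, ?v, e a}" for y z
    using that X_X[OF a(3) a(2)] e_X[OF a(1) a(2)] e_X[OF a(1) a(3)] by auto
  have comm: "y * z = z * y" if "y \<in> ?S" "z \<in> ?S" for y z
    by (metis subalgebra_commute[OF that(2)] subalgebra_commute[OF that(1)] gen_comm)
  have step: "split_prod (map ((*) \<alpha>) L) ?v * y = 0" if "?v * y = c \<alpha> * (?u * y)" for \<alpha> y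
    using split_prod_scaled[OF X_X[OF a(2,3)] that] L(2) by simp
  define F where "F = split_prod L ?v"
  define A where "A = split_prod (map ((*) q) L) ?v"
  define B where "B = split_prod (map ((*) (inverse q)) L) ?v"
  have SF: "F \<in> ?S" "A \<in> ?S" "B \<in> ?S" by (simp_all add: F_def A_def B_def split_prod_in S)
  have F0: "F * (\<Psi> * x) = 0" for x
    using split_prod_intertwine[OF \<Psi>(1), of L] L(2) by (simp add: F_def flip: mult.assoc)
  \<comment> \<open>The factors of \<open>\<Psi>\<^sup>2\<close> on the image of \<open>e\<close> are traded for \<open>A\<close> and \<open>B\<close>, with roots scaled by
    \<open>q\<close> and \<open>q\<^sup>-\<^sup>1\<close>.\<close>
  have e_part: "A * B * F * e a = 0"
  proof -
    have "F * (((?Q * ?u - ?v) * (?u - ?Q * ?v)) * e a) = - (F * (\<Psi> * (\<Psi> * e a)))"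
      using \<Psi>(2) by (simp add: mult.assoc)
    then have 0: "F * ((?Q * ?u - ?v) * (?u - ?Q * ?v) * e a) = 0" by (simp add: F0)
    let ?y = "(?u - ?Q * ?v) * F * e a"
    have "(?Q * ?u - ?v) * ?y = F * ((?Q * ?u - ?v) * (?u - ?Q * ?v) * e a)"
      using comm[OF SF(1), of "(?Q * ?u - ?v) * (?u - ?Q * ?v)"] S
      by (simp add: subalgebra_closed flip: mult.assoc)
    then have "?v * ?y = c q * (?u * ?y)"
      unfolding 0 by (simp add: left_diff_distrib mult.assoc)
    then have "A * ?y = 0" unfolding A_def by (rule step)
    moreover have "A * ?y = (?u - ?Q * ?v) * (A * F * e a)"
      using comm[OF SF(2), of "?u - ?Q * ?v"] S by (simp add: subalgebra_closed flip: mult.assoc)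
    ultimately have uv: "?u * (A * F * e a) = ?Q * (?v * (A * F * e a))"
      by (simp add: left_diff_distrib mult.assoc)
    have "?v * (A * F * e a) = c (inverse q) * (?u * (A * F * e a))"
      unfolding uv using q_neq_0 by (simp add: c_1 flip: mult.assoc c_mult)
    then have "B * (A * F * e a) = 0" unfolding B_def by (rule step)
    then show ?thesis using comm[OF SF(2,3)] by (simp add: mult.assoc[symmetric])
  qed
  \<comment> \<open>On the image of \<open>1 - e\<close> each of the two factors \<open>v - u\<close> is traded for another \<open>F\<close>.\<close>
  have f_part: "F * F * F * (1 - e a) = 0"
  proof -
    have "?Q * (F * ((?v - ?u) * (?v - ?u) * (1 - e a))) = - (F * (\<Psi> * (\<Psi> * (1 - e a))))"
      using \<Psi>(3) by (simp only: mult.assoc[symmetric] minus_mult_left minus_mult_right minus_minus c_comm) (simp add: mult.assoc)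
    then have 0: "F * ((?v - ?u) * (?v - ?u) * (1 - e a)) = 0"
      using q_neq_0 by (simp add: F0 c_eq_0)
    have one: "map ((*) 1) L = L" by (simp add: map_idI)
    have vu: "F * (?v - ?u) = (?v - ?u) * F"
      using comm[OF SF(1), of "?v - ?u"] S by (simp add: subalgebra_closed)
    let ?y = "(?v - ?u) * F * (1 - e a)"
    have "(?v - ?u) * ?y = F * ((?v - ?u) * (?v - ?u) * (1 - e a))"
      using vu by (metis mult.assoc)
    then have "?v * ?y = c 1 * (?u * ?y)" unfolding 0 by (simp add: c_1 left_diff_distrib mult.assoc)
    from step[OF this] have "F * ?y = 0" by (simp add: F_def one)
    moreover have "F * ?y = (?v - ?u) * (F * F * (1 - e a))"
      by (simp add: vu flip: mult.assoc)
    ultimately have "?v * (F * F * (1 - e a)) = c 1 * (?u * (F * F * (1 - e a)))"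
      by (simp add: c_1 left_diff_distrib mult.assoc)
    from step[OF this] show ?thesis by (simp add: F_def one mult.assoc)
  qed
  define M where "M = (map ((*) q) L @ map ((*) (inverse q)) L) @ L @ L @ L"
  have "split_prod M ?v = (A * B) * (F * F * F)"
    by (simp add: M_def A_def B_def F_def mult.assoc)
  also have "\<dots> = (A * B) * (F * F * F) * e a + (A * B) * (F * F * F) * (1 - e a)"
    by (simp add: right_diff_distrib)
  also have "(A * B) * (F * F * F) * e a = (F * F) * (A * B * F * e a)"
    using comm[of "F * F" "A * B"] SF by (simp add: subalgebra_closed flip: mult.assoc)
  also have "(A * B) * (F * F * F) * (1 - e a) = (A * B) * (F * F * F * (1 - e a))"
    by (simp only: mult.assoc)
  finally have "split_prod M ?v = 0" by (simp add: e_part f_part)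
  moreover have "set M \<subseteq> range (\<lambda>i::int. q powi i)"
  proof -
    have "q * q powi i = q powi (i + 1)" "inverse q * q powi i = q powi (i - 1)" for i :: int
      using q_neq_0 by (simp_all add: power_int_add power_int_diff field_simps)
    then show ?thesis using L(1) unfolding M_def by auto
  qed
  ultimately show ?case by (intro exI[of _ M]) (simp add: a_def b_def)
qed

lemma q_powi_inj:
  "x \<in> zmod_reps (quantum_char q) \<Longrightarrow> y \<in> zmod_reps (quantum_char q) \<Longrightarrow> q powi x = q powi y \<Longrightarrow> x = y"
  using zmod_reps_eq powi_eq_iff[OF q_neq_0 quantum_char_power_eq_1_iff[OF q_neq_1]] by metis

lemma \<xi>_neq_0: "\<xi> \<noteq> 0"
  using \<xi>_primitive d_pos by (auto simp: primitive_root_of_unity_def power_0_left)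

lemma \<xi>_powi_inj: "x \<in> zmod_reps d \<Longrightarrow> y \<in> zmod_reps d \<Longrightarrow> \<xi> powi x = \<xi> powi y \<Longrightarrow> x = y"
  using zmod_reps_eq powi_eq_iff[OF \<xi>_neq_0 primitive_root_power_eq_1_iff[OF d_pos \<xi>_primitive]] by metis

lemma \<xi>_powi_d: "(\<xi> powi x) ^ d = 1"
proof -
  have "(\<xi> powi x) ^ d = (\<xi> ^ d) powi x"
    by (simp add: power_int_power power_int_power' mult.commute)
  then show ?thesis using \<xi>_primitive by (simp add: primitive_root_of_unity_def)
qed

lemma X_parts:
  assumes "a \<in> {1..n}"
  shows "\<exists>f N I. finite I \<and> I \<subseteq> zmod_reps (quantum_char q) \<and> (\<Sum>i\<in>I. f i) = 1 \<and>
    (\<forall>i\<in>zmod_reps (quantum_char q). f i \<in> subalgebra {X a} \<and> (X a - c (q powi i)) ^ N * f i = 0 \<and>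
       (i \<notin> I \<longrightarrow> f i = 0))"
proof -
  obtain L where L: "set L \<subseteq> range (\<lambda>i::int. q powi i)" "split_prod L (X a) = 0"
    using X_split[OF assms] by blast
  obtain f N where f: "\<And>\<alpha>. f \<alpha> \<in> subalgebra {X a}" "\<And>\<alpha>. (X a - c \<alpha>) ^ N * f \<alpha> = 0"
    "\<And>\<alpha>. \<alpha> \<notin> set L \<Longrightarrow> f \<alpha> = 0" "1 = (\<Sum>\<alpha>\<in>set L. f \<alpha>)"
    using primary_decomposition[of 1 "X a" L] L(2) by (auto simp: split_prod_def subalgebra_1)
  let ?R = "zmod_reps (quantum_char q)"
  define I where "I = {i \<in> ?R. q powi i \<in> set L}"
  \<comment> \<open>Powers of \<open>q\<close> repeat if \<open>q\<close> has finite order; residues label the distinct ones.\<close>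
  have bij: "bij_betw (\<lambda>i. q powi i) I (set L)"
  proof (rule bij_betwI')
    fix y assume "y \<in> set L"
    then obtain z :: int where z: "y = q powi z" using L(1) by auto
    have "q powi (z mod int (quantum_char q)) = q powi z"
      by (subst powi_eq_iff[OF q_neq_0 quantum_char_power_eq_1_iff[OF q_neq_1]])
         (simp add: mod_eq_dvd_iff[symmetric])
    then show "\<exists>x\<in>I. y = q powi x"
      using z \<open>y \<in> set L\<close> by (intro bexI[of _ "z mod int (quantum_char q)"]) (simp_all add: I_def mod_in_zmod_reps)
  qed (auto simp: I_def dest: q_powi_inj)
  show ?thesis
  proof (intro exI conjI ballI)
    show "finite I" using bij bij_betw_finite by blast
    show "(\<Sum>i\<in>I. f (q powi i)) = 1" using sum.reindex_bij_betw[OF bij, of f] f(4) by simp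
  qed (use f I_def in auto)
qed

text \<open>
  The projection to an eigenspace of \<open>t\<^sub>a\<close> given by the finite Fourier transform.
\<close>

definition t_part :: "nat \<Rightarrow> int \<Rightarrow> 'r"
  where "t_part a j = c (1 / of_nat d) * (\<Sum>r<d. c (inverse (\<xi> powi j) ^ r) * t a ^ r)"

lemma t_part_in: "t_part a j \<in> subalgebra {t a}"
  unfolding t_part_def by (auto intro!: subalgebra_closed subalgebra_sum intro: subalgebra.gen)

lemma t_part_eigen:
  assumes "a \<in> {1..n}"
  shows "(t a - c (\<xi> powi j)) * t_part a j = 0"
proof -
  let ?\<zeta> = "\<xi> powi j"
  have z: "?\<zeta> \<noteq> 0" using \<xi>_neq_0 by (simp add: power_int_eq_0_iff)
  let ?F = "\<lambda>r. c (inverse ?\<zeta> ^ r) * t a ^ r"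
  have "(t a - c ?\<zeta>) * ?F r = c ?\<zeta> * (?F (Suc r) - ?F r)" for r
  proof -
    have "c ?\<zeta> * ?F (Suc r) = c (?\<zeta> * inverse ?\<zeta> ^ Suc r) * t a ^ Suc r"
      by (simp add: c_mult mult.assoc)
    also have "?\<zeta> * inverse ?\<zeta> ^ Suc r = inverse ?\<zeta> ^ r" using z by simp
    finally show ?thesis
      by (simp add: left_diff_distrib right_diff_distrib c_comm_left[of "t a"])
  qed
  then have "(t a - c ?\<zeta>) * (\<Sum>r<d. ?F r) = c ?\<zeta> * (\<Sum>r<d. ?F (Suc r) - ?F r)"
    by (simp only: sum_distrib_left)
  also have "(\<Sum>r<d. ?F (Suc r) - ?F r) = ?F d - ?F 0"
    by (rule sum_lessThan_telescope)
  also have "\<dots> = 0" using \<xi>_powi_d[of j] t_order[OF assms] z by (simp add: power_inverse c_1)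
  finally show ?thesis
    unfolding t_part_def by (subst c_comm_left) simp
qed

lemma sum_t_part: "(\<Sum>j\<in>zmod_reps d. t_part a j) = 1"
proof -
  have inner: "(\<Sum>j<d. inverse (\<xi> ^ j) ^ r) = (if r = 0 then of_nat d else 0)" if "r < d" for r
  proof (cases "r = 0")
    case False
    have "(\<Sum>j<d. (inverse \<xi> ^ r) ^ j) = 0"
    proof (rule sum_powers_root)
      have "\<xi> ^ d = 1" "\<xi> ^ r \<noteq> 1" using \<xi>_primitive that False by (simp_all add: primitive_root_of_unity_def)
      then show "(inverse \<xi> ^ r) ^ d = 1" "inverse \<xi> ^ r \<noteq> 1"
        by (metis power_commutes power_inverse inverse_1 power_mult mult.commute power_one,
            metis power_inverse inverse_eq_1_iff)
    qed
    moreover have "inverse (\<xi> ^ j) ^ r = (inverse \<xi> ^ r) ^ j" for j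
      by (simp add: power_inverse flip: power_mult) (simp add: mult.commute)
    ultimately show ?thesis using False by simp
  qed simp
  have reps: "zmod_reps d = int ` {..<d}"
    using zmod_reps_nonzero[of d] d_pos by (simp add: image_int_atLeastLessThan lessThan_atLeast0)
  have "(\<Sum>j\<in>zmod_reps d. t_part a j) = (\<Sum>j<d. t_part a (int j))"
    by (simp add: reps sum.reindex)
  also have "\<dots> = c (1 / of_nat d) * (\<Sum>r<d. \<Sum>j<d. c (inverse (\<xi> ^ j) ^ r) * t a ^ r)"
    by (subst sum.swap) (simp add: t_part_def sum_distrib_left)
  also have "(\<Sum>r<d. \<Sum>j<d. c (inverse (\<xi> ^ j) ^ r) * t a ^ r) = (\<Sum>r<d. c (if r = 0 then of_nat d else 0) * t a ^ r)"
    by (rule sum.cong) (simp_all add: inner flip: sum_distrib_right c_sum)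
  also have "\<dots> = (\<Sum>r<d. if r = 0 then c (of_nat d) else 0)"
    by (rule sum.cong) (auto simp: c_0)
  also have "\<dots> = c (of_nat d)" using d_pos by simp
  also have "c (1 / of_nat d) * c (of_nat d) = 1" using d_char by (simp add: c_1 flip: c_mult)
  finally show ?thesis .
qed

definition Alg :: "'r set" where "Alg = subalgebra (X ` {1..n} \<union> t ` {1..n})"

lemma subalgebra_mono: "x \<in> subalgebra B \<Longrightarrow> (\<And>b. b \<in> B \<Longrightarrow> b \<in> subalgebra B') \<Longrightarrow> x \<in> subalgebra B'"
  by (induction rule: subalgebra.induct) (auto intro: subalgebra_closed)

lemma subalgebra_X_Alg: "a \<in> {1..n} \<Longrightarrow> x \<in> subalgebra {X a} \<Longrightarrow> x \<in> Alg"
  unfolding Alg_def by (erule subalgebra_mono) (auto intro: subalgebra.gen)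

lemma subalgebra_t_Alg: "a \<in> {1..n} \<Longrightarrow> x \<in> subalgebra {t a} \<Longrightarrow> x \<in> Alg"
  unfolding Alg_def by (erule subalgebra_mono) (auto intro: subalgebra.gen)

lemma Alg_mult: "x \<in> Alg \<Longrightarrow> y \<in> Alg \<Longrightarrow> x * y \<in> Alg"
  unfolding Alg_def by (rule subalgebra.mult)

lemma Alg_commute:
  assumes "x \<in> Alg" and "y \<in> Alg"
  shows "x * y = y * x"
proof -
  have "b * b' = b' * b" if "b \<in> X ` {1..n} \<union> t ` {1..n}" "b' \<in> X ` {1..n} \<union> t ` {1..n}" for b b'
    using that X_X t_t t_X by auto
  then show ?thesis
    using subalgebra_commute assms unfolding Alg_def by metis
qed

abbreviation K :: "(nat \<Rightarrow> int \<times> int) set" where "K \<equiv> yh_K d n q"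

text \<open>
  The idempotents are the products over all places of the components of one for \<open>X\<^sub>a\<close> and \<open>t\<^sub>a\<close>.
  Only finitely many are nonzero, even if there are infinitely many residues, since each \<open>X\<^sub>a\<close> has
  finitely many eigenvalues.
\<close>

lemma idempotents_exist:
  "\<exists>E. (\<forall>k\<in>K. E k \<in> Alg \<and> (\<exists>N. \<forall>a\<in>{1..n}. (X a - c (q powi fst (k a))) ^ N * E k = 0 \<and>
      (t a - c (\<xi> powi snd (k a))) * E k = 0)) \<and>
    finite {k\<in>K. E k \<noteq> 0} \<and> (\<Sum>k\<in>{k\<in>K. E k \<noteq> 0}. E k) = 1"
proof -
  let ?R = "zmod_reps (quantum_char q)"
  obtain f N I where fNI: "\<And>a. a \<in> {1..n} \<Longrightarrow> finite (I a) \<and> I a \<subseteq> ?R \<and> (\<Sum>i\<in>I a. f a i) = 1 \<and>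
      (\<forall>i\<in>?R. f a i \<in> subalgebra {X a} \<and> (X a - c (q powi i)) ^ N a * f a i = 0 \<and> (i \<notin> I a \<longrightarrow> f a i = (0::'r)))"
    using X_parts by metis
  define P where "P a s = f a (fst s) * t_part a (snd s)" for a s
  \<comment> \<open>One finite set of residues for all places makes the index set a set of functions into a
    fixed set.\<close>
  define II where "II = (\<Union>a\<in>{1..n}. I a)"
  define S where "S = II \<times> zmod_reps d"
  have I: "finite (I a)" "I a \<subseteq> ?R" if "a \<in> {1..n}" for a using fNI[OF that] by simp_all
  have fin: "finite II" "II \<subseteq> ?R" unfolding II_def using I by (simp, blast)
  have finS: "finite S" using fin d_pos by (simp add: S_def zmod_reps_nonzero)
  have sumS: "(\<Sum>s\<in>S. P a s) = 1" if "a \<in> {1..n}" for a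
  proof -
    have "(\<Sum>i\<in>II. f a i) = (\<Sum>i\<in>I a. f a i)"
      by (rule sum.mono_neutral_right) (use fin fNI[OF that] that in \<open>auto simp: II_def\<close>)
    moreover have "(\<Sum>s\<in>S. P a s) = (\<Sum>i\<in>II. f a i) * (\<Sum>j\<in>zmod_reps d. t_part a j)"
      by (simp add: S_def P_def sum_product sum.cartesian_product case_prod_unfold)
    ultimately show ?thesis using fNI[OF that] sum_t_part by simp
  qed
  define E where "E = ordered_prod P n"
  have f_in: "f a i \<in> Alg" if "a \<in> {1..n}" "i \<in> ?R" for a i
    using fNI[OF that(1)] that by (intro subalgebra_X_Alg[OF that(1)]) simp
  have P_in: "P a s \<in> Alg" if "a \<in> {1..n}" "s \<in> ?R \<times> zmod_reps d" for a s
    unfolding P_def using that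
    by (intro Alg_mult f_in subalgebra_t_Alg[OF that(1) t_part_in]) auto
  have K: "k a \<in> ?R \<times> zmod_reps d" if "k \<in> K" "a \<in> {1..n}" for k a
    using PiE_mem[OF that(1)[unfolded yh_K_def] that(2)] .
  have op_in: "ordered_prod P m k \<in> Alg" if "k \<in> K" "m \<le> n" for k m
    using that(2)
  proof (induction m)
    case 0
    then show ?case by (simp add: Alg_def subalgebra_1)
  next
    case (Suc m)
    then show ?case using P_in[OF _ K[OF that(1)], of "Suc m" "Suc m"] by (auto intro: Alg_mult)
  qed
  have kill: "y * ordered_prod P m k = 0"
    if "k \<in> K" "m \<le> n" "a \<in> {1..m}" "y \<in> Alg" "y * P a (k a) = 0" for y k a m
    using that(2,3)
  proof (induction m)
    case (Suc m)
    have mem: "ordered_prod P m k \<in> Alg" using op_in[OF that(1)] Suc by simp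
    show ?case
    proof (cases "a = Suc m")
      case True
      have "y * ordered_prod P (Suc m) k = ordered_prod P m k * (y * P a (k a))"
        using True Alg_commute[OF that(4) mem] by (simp flip: mult.assoc)
      then show ?thesis using that(5) by simp
    next
      case False
      then show ?thesis using Suc by (simp flip: mult.assoc)
    qed
  qed simp
  have X_in: "X a - c \<alpha> \<in> Alg" and t_in: "t a - c \<alpha> \<in> Alg" if "a \<in> {1..n}" for a \<alpha>
    unfolding Alg_def using that by (auto intro!: subalgebra_closed intro: subalgebra.gen)
  have eigen: "(X a - c (q powi fst (k a))) ^ Max (N ` {1..n}) * E k = 0" "(t a - c (\<xi> powi snd (k a))) * E k = 0"
    if "k \<in> K" "a \<in> {1..n}" for k a
  proof -
    let ?x = "X a - c (q powi fst (k a))" and ?M = "Max (N ` {1..n})"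
    have i: "fst (k a) \<in> ?R" using K[OF that] by auto
    have "N a \<le> ?M" using that(2) by simp
    then have "?x ^ ?M = ?x ^ (?M - N a) * ?x ^ N a" by (simp flip: power_add)
    moreover have "?x ^ N a * f a (fst (k a)) = 0" using fNI[OF that(2)] i by simp
    ultimately have 0: "?x ^ ?M * P a (k a) = 0" by (simp add: P_def mult.assoc assoc_left)
    have "?x ^ ?M \<in> Alg" using X_in[OF that(2)] by (simp add: Alg_def subalgebra_power)
    then show "?x ^ ?M * E k = 0"
      unfolding E_def using 0 by (rule kill[OF that(1) order_refl that(2)])
    let ?y = "t a - c (\<xi> powi snd (k a))"
    have "?y * f a (fst (k a)) = f a (fst (k a)) * ?y"
      by (rule Alg_commute[OF t_in[OF that(2)] f_in[OF that(2) i]])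
    then have "?y * P a (k a) = f a (fst (k a)) * (?y * t_part a (snd (k a)))"
      unfolding P_def by (simp only: mult.assoc[symmetric])
    then have "?y * P a (k a) = 0" by (simp only: t_part_eigen[OF that(2)] mult_zero_right)
    then show "?y * E k = 0"
      unfolding E_def by (rule kill[OF that(1) order_refl that(2) t_in[OF that(2)]])
  qed
  have supp: "{k \<in> K. E k \<noteq> 0} \<subseteq> {1..n} \<rightarrow>\<^sub>E S"
  proof
    fix k assume k: "k \<in> {k \<in> K. E k \<noteq> 0}"
    have "k a \<in> S" if "a \<in> {1..n}" for a
    proof -
      have "fst (k a) \<in> I a"
      proof (rule ccontr)
        assume "fst (k a) \<notin> I a"
        then have "P a (k a) = 0" using fNI[OF that] K[of k a] k that by (simp add: P_def mem_Times_iff)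
        then have "E k = 0" unfolding E_def using that by (rule ordered_prod_eq_0[rotated])
        then show False using k by simp
      qed
      then show ?thesis using K[of k a] k that by (auto simp: S_def II_def mem_Times_iff)
    qed
    then show "k \<in> {1..n} \<rightarrow>\<^sub>E S" using k by (auto simp: yh_K_def PiE_iff)
  qed
  have S_K: "{1..n} \<rightarrow>\<^sub>E S \<subseteq> K"
    unfolding yh_K_def S_def using fin by (intro PiE_mono) auto
  have finP: "finite ({1..n} \<rightarrow>\<^sub>E S)" using finS by (intro finite_PiE) auto
  have "(\<Sum>k\<in>{k \<in> K. E k \<noteq> 0}. E k) = (\<Sum>k\<in>{1..n} \<rightarrow>\<^sub>E S. E k)"
    by (rule sum.mono_neutral_left) (use supp S_K finP in auto)
  also have "\<dots> = 1" unfolding E_def by (rule sum_ordered_prod) (rule sumS)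
  finally show ?thesis
    using finite_subset[OF supp finP] op_in eigen unfolding E_def by (intro exI[of _ "ordered_prod P n"]) blast
qed

end

section \<open>Weights, and the coefficients of the intertwiners\<close>

text \<open>
  The \<open>E k\<close> enter through the eigenvalue conditions and their sum. That they are orthogonal
  idempotents follows, because only zero has two different weights.
\<close>

locale yokonuma_hecke_idempotents = yokonuma_hecke c d n q \<xi> g t
  for c :: "'k::field \<Rightarrow> 'r::ring_1" and d n q \<xi> g t +
  fixes E :: "(nat \<Rightarrow> int \<times> int) \<Rightarrow> 'r"
  assumes E_in: "k \<in> K \<Longrightarrow> E k \<in> Alg"
    and E_eigen: "k \<in> K \<Longrightarrow> \<exists>N. \<forall>a\<in>{1..n}. (X a - c (q powi fst (k a))) ^ N * E k = 0 \<and>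
      (t a - c (\<xi> powi snd (k a))) * E k = 0"
    and E_finite: "finite {k\<in>K. E k \<noteq> 0}"
    and E_sum: "(\<Sum>k\<in>{k\<in>K. E k \<noteq> 0}. E k) = 1"
begin

lemma X_in: "a \<in> {1..n} \<Longrightarrow> X a \<in> Alg"
  by (auto simp: Alg_def intro: subalgebra.gen)

lemma t_in: "a \<in> {1..n} \<Longrightarrow> t a \<in> Alg"
  by (auto simp: Alg_def intro: subalgebra.gen)

lemma c_in: "c x \<in> Alg"
  by (auto simp: Alg_def intro: subalgebra_closed)

lemma Alg_add: "x \<in> Alg \<Longrightarrow> y \<in> Alg \<Longrightarrow> x + y \<in> Alg"
  unfolding Alg_def by (rule subalgebra.add)

lemma Alg_diff: "x \<in> Alg \<Longrightarrow> y \<in> Alg \<Longrightarrow> x - y \<in> Alg"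
  unfolding Alg_def by (rule subalgebra_diff)

lemma Alg_power: "x \<in> Alg \<Longrightarrow> x ^ m \<in> Alg"
  unfolding Alg_def by (rule subalgebra_power)

lemma Alg_0: "0 \<in> Alg"
  unfolding Alg_def by (rule subalgebra_0)

lemmas Alg_closed = X_in t_in c_in E_in Alg_add Alg_diff Alg_mult Alg_power Alg_0

text \<open>
  The exponent may depend on \<open>x\<close> but not on the place, which is no restriction for finitely many
  places.
\<close>

definition weight :: "(nat \<Rightarrow> int \<times> int) \<Rightarrow> 'r \<Rightarrow> bool"
  where "weight k x \<longleftrightarrow> (\<exists>N. \<forall>a\<in>{1..n}. (X a - c (q powi fst (k a))) ^ N * x = 0 \<and>
    (t a - c (\<xi> powi snd (k a))) * x = 0)"

lemma weight_E: "k \<in> K \<Longrightarrow> weight k (E k)"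
  unfolding weight_def by (rule E_eigen)

lemma weight_mult: "weight k x \<Longrightarrow> weight k (x * y)"
  unfolding weight_def by (simp only: mult.assoc[symmetric]) (metis mult_zero_left)

lemma weight_Alg:
  assumes "y \<in> Alg" and "weight k x"
  shows "weight k (y * x)"
proof -
  obtain N where N: "\<And>a. a \<in> {1..n} \<Longrightarrow> (X a - c (q powi fst (k a))) ^ N * x = 0 \<and>
    (t a - c (\<xi> powi snd (k a))) * x = 0"
    using assms(2) unfolding weight_def by blast
  have "z * (y * x) = 0" if "z \<in> Alg" "z * x = 0" for z
    using Alg_commute[OF that(1) assms(1)] that(2) by (metis mult.assoc mult_zero_right)
  then show ?thesis
    unfolding weight_def using N by (intro exI[of _ N]) (simp add: Alg_closed)
qed

lemma K_differ:
  assumes "k \<in> K" "l \<in> K" "k \<noteq> l"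
  obtains a where "a \<in> {1..n}" "k a \<noteq> l a"
  using assms unfolding yh_K_def by (metis PiE_ext)

lemma K_reps:
  assumes "k \<in> K" "a \<in> {1..n}"
  shows "fst (k a) \<in> zmod_reps (quantum_char q)" "snd (k a) \<in> zmod_reps d"
  using PiE_mem[OF assms(1)[unfolded yh_K_def] assms(2)] by auto

lemma weight_unique:
  assumes "k \<in> K" "l \<in> K" "k \<noteq> l" "weight k x" "weight l x"
  shows "x = 0"
proof -
  obtain a where a: "a \<in> {1..n}" "k a \<noteq> l a" using K_differ[OF assms(1-3)] .
  obtain N where N: "(X a - c (q powi fst (k a))) ^ N * x = 0" "(t a - c (\<xi> powi snd (k a))) ^ 1 * x = 0"
    using assms(4) a(1) unfolding weight_def power_one_right by blast
  obtain M where M: "(X a - c (q powi fst (l a))) ^ M * x = 0" "(t a - c (\<xi> powi snd (l a))) ^ 1 * x = 0"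
    using assms(5) a(1) unfolding weight_def power_one_right by blast
  consider "fst (k a) \<noteq> fst (l a)" | "snd (k a) \<noteq> snd (l a)" using a(2) by (auto simp: prod_eq_iff)
  then show ?thesis
  proof cases
    case 1
    then have "q powi fst (k a) \<noteq> q powi fst (l a)"
      using q_powi_inj K_reps assms(1,2) a(1) by blast
    then show ?thesis using eigenvalues_disjoint N(1) M(1) by blast
  next
    case 2
    then have "\<xi> powi snd (k a) \<noteq> \<xi> powi snd (l a)"
      using \<xi>_powi_inj K_reps assms(1,2) a(1) by blast
    then show ?thesis using eigenvalues_disjoint N(2) M(2) by blast
  qed
qed

lemma weight_E_other: "k \<in> K \<Longrightarrow> l \<in> K \<Longrightarrow> k \<noteq> l \<Longrightarrow> weight k x \<Longrightarrow> E l * x = 0"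
  by (rule weight_unique[of k l]) (auto intro: weight_Alg weight_mult weight_E E_in)

lemma sum_E_left: "(\<Sum>l\<in>{k\<in>K. E k \<noteq> 0}. E l * x) = x"
  by (simp add: E_sum flip: sum_distrib_right)

lemma weight_E_fix:
  assumes "k \<in> K" "weight k x"
  shows "E k * x = x"
proof -
  have "(\<Sum>l\<in>{k\<in>K. E k \<noteq> 0}. E l * x) = (\<Sum>l\<in>{k\<in>K. E k \<noteq> 0}. if l = k then E k * x else 0)"
    by (rule sum.cong) (auto intro: weight_E_other assms)
  also have "\<dots> = E k * x" using assms(1) E_finite by auto
  finally show ?thesis by (simp add: sum_E_left)
qed

lemma E_idem: "k \<in> K \<Longrightarrow> E k * E k = E k"
  by (rule weight_E_fix) (auto intro: weight_E)

lemma E_orth: "k \<in> K \<Longrightarrow> l \<in> K \<Longrightarrow> k \<noteq> l \<Longrightarrow> E k * E l = 0"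
  by (rule weight_E_other[of l k]) (auto intro: weight_E)

lemma E_comm: "k \<in> K \<Longrightarrow> x \<in> Alg \<Longrightarrow> x * E k = E k * x"
  by (rule Alg_commute) (auto intro: E_in)

lemma t_E: "k \<in> K \<Longrightarrow> a \<in> {1..n} \<Longrightarrow> t a * E k = c (\<xi> powi snd (k a)) * E k"
  using E_eigen[of k] by (auto simp: left_diff_distrib)

lemma t_E_mult: "k \<in> K \<Longrightarrow> a \<in> {1..n} \<Longrightarrow> E k * x = x \<Longrightarrow> t a * x = c (\<xi> powi snd (k a)) * x"
  by (metis t_E mult.assoc)

text \<open>
  On \<open>E k\<close>, the difference \<open>X\<^sub>b - X\<^sub>a\<close> is the nonzero difference of the eigenvalues plus a
  difference of commuting nilpotents.
\<close>

lemma diff_inverse: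
  assumes "k \<in> K" "a \<in> {1..n}" "b \<in> {1..n}" "fst (k a) \<noteq> fst (k b)"
  shows "\<exists>w. w \<in> Alg \<and> (X b - X a) * w = E k \<and> E k * w = w"
proof -
  let ?\<alpha> = "q powi fst (k a)" and ?\<beta> = "q powi fst (k b)"
  obtain N where N: "(X a - c ?\<alpha>) ^ N * E k = 0" "(X b - c ?\<beta>) ^ N * E k = 0"
    using E_eigen[OF assms(1)] assms(2,3) by blast
  have "?\<beta> - ?\<alpha> \<noteq> 0" using q_powi_inj K_reps assms by (metis right_minus_eq)
  then obtain h where h: "h \<in> subalgebra {X b - c ?\<beta>, X a - c ?\<alpha>}"
    "(c (?\<beta> - ?\<alpha>) + (X b - c ?\<beta>) - (X a - c ?\<alpha>)) * (h * E k) = E k"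
    using solve_invertible[of "?\<beta> - ?\<alpha>" "X b - c ?\<beta>" "X a - c ?\<alpha>" N "E k" N] N
      Alg_commute[of "X b - c ?\<beta>" "X a - c ?\<alpha>"] assms by (auto simp: Alg_closed)
  have "c (?\<beta> - ?\<alpha>) + (X b - c ?\<beta>) - (X a - c ?\<alpha>) = X b - X a" by (simp add: c_diff)
  with h(2) have 1: "(X b - X a) * (h * E k) = E k" by simp
  have "X b - c ?\<beta> \<in> Alg" "X a - c ?\<alpha> \<in> Alg" using assms(2,3) by (simp_all add: Alg_closed)
  then have hA: "h \<in> Alg"
    unfolding Alg_def by (intro subalgebra_mono[OF h(1)]) auto
  have "E k * (h * E k) = h * E k"
    using E_comm[OF assms(1) hA] E_idem[OF assms(1)] by (metis mult.assoc)
  then show ?thesis using 1 hA assms(1) by (intro exI[of _ "h * E k"]) (auto intro: Alg_closed)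
qed

lemma diff_cancel:
  assumes "k \<in> K" "a \<in> {1..n}" "b \<in> {1..n}" "fst (k a) \<noteq> fst (k b)" "E k * x = x" "E k * y = y"
    "(X b - X a) * x = (X b - X a) * y"
  shows "x = y"
proof -
  obtain w where w: "w \<in> Alg" "(X b - X a) * w = E k" using diff_inverse[OF assms(1-4)] by blast
  have "w * (X b - X a) = E k"
    using w Alg_commute[of w "X b - X a"] assms by (simp add: Alg_closed)
  then show ?thesis by (metis assms(5-7) mult.assoc)
qed

text \<open>
  The inverse of \<open>X\<^sub>b - X\<^sub>a\<close> on the weight \<open>k\<close>.
\<close>

definition diff_inv :: "nat \<Rightarrow> nat \<Rightarrow> (nat \<Rightarrow> int \<times> int) \<Rightarrow> 'r"
  where "diff_inv a b k = (SOME w. w \<in> Alg \<and> (X b - X a) * w = E k \<and> E k * w = w)"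

lemma diff_inv:
  assumes "k \<in> K" "a \<in> {1..n}" "b \<in> {1..n}" "fst (k a) \<noteq> fst (k b)"
  shows "diff_inv a b k \<in> Alg" "(X b - X a) * diff_inv a b k = E k" "E k * diff_inv a b k = diff_inv a b k"
  using someI_ex[OF diff_inverse[OF assms]] unfolding diff_inv_def by auto

text \<open>
  The summand of the intertwiner on the weight \<open>k\<close>, for an arbitrary pair of places: the fraction
  \<open>(1 - X\<^sub>a X\<^sub>b\<^sup>-\<^sup>1)\<^sup>-\<^sup>1\<close> is written as \<open>X\<^sub>b (X\<^sub>b - X\<^sub>a)\<^sup>-\<^sup>1\<close>. Pairs of places that are not adjacent
  arise when coefficients are moved past intertwiners.
\<close>

definition \<beta> :: "nat \<Rightarrow> nat \<Rightarrow> (nat \<Rightarrow> int \<times> int) \<Rightarrow> 'r"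
  where "\<beta> a b k =
    (if snd (k a) \<noteq> snd (k b) then 0
     else if fst (k a) = fst (k b) then E k
     else c (1 - q) * (X b * diff_inv a b k))"

lemma \<beta>_in: "k \<in> K \<Longrightarrow> a \<in> {1..n} \<Longrightarrow> b \<in> {1..n} \<Longrightarrow> \<beta> a b k \<in> Alg"
  unfolding \<beta>_def by (simp add: Alg_closed diff_inv(1))

lemma E_\<beta>:
  assumes "k \<in> K" "a \<in> {1..n}" "b \<in> {1..n}"
  shows "E k * \<beta> a b k = \<beta> a b k"
proof -
  have "E k * (X b * diff_inv a b k) = X b * diff_inv a b k" if "fst (k a) \<noteq> fst (k b)"
    using assoc_left[OF E_comm[OF assms(1) X_in[OF assms(3)], symmetric]] diff_inv(3)[OF assms that]
    by (simp add: mult.assoc)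
  then show ?thesis
    unfolding \<beta>_def using E_idem[OF assms(1)] by (simp add: c_comm_left[of "E k"])
qed

lemma \<beta>_E: "k \<in> K \<Longrightarrow> a \<in> {1..n} \<Longrightarrow> b \<in> {1..n} \<Longrightarrow> \<beta> a b k * E k = \<beta> a b k"
  using E_comm[OF _ \<beta>_in] E_\<beta> by simp

lemma \<beta>_E_other:
  "k \<in> K \<Longrightarrow> l \<in> K \<Longrightarrow> k \<noteq> l \<Longrightarrow> a \<in> {1..n} \<Longrightarrow> b \<in> {1..n} \<Longrightarrow> \<beta> a b k * E l = 0"
  using arg_cong[OF E_orth[of k l], of "\<lambda>x. \<beta> a b k * x"] by (simp add: \<beta>_E flip: mult.assoc)

lemma \<beta>_diff:
  "k \<in> K \<Longrightarrow> a \<in> {1..n} \<Longrightarrow> b \<in> {1..n} \<Longrightarrow> snd (k a) = snd (k b) \<Longrightarrow> fst (k a) \<noteq> fst (k b) \<Longrightarrow>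
    (X b - X a) * \<beta> a b k = c (1 - q) * (X b * E k)"
  unfolding \<beta>_def using diff_inv(2)[of k a b] assoc_left[OF Alg_commute[of "X b - X a" "X b"]]
  by (simp add: Alg_closed c_comm_left[of "X b - X a"] mult.assoc)

lemma \<beta>_eq_0: "snd (k a) \<noteq> snd (k b) \<Longrightarrow> \<beta> a b k = 0"
  by (simp add: \<beta>_def)

lemma \<beta>_equal: "k a = k b \<Longrightarrow> \<beta> a b k = E k"
  by (simp add: \<beta>_def)

text \<open>
  In the fractional case both sides become equal after multiplication by \<open>X\<^sub>b\<^sub>' - X\<^sub>a\<^sub>'\<close>, and this
  factor can be cancelled on the weight \<open>k'\<close>.
\<close>

lemma \<beta>_transport:
  assumes "k \<in> K" "k' \<in> K" "a \<in> {1..n}" "b \<in> {1..n}" "a' \<in> {1..n}" "b' \<in> {1..n}"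
    and "k' a' = k a" "k' b' = k b"
    and tau: "\<tau> * E k = E k' * \<tau>" "\<tau> * (X a * E k) = X a' * (\<tau> * E k)" "\<tau> * (X b * E k) = X b' * (\<tau> * E k)"
  shows "\<tau> * \<beta> a b k = \<beta> a' b' k' * \<tau>"
proof -
  consider "snd (k a) \<noteq> snd (k b)" | "k a = k b" | "snd (k a) = snd (k b)" "fst (k a) \<noteq> fst (k b)"
    by (metis prod_eq_iff)
  then show ?thesis
  proof cases
    case 1
    then show ?thesis using assms by (simp add: \<beta>_eq_0)
  next
    case 2
    then show ?thesis using assms by (simp add: \<beta>_equal)
  next
    case 3
    let ?\<beta> = "\<beta> a b k" and ?\<beta>' = "\<beta> a' b' k'"
    note E\<beta> = E_\<beta>[OF assms(1,3,4)] and E\<beta>' = E_\<beta>[OF assms(2,5,6)]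
    have TX: "\<tau> * (X a * ?\<beta>) = X a' * (\<tau> * ?\<beta>)" "\<tau> * (X b * ?\<beta>) = X b' * (\<tau> * ?\<beta>)"
      using arg_cong[OF tau(2), of "\<lambda>x. x * ?\<beta>"] arg_cong[OF tau(3), of "\<lambda>x. x * ?\<beta>"]
      by (simp_all only: mult.assoc E\<beta>)
    have "(X b' - X a') * (\<tau> * ?\<beta>) = \<tau> * ((X b - X a) * ?\<beta>)"
      by (simp only: left_diff_distrib right_diff_distrib TX)
    also have "\<dots> = c (1 - q) * (X b' * (E k' * \<tau>))"
      using 3 assms by (simp add: \<beta>_diff c_comm_left[of \<tau>])
    also have "\<dots> = (X b' - X a') * ?\<beta>' * \<tau>"
      using 3 assms by (simp add: \<beta>_diff mult.assoc)
    finally have "(X b' - X a') * (\<tau> * ?\<beta>) = (X b' - X a') * (?\<beta>' * \<tau>)" by (simp only: mult.assoc)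
    moreover have "E k' * (\<tau> * ?\<beta>) = \<tau> * ?\<beta>" by (metis tau(1) E\<beta> mult.assoc)
    moreover have "E k' * (?\<beta>' * \<tau>) = ?\<beta>' * \<tau>" by (metis E\<beta>' mult.assoc)
    ultimately show ?thesis using diff_cancel[OF assms(2,5,6)] 3 assms(7,8) by metis
  qed
qed

text \<open>
  On the weight \<open>k\<close>, the element \<open>e\<^sub>a\<close> is the mean of the powers of the quotient of the eigenvalues
  of \<open>t\<^sub>a\<close> and \<open>t\<^sub>a\<^sub>+\<^sub>1\<close>. This is a \<open>d\<close>-th root of unity, and the sum of its powers vanishes unless it
  is \<open>1\<close>.
\<close>

lemma e_E:
  assumes "k \<in> K" "a \<in> {1..<n}"
  shows "e a * E k = (if snd (k a) = snd (k (a + 1)) then E k else 0)"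
proof -
  define \<zeta> where "\<zeta> b = \<xi> powi snd (k b)" for b
  have a: "a \<in> {1..n}" "a + 1 \<in> {1..n}" using assms(2) by auto
  have \<zeta>: "\<zeta> b \<noteq> 0" "\<zeta> b ^ d = 1" for b
    using \<xi>_neq_0 \<xi>_powi_d by (simp_all add: \<zeta>_def power_int_eq_0_iff)
  have pow: "t b ^ r * E k = c (\<zeta> b ^ r) * E k" if "b \<in> {1..n}" for b r
  proof (induction r)
    case (Suc r)
    then show ?case
      using t_E[OF assms(1) that] by (simp add: mult.assoc c_mult c_comm_left[of "t b"] \<zeta>_def)
        (rule c_comm_left)
  qed (simp add: c_1)
  have "t a ^ r * t (a + 1) ^ (d - r) * E k = c ((\<zeta> a / \<zeta> (a + 1)) ^ r) * E k" if "r < d" for r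
  proof -
    have "t a ^ r * t (a + 1) ^ (d - r) * E k = c (\<zeta> (a + 1) ^ (d - r)) * (t a ^ r * E k)"
      by (simp only: mult.assoc pow[OF a(2)] c_comm_left)
    also have "\<dots> = c (\<zeta> (a + 1) ^ (d - r) * \<zeta> a ^ r) * E k"
      by (simp only: pow[OF a(1)] c_mult mult.assoc)
    also have "\<zeta> (a + 1) ^ (d - r) * \<zeta> a ^ r = (\<zeta> a / \<zeta> (a + 1)) ^ r"
      using that \<zeta>[of "a + 1"] by (simp add: power_diff power_divide)
    finally show ?thesis .
  qed
  then have "e a * E k = c (1 / of_nat d) * (c (\<Sum>r<d. (\<zeta> a / \<zeta> (a + 1)) ^ r) * E k)"
    by (simp add: e_def mult.assoc sum_distrib_right c_sum)
  moreover have "(\<Sum>r<d. (\<zeta> a / \<zeta> (a + 1)) ^ r) = (if snd (k a) = snd (k (a + 1)) then of_nat d else 0)"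
  proof (cases "snd (k a) = snd (k (a + 1))")
    case True
    then have "\<zeta> a / \<zeta> (a + 1) = 1" using \<zeta>(1)[of a] by (simp add: \<zeta>_def)
    then show ?thesis using True by simp
  next
    case False
    then have "\<zeta> a \<noteq> \<zeta> (a + 1)" unfolding \<zeta>_def using \<xi>_powi_inj K_reps(2)[OF assms(1)] a by blast
    then have ne: "\<zeta> a / \<zeta> (a + 1) \<noteq> 1" using \<zeta>(1)[of "a + 1"] by simp
    have "(\<zeta> a / \<zeta> (a + 1)) ^ d = 1" by (simp only: power_divide \<zeta> div_self one_neq_zero not_False_eq_True)
    from sum_powers_root[OF this ne] show ?thesis using False by (simp only: if_False)
  qed
  ultimately show ?thesis using d_char by (auto simp: c_0 c_1 simp flip: c_mult mult.assoc)
qed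

definition \<Phi> :: "nat \<Rightarrow> 'r"
  where "\<Phi> a = g a + (\<Sum>k\<in>{k\<in>K. E k \<noteq> 0}. \<beta> a (a + 1) k)"

lemma sum_\<beta>_E:
  assumes "k \<in> K" "a \<in> {1..n}" "b \<in> {1..n}"
  shows "(\<Sum>l\<in>{k\<in>K. E k \<noteq> 0}. \<beta> a b l) * E k = \<beta> a b k"
proof -
  have "(\<Sum>l\<in>{k\<in>K. E k \<noteq> 0}. \<beta> a b l * E k) = (\<Sum>l\<in>{k\<in>K. E k \<noteq> 0}. if l = k then \<beta> a b k else 0)"
    by (rule sum.cong) (use assms in \<open>auto simp: \<beta>_E \<beta>_E_other\<close>)
  also have "\<dots> = \<beta> a b k"
    using assms E_finite \<beta>_E[OF assms] by (auto simp: sum.delta)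
  finally show ?thesis by (simp add: sum_distrib_right)
qed

lemma \<Phi>_E: "k \<in> K \<Longrightarrow> a \<in> {1..<n} \<Longrightarrow> \<Phi> a * E k = g a * E k + \<beta> a (a + 1) k"
  by (simp add: \<Phi>_def distrib_right sum_\<beta>_E)

lemma sum_\<beta>_in: "a \<in> {1..n} \<Longrightarrow> b \<in> {1..n} \<Longrightarrow> (\<Sum>k\<in>{k\<in>K. E k \<noteq> 0}. \<beta> a b k) \<in> Alg"
  using \<beta>_in unfolding Alg_def by (intro subalgebra_sum) auto

lemma \<Phi>_X_far:
  assumes "a \<in> {1..<n}" "b \<in> {1..n}" "b \<noteq> a" "b \<noteq> a + 1"
  shows "\<Phi> a * X b = X b * \<Phi> a"
  using g_X[OF assms] Alg_commute[OF sum_\<beta>_in[of a "a + 1"] X_in[OF assms(2)]] assms(1)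
  by (simp add: \<Phi>_def distrib_left distrib_right)

end

section \<open>Intertwiners and Jucys--Murphy elements; squares\<close>

context yokonuma_hecke_idempotents
begin

lemma eq_by_E:
  assumes "\<And>k. k \<in> K \<Longrightarrow> x * E k = y * E k"
  shows "x = y"
proof -
  have "(\<Sum>k\<in>{k\<in>K. E k \<noteq> 0}. x * E k) = (\<Sum>k\<in>{k\<in>K. E k \<noteq> 0}. y * E k)"
    by (rule sum.cong) (auto intro: assms)
  then show ?thesis by (simp add: E_sum flip: sum_distrib_left)
qed

lemma g_X_same_E:
  assumes "k \<in> K" "a \<in> {1..<n}"
  shows "g a * (X a * E k) = X (a + 1) * (g a * E k) -
    (if snd (k a) = snd (k (a + 1)) then c (q - 1) * (X (a + 1) * E k) else 0)"
proof -
  have "e a * (X (a + 1) * E k) = X (a + 1) * (e a * E k)"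
    using e_X[OF assms(2), of "a + 1"] assms(2) by (simp flip: mult.assoc)
  then show ?thesis
    using arg_cong[OF g_X_same[OF assms(2)], of "\<lambda>x. x * E k"] e_E[OF assms]
    by (simp add: mult.assoc left_diff_distrib)
qed

lemma g_X_next_E:
  assumes "k \<in> K" "a \<in> {1..<n}"
  shows "g a * (X (a + 1) * E k) = X a * (g a * E k) +
    (if snd (k a) = snd (k (a + 1)) then c (q - 1) * (X (a + 1) * E k) else 0)"
proof -
  have "e a * (X (a + 1) * E k) = X (a + 1) * (e a * E k)"
    using e_X[OF assms(2), of "a + 1"] assms(2) by (simp flip: mult.assoc)
  then show ?thesis
    using arg_cong[OF g_X_next[OF assms(2)], of "\<lambda>x. x * E k"] e_E[OF assms]
    by (simp add: mult.assoc distrib_right)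
qed

lemma g_g_E:
  assumes "k \<in> K" "a \<in> {1..<n}"
  shows "g a * (g a * E k) = c q * E k + (if snd (k a) = snd (k (a + 1)) then c (q - 1) * (g a * E k) else 0)"
  using arg_cong[OF g_square[OF assms(2)], of "\<lambda>x. x * E k"] e_E[OF assms]
  by (simp add: mult.assoc distrib_right)

lemma \<Phi>_Alg_E:
  assumes "k \<in> K" "a \<in> {1..<n}" "x \<in> Alg"
  shows "\<Phi> a * (x * E k) = g a * (x * E k) + \<beta> a (a + 1) k * x"
  using arg_cong[OF \<Phi>_E[OF assms(1,2)], of "\<lambda>y. y * x"] E_comm[OF assms(1,3)]
  by (simp add: mult.assoc distrib_right)

text \<open>
  The exchange rules for \<open>g\<^sub>a\<close> have the same correction term with opposite signs, and \<open>\<beta>\<close> is chosen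
  so that \<open>(X\<^sub>a\<^sub>+\<^sub>1 - X\<^sub>a) \<beta>\<close> offsets it. If the two places are equal, \<open>\<beta>\<close> is one instead of a
  fraction, and the defect is what is left; so it is the same in both rules.
\<close>

lemma \<Phi>_X_defect:
  fixes a k
  assumes "k \<in> K" "a \<in> {1..<n}"
  defines "R \<equiv> if k a = k (a + 1) then c q * (X (a + 1) * E k) - X a * E k else 0"
  shows "\<Phi> a * (X (a + 1) * E k) = X a * (\<Phi> a * E k) + R"
    and "X (a + 1) * (\<Phi> a * E k) = \<Phi> a * (X a * E k) + R"
proof -
  have a: "a \<in> {1..n}" "a + 1 \<in> {1..n}" using assms(2) by auto
  let ?\<beta> = "\<beta> a (a + 1) k"
  let ?\<delta> = "if snd (k a) = snd (k (a + 1)) then c (q - 1) * (X (a + 1) * E k) else 0"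
  have "X (a + 1) * ?\<beta> = X a * ?\<beta> - ?\<delta> + R"
  proof (cases "k a = k (a + 1)")
    case True
    then show ?thesis by (simp add: \<beta>_equal R_def c_diff c_1 left_diff_distrib)
  next
    case False
    then show ?thesis
      using \<beta>_diff[OF assms(1) a] \<beta>_eq_0[of k a "a + 1"]
      by (cases "snd (k a) = snd (k (a + 1))")
         (auto simp: R_def prod_eq_iff c_diff left_diff_distrib algebra_simps)
  qed
  moreover have "?\<beta> * X b = X b * ?\<beta>" if "b \<in> {1..n}" for b
    using Alg_commute \<beta>_in[OF assms(1) a] X_in[OF that] by simp
  ultimately show "\<Phi> a * (X (a + 1) * E k) = X a * (\<Phi> a * E k) + R"
    and "X (a + 1) * (\<Phi> a * E k) = \<Phi> a * (X a * E k) + R"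
    unfolding \<Phi>_Alg_E[OF assms(1,2) X_in[OF a(1)]] \<Phi>_Alg_E[OF assms(1,2) X_in[OF a(2)]]
      \<Phi>_E[OF assms(1,2)] g_X_same_E[OF assms(1,2)] g_X_next_E[OF assms(1,2)]
    using a by (simp_all only: distrib_left) (simp_all add: algebra_simps)
qed

lemma \<Phi>_X_next: "k \<in> K \<Longrightarrow> a \<in> {1..<n} \<Longrightarrow> k a \<noteq> k (a + 1) \<Longrightarrow>
    \<Phi> a * (X (a + 1) * E k) = X a * (\<Phi> a * E k)"
  and \<Phi>_X_same: "k \<in> K \<Longrightarrow> a \<in> {1..<n} \<Longrightarrow> k a \<noteq> k (a + 1) \<Longrightarrow>
    \<Phi> a * (X a * E k) = X (a + 1) * (\<Phi> a * E k)"
  and \<Phi>_X_next_equal: "k \<in> K \<Longrightarrow> a \<in> {1..<n} \<Longrightarrow> k a = k (a + 1) \<Longrightarrow>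
    \<Phi> a * (X (a + 1) * E k) = X a * (\<Phi> a * E k) + (c q * (X (a + 1) * E k) - X a * E k)"
  and \<Phi>_X_same_equal: "k \<in> K \<Longrightarrow> a \<in> {1..<n} \<Longrightarrow> k a = k (a + 1) \<Longrightarrow>
    X (a + 1) * (\<Phi> a * E k) = \<Phi> a * (X a * E k) + (c q * (X (a + 1) * E k) - X a * E k)"
  using \<Phi>_X_defect[of k a] by simp_all

lemma swap_in_K: "k \<in> K \<Longrightarrow> a \<in> {1..<n} \<Longrightarrow> swap_places a k \<in> K"
  unfolding yh_K_def swap_places_def PiE_iff
  by (auto simp: transpose_def extensional_def)

lemma swap_swap: "swap_places a (swap_places a k) = k"
  by (simp add: swap_places_def comp_assoc)

text \<open>
  The coefficient commutes with \<open>t\<^sub>b\<close> whereas \<open>g\<^sub>a\<close> moves the index of \<open>t\<^sub>b\<close>, but where the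
  coefficient is nonzero \<open>t\<^sub>a\<close> and \<open>t\<^sub>a\<^sub>+\<^sub>1\<close> act by the same scalar.
\<close>

lemma \<Phi>_t:
  assumes "k \<in> K" "a \<in> {1..<n}" "b \<in> {1..n}"
  shows "\<Phi> a * (t b * E k) = t (transpose a (a + 1) b) * (\<Phi> a * E k)"
proof -
  let ?b = "transpose a (a + 1) b"
  have a: "a \<in> {1..n}" "a + 1 \<in> {1..n}" and b: "?b \<in> {1..n}"
    using assms(2,3) by (auto simp: transpose_def)
  have g: "g a * t b = t ?b * g a" using t_g[OF b assms(2)] by simp
  have "\<beta> a (a + 1) k * t b = t ?b * \<beta> a (a + 1) k"
  proof (cases "snd (k a) = snd (k (a + 1))")
    case True
    then have "snd (k ?b) = snd (k b)" by (auto simp: transpose_def)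
    then have "t ?b * \<beta> a (a + 1) k = t b * \<beta> a (a + 1) k"
      using t_E_mult[OF assms(1) _ E_\<beta>[OF assms(1) a]] b assms(3) by simp
    then show ?thesis using Alg_commute[OF \<beta>_in[OF assms(1) a] t_in[OF assms(3)]] by simp
  qed (simp add: \<beta>_eq_0)
  then show ?thesis
    unfolding \<Phi>_Alg_E[OF assms(1,2) t_in[OF assms(3)]] \<Phi>_E[OF assms(1,2)]
    using g by (simp add: distrib_left flip: mult.assoc)
qed

lemma weightI:
  assumes "\<And>a. a \<in> {1..n} \<Longrightarrow> \<exists>N. (X a - c (q powi fst (k a))) ^ N * x = 0"
    and "\<And>a. a \<in> {1..n} \<Longrightarrow> t a * x = c (\<xi> powi snd (k a)) * x"
  shows "weight k x"
proof -
  obtain N where N: "\<And>a. a \<in> {1..n} \<Longrightarrow> (X a - c (q powi fst (k a))) ^ N a * x = 0"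
    using assms(1) by metis
  let ?M = "Max (N ` {1..n})"
  have "(X a - c (q powi fst (k a))) ^ ?M * x = 0" if "a \<in> {1..n}" for a
  proof -
    have "N a \<le> ?M" using that by simp
    then have "(X a - c (q powi fst (k a))) ^ ?M =
        (X a - c (q powi fst (k a))) ^ (?M - N a) * (X a - c (q powi fst (k a))) ^ N a"
      by (simp flip: power_add)
    then show ?thesis using N[OF that] by (simp add: mult.assoc)
  qed
  then show ?thesis unfolding weight_def using assms(2) by (intro exI[of _ ?M]) (simp add: left_diff_distrib)
qed

text \<open>
  An exchange rule with an additive correction passes to powers: in the commutative algebra the
  corrections add up to a multiple of the original one.
\<close>

lemma shift_power:
  assumes "k \<in> K" "u \<in> Alg" "v \<in> Alg" "z \<in> Alg"
    and "u * (\<tau> * E k) = \<tau> * (v * E k) + z * E k"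
  shows "\<exists>y\<in>Alg. (u - c \<alpha>) ^ N * (\<tau> * E k) = \<tau> * ((v - c \<alpha>) ^ N * E k) + y * (z * E k)"
proof (induction N)
  case 0
  then show ?case by (intro bexI[of _ 0]) (simp_all add: Alg_0)
next
  case (Suc N)
  then obtain y where y: "y \<in> Alg"
    "(u - c \<alpha>) ^ N * (\<tau> * E k) = \<tau> * ((v - c \<alpha>) ^ N * E k) + y * (z * E k)" by blast
  let ?v = "(v - c \<alpha>) ^ N"
  have vA: "?v \<in> Alg" using assms(3) by (simp add: Alg_closed)
  have "(u - c \<alpha>) * (\<tau> * E k) = \<tau> * ((v - c \<alpha>) * E k) + z * E k"
    using assms(5) by (simp add: left_diff_distrib right_diff_distrib c_comm_left[of \<tau>])
  from arg_cong[OF this, of "\<lambda>x. x * ?v"]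
  have "(u - c \<alpha>) * (\<tau> * (?v * E k)) = \<tau> * ((v - c \<alpha>) * (?v * E k)) + z * (?v * E k)"
    by (simp add: mult.assoc distrib_right E_comm[OF assms(1) vA])
  moreover have "z * (?v * E k) = ?v * (z * E k)"
    using Alg_commute[OF assms(4) vA] by (simp flip: mult.assoc)
  ultimately have "(u - c \<alpha>) ^ Suc N * (\<tau> * E k) =
      \<tau> * ((v - c \<alpha>) ^ Suc N * E k) + (?v + (u - c \<alpha>) * y) * (z * E k)"
    by (simp add: mult.assoc y(2) distrib_left distrib_right)
  then show ?case using y(1) assms vA by (intro bexI[of _ "?v + (u - c \<alpha>) * y"]) (simp_all add: Alg_closed)
qed

text \<open>
  A correction term occurs only if the two places are equal. Then it has weight \<open>k = \<sigma>\<^sub>a k\<close>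
  itself, so that a higher power of \<open>X\<^sub>b - q\<^sup>i\<close>, where \<open>q\<^sup>i\<close> is the eigenvalue, kills it.
\<close>

lemma weight_\<Phi>:
  assumes "k \<in> K" "a \<in> {1..<n}"
  shows "weight (swap_places a k) (\<Phi> a * E k)"
proof (rule weightI)
  fix b assume b: "b \<in> {1..n}"
  let ?b = "transpose a (a + 1) b"
  have b': "?b \<in> {1..n}" using b assms(2) by (auto simp: transpose_def)
  have "\<Phi> a * (t ?b * E k) = t b * (\<Phi> a * E k)" using \<Phi>_t[OF assms b'] by simp
  then show "t b * (\<Phi> a * E k) = c (\<xi> powi snd (swap_places a k b)) * (\<Phi> a * E k)"
    using t_E[OF assms(1) b'] by (simp add: swap_places_def c_comm_left[of "\<Phi> a"])
  have "\<exists>z\<in>Alg. X b * (\<Phi> a * E k) = \<Phi> a * (X ?b * E k) + z * E k \<and> (z = 0 \<or> k b = k ?b)"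
  proof (cases "b = a \<or> b = a + 1")
    case False
    then have "X b * (\<Phi> a * E k) = \<Phi> a * (X b * E k)"
      using \<Phi>_X_far[OF assms(2) b] by (simp flip: mult.assoc)
    moreover have "?b = b" using False by simp
    ultimately show ?thesis by (intro bexI[of _ 0]) (simp_all add: Alg_0)
  next
    case True
    show ?thesis
    proof (cases "k a = k (a + 1)")
      case False
      then show ?thesis using True \<Phi>_X_next[OF assms False] \<Phi>_X_same[OF assms False]
        by (intro bexI[of _ 0]) (auto simp: Alg_0)
    next
      case same: True
      let ?z = "c q * X (a + 1) - X a"
      have z: "?z \<in> Alg" "- ?z \<in> Alg" "?z * E k = c q * (X (a + 1) * E k) - X a * E k"
        using assms(2) Alg_diff[of 0 ?z] by (simp_all add: Alg_closed left_diff_distrib mult.assoc)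
      from True show ?thesis
      proof
        assume "b = a"
        then show ?thesis using \<Phi>_X_next_equal[OF assms same] z same
          by (intro bexI[of _ "- ?z"]) (simp_all add: algebra_simps)
      next
        assume "b = a + 1"
        then show ?thesis using \<Phi>_X_same_equal[OF assms same] z same
          by (intro bexI[of _ "?z"]) simp_all
      qed
    qed
  qed
  then obtain z where z: "z \<in> Alg" "X b * (\<Phi> a * E k) = \<Phi> a * (X ?b * E k) + z * E k" "z = 0 \<or> k b = k ?b"
    by blast
  let ?\<alpha> = "q powi fst (k ?b)"
  obtain N where N: "(X ?b - c ?\<alpha>) ^ N * E k = 0" "(X b - c (q powi fst (k b))) ^ N * E k = 0"
    using E_eigen[OF assms(1)] b b' by blast
  obtain y where y: "y \<in> Alg"
    "(X b - c ?\<alpha>) ^ N * (\<Phi> a * E k) = \<Phi> a * ((X ?b - c ?\<alpha>) ^ N * E k) + y * (z * E k)"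
    using shift_power[OF assms(1) X_in[OF b] X_in[OF b'] z(1,2)] by blast
  have "(X b - c ?\<alpha>) ^ N * (y * (z * E k)) = (y * z) * ((X b - c ?\<alpha>) ^ N * E k)"
    using Alg_commute[of "(X b - c ?\<alpha>) ^ N" "y * z"] y(1) z(1) b by (simp add: Alg_closed flip: mult.assoc)
  also have "\<dots> = 0" using N(2) z(3) by auto
  finally have "(X b - c ?\<alpha>) ^ (N + N) * (\<Phi> a * E k) = 0"
    by (simp only: power_add mult.assoc y(2) N(1) mult_zero_right add_0_left)
  then show "\<exists>N. (X b - c (q powi fst (swap_places a k b))) ^ N * (\<Phi> a * E k) = 0"
    by (auto simp: swap_places_def)
qed

text \<open>
  Two elements are compared on every weight \<open>l\<close>; for \<open>l \<noteq> k\<close> both sides vanish because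
  \<open>\<sigma>\<^sub>a l \<noteq> \<sigma>\<^sub>a k\<close>.
\<close>

lemma \<Phi>_E_swap:
  assumes "k \<in> K" "a \<in> {1..<n}"
  shows "\<Phi> a * E k = E (swap_places a k) * \<Phi> a"
proof -
  have "E (swap_places a k) * \<Phi> a * E l = (\<Phi> a * E k) * E l" if l: "l \<in> K" for l
  proof (cases "l = k")
    case True
    then show ?thesis
      using weight_E_fix[OF swap_in_K[OF assms] weight_\<Phi>[OF assms]] E_idem[OF assms(1)] by (simp add: mult.assoc)
  next
    case False
    then have "swap_places a l \<noteq> swap_places a k" by (metis swap_swap)
    then have "E (swap_places a k) * (\<Phi> a * E l) = 0"
      using weight_E_other[OF swap_in_K[OF l assms(2)] swap_in_K[OF assms] _ weight_\<Phi>[OF l assms(2)]] by simp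
    then show ?thesis using E_orth[OF assms(1) l] False by (simp add: mult.assoc)
  qed
  then show ?thesis using eq_by_E by metis
qed

lemma \<Phi>_X:
  assumes "k \<in> K" "a \<in> {1..<n}" "k a \<noteq> k (a + 1)" "b \<in> {1..n}"
  shows "\<Phi> a * (X b * E k) = X (transpose a (a + 1) b) * (\<Phi> a * E k)"
proof -
  consider "b = a" | "b = a + 1" | "b \<noteq> a" "b \<noteq> a + 1" by blast
  then show ?thesis
  proof cases
    case 1
    then show ?thesis using \<Phi>_X_same[OF assms(1-3)] by simp
  next
    case 2
    then show ?thesis using \<Phi>_X_next[OF assms(1-3)] by simp
  next
    case 3
    then show ?thesis using \<Phi>_X_far[OF assms(2,4)] by (simp flip: mult.assoc)
  qed
qed

lemma \<Phi>_\<beta>: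
  assumes "k \<in> K" "a \<in> {1..<n}" "k a \<noteq> k (a + 1)" "b \<in> {1..n}" "b' \<in> {1..n}"
  shows "\<Phi> a * \<beta> b b' k = \<beta> (transpose a (a + 1) b) (transpose a (a + 1) b') (swap_places a k) * (\<Phi> a * E k)"
proof -
  have "transpose a (a + 1) b \<in> {1..n}" "transpose a (a + 1) b' \<in> {1..n}"
    using assms by (auto simp: transpose_def)
  then have "\<Phi> a * \<beta> b b' k = \<beta> (transpose a (a + 1) b) (transpose a (a + 1) b') (swap_places a k) * \<Phi> a"
    by (intro \<beta>_transport[OF assms(1) swap_in_K[OF assms(1,2)] assms(4,5) _ _ _ _
          \<Phi>_E_swap[OF assms(1,2)] \<Phi>_X[OF assms(1-4)] \<Phi>_X[OF assms(1-3,5)]])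
       (simp_all add: swap_places_def)
  from arg_cong[OF this, of "\<lambda>x. x * E k"] show ?thesis
    by (simp only: mult.assoc \<beta>_E[OF assms(1,4,5)])
qed

text \<open>
  An intertwiner commutes with the coefficient part of a distant one by transport of the
  coefficients, since it leaves the two places concerned alone. The statement for the intertwiners
  then follows from the commutation of the \<open>g\<close>.
\<close>

lemma \<Phi>_commute_far:
  assumes "a \<in> {1..<n}" "b \<in> {1..<n}" "a + 1 < b \<or> b + 1 < a"
  shows "\<Phi> a * \<Phi> b = \<Phi> b * \<Phi> a"
proof -
  let ?H = "\<lambda>a. \<Sum>k\<in>{k\<in>K. E k \<noteq> 0}. \<beta> a (a + 1) k"
  have far: "\<Phi> b * ?H a = ?H a * \<Phi> b" if "a \<in> {1..<n}" "b \<in> {1..<n}" "a + 1 < b \<or> b + 1 < a" for a b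
  proof (rule eq_by_E)
    fix k assume k: "k \<in> K"
    let ?k = "swap_places b k"
    have a: "a \<in> {1..n}" "a + 1 \<in> {1..n}" using that by auto
    have "?k a = k a" "?k (a + 1) = k (a + 1)" using that(3) by (auto simp: swap_places_def)
    moreover have "\<Phi> b * (X a * E k) = X a * (\<Phi> b * E k)" "\<Phi> b * (X (a + 1) * E k) = X (a + 1) * (\<Phi> b * E k)"
    proof -
      have "\<Phi> b * X a = X a * \<Phi> b" "\<Phi> b * X (a + 1) = X (a + 1) * \<Phi> b"
        using that(3) by (intro \<Phi>_X_far[OF that(2)] a; linarith)+
      then show "\<Phi> b * (X a * E k) = X a * (\<Phi> b * E k)" "\<Phi> b * (X (a + 1) * E k) = X (a + 1) * (\<Phi> b * E k)"
        by (simp_all only: mult.assoc[symmetric])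
    qed
    ultimately have "\<Phi> b * \<beta> a (a + 1) k = \<beta> a (a + 1) ?k * \<Phi> b"
      by (intro \<beta>_transport[OF k swap_in_K[OF k that(2)] a a] \<Phi>_E_swap[OF k that(2)])
    also have "\<dots> = ?H a * (\<Phi> b * E k)"
      unfolding \<Phi>_E_swap[OF k that(2)] using sum_\<beta>_E[OF swap_in_K[OF k that(2)] a] by (simp flip: mult.assoc)
    finally show "\<Phi> b * ?H a * E k = ?H a * \<Phi> b * E k"
      using sum_\<beta>_E[OF k a] by (simp add: mult.assoc)
  qed
  have H: "?H a * ?H b = ?H b * ?H a"
    using assms(1,2) by (intro Alg_commute sum_\<beta>_in) auto
  have \<Phi>: "\<Phi> a = g a + ?H a" "\<Phi> b = g b + ?H b" by (simp_all only: \<Phi>_def)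
  have "\<Phi> a * \<Phi> b = g a * g b + ?H a * g b + \<Phi> a * ?H b"
    by (simp only: \<Phi> distrib_left distrib_right add.assoc)
  moreover have "\<Phi> b * \<Phi> a = g b * g a + ?H b * g a + \<Phi> b * ?H a"
    by (simp only: \<Phi> distrib_left distrib_right add.assoc)
  ultimately show ?thesis
    using far[OF assms] far[OF assms(2,1) disj_commute[THEN iffD1, OF assms(3)]] g_far'[OF assms] H
    unfolding \<Phi> by (simp add: distrib_left distrib_right add.commute add.left_commute)
qed

text \<open>
  The numerators of \<open>X\<^sub>b / (X\<^sub>b - X\<^sub>a)\<close> and \<open>- X\<^sub>a / (X\<^sub>b - X\<^sub>a)\<close> add up to the denominator.
\<close>

lemma \<beta>_flip:
  assumes "k \<in> K" "a \<in> {1..n}" "b \<in> {1..n}" "snd (k a) = snd (k b)" "fst (k a) \<noteq> fst (k b)"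
  shows "\<beta> a b k + \<beta> b a k = c (1 - q) * E k"
proof (rule diff_cancel[OF assms(1-3,5)])
  have "(X b - X a) * \<beta> b a k = - ((X a - X b) * \<beta> b a k)"
    by (simp add: left_diff_distrib)
  also have "\<dots> = - (c (1 - q) * (X a * E k))"
    using \<beta>_diff[OF assms(1,3,2)] assms(4,5) by simp
  finally show "(X b - X a) * (\<beta> a b k + \<beta> b a k) = (X b - X a) * (c (1 - q) * E k)"
    by (simp only: distrib_left \<beta>_diff[OF assms])
       (simp add: c_left left_diff_distrib right_diff_distrib)
qed (simp_all only: distrib_left E_\<beta>[OF assms(1-3)] E_\<beta>[OF assms(1,3,2)] E_idem[OF assms(1)] c_comm_left[of "E k"])

text \<open>
  Moving the coefficient of the left factor past \<open>\<Phi>\<^sub>a\<close> turns it into \<open>\<beta>\<^sub>a\<^sub>+\<^sub>1\<^sub>,\<^sub>a(k)\<close>; then the terms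
  linear in \<open>g\<^sub>a\<close> cancel by the quadratic relation.
\<close>

lemma \<Phi>_square:
  assumes "k \<in> K" "a \<in> {1..<n}" "k a \<noteq> k (a + 1)"
  shows "\<Phi> a * (\<Phi> a * E k) = c q * E k + \<beta> a (a + 1) k * \<beta> (a + 1) a k"
proof -
  let ?k = "swap_places a k" and ?\<beta> = "\<beta> a (a + 1) k" and ?\<beta>' = "\<beta> (a + 1) a k"
  have a: "a \<in> {1..n}" "a + 1 \<in> {1..n}" using assms(2) by auto
  note sk = swap_in_K[OF assms(1,2)]
  have tr: "\<beta> a (a + 1) ?k * (\<Phi> a * E k) = \<Phi> a * E k * ?\<beta>'"
    using \<Phi>_\<beta>[OF assms a(2) a(1)] E_\<beta>[OF assms(1) a(2,1)] by (simp add: mult.assoc)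
  have "\<Phi> a * (\<Phi> a * E k) = \<Phi> a * E ?k * (\<Phi> a * E k)"
    using weight_E_fix[OF sk weight_\<Phi>[OF assms(1,2)]] by (simp add: mult.assoc)
  also have "\<dots> = g a * (\<Phi> a * E k) + (\<Phi> a * E k) * ?\<beta>'"
    unfolding \<Phi>_E[OF sk assms(2)] distrib_right tr
    using weight_E_fix[OF sk weight_\<Phi>[OF assms(1,2)]] by (simp add: mult.assoc)
  also have "\<dots> = g a * (g a * E k) + g a * (?\<beta> + ?\<beta>') + ?\<beta> * ?\<beta>'"
    unfolding \<Phi>_E[OF assms(1,2)] using E_\<beta>[OF assms(1) a(2,1)]
    by (simp add: distrib_left distrib_right mult.assoc)
  also have "g a * (g a * E k) + g a * (?\<beta> + ?\<beta>') = c q * E k"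
  proof (cases "snd (k a) = snd (k (a + 1))")
    case True
    then have "?\<beta> + ?\<beta>' = c (1 - q) * E k"
      using \<beta>_flip[OF assms(1) a] assms(3) by (simp add: prod_eq_iff)
    then show ?thesis unfolding g_g_E[OF assms(1,2)] using True
      by (simp add: c_left right_diff_distrib c_diff left_diff_distrib)
  next
    case False
    then show ?thesis unfolding g_g_E[OF assms(1,2)] by (simp add: \<beta>_eq_0)
  qed
  finally show ?thesis .
qed

text \<open>
  Here \<open>\<Phi>\<^sub>a = g\<^sub>a + 1\<close>, and \<open>g\<^sub>a\<^sup>2 = q + (q - 1) g\<^sub>a\<close>.
\<close>

lemma \<Phi>_square_equal:
  assumes "k \<in> K" "a \<in> {1..<n}" "k a = k (a + 1)"
  shows "\<Phi> a * (\<Phi> a * E k) = c (q + 1) * (\<Phi> a * E k)"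
proof -
  have sk: "swap_places a k = k" using assms(3) by (auto simp: swap_places_def transpose_def)
  have E\<Phi>: "E k * (\<Phi> a * E k) = \<Phi> a * E k"
    using weight_E_fix[OF assms(1)] weight_\<Phi>[OF assms(1,2)] sk by simp
  have "\<Phi> a * (\<Phi> a * E k) = \<Phi> a * E k * (\<Phi> a * E k)"
    using E\<Phi> by (simp add: mult.assoc)
  also have "\<dots> = g a * (\<Phi> a * E k) + \<Phi> a * E k"
    unfolding \<Phi>_E[OF assms(1,2)] \<beta>_equal[OF assms(3)] distrib_right
    using E\<Phi> unfolding \<Phi>_E[OF assms(1,2)] \<beta>_equal[OF assms(3)] by (simp add: mult.assoc)
  also have "\<dots> = c (q + 1) * (\<Phi> a * E k)"
    unfolding \<Phi>_E[OF assms(1,2)] \<beta>_equal[OF assms(3)] distrib_left g_g_E[OF assms(1,2)] using assms(3)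
    by (simp add: c_add c_diff c_1 left_diff_distrib distrib_right)
  finally show ?thesis .
qed

end

section \<open>Coefficients and generators at places with equal entries\<close>

context yokonuma_hecke_idempotents
begin

lemma c_q: "c (q - 1) = - c (1 - q)"
  by (simp flip: c_minus)

lemma \<beta>_diff_mult:
  "k \<in> K \<Longrightarrow> a \<in> {1..n} \<Longrightarrow> b \<in> {1..n} \<Longrightarrow> snd (k a) = snd (k b) \<Longrightarrow> fst (k a) \<noteq> fst (k b) \<Longrightarrow>
    (X b - X a) * (\<beta> a b k * y) = c (1 - q) * (X b * (E k * y))"
  using \<beta>_diff[of k a b] by (simp flip: mult.assoc)

lemma g_X_fixed:
  assumes "k \<in> K" "a \<in> {1..<n}" "b = a + 1" "snd (k a) = snd (k b)" "E k * y = y"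
  shows "X b * (g a * y) = g a * (X a * y) - c (1 - q) * (X b * y)"
    and "X a * (g a * y) = g a * (X b * y) + c (1 - q) * (X b * y)"
  using arg_cong[OF g_X_same_E[OF assms(1,2)], of "\<lambda>x. x * y"]
    arg_cong[OF g_X_next_E[OF assms(1,2)], of "\<lambda>x. x * y"] assms(4)
  unfolding assms(3)[symmetric]
  by (simp_all add: mult.assoc left_diff_distrib distrib_right c_q assms(5))

lemma g_X_mult: "b \<in> {1..<n} \<Longrightarrow> a \<in> {1..n} \<Longrightarrow> a \<noteq> b \<Longrightarrow> a \<noteq> b + 1 \<Longrightarrow> X a * (g b * y) = g b * (X a * y)"
  using g_X[of b a] by (simp flip: mult.assoc)

lemma E_g_equal:
  assumes "k \<in> K" "a \<in> {1..<n}" "k a = k (a + 1)"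
  shows "E k * (g a * E k) = g a * E k"
proof -
  have "swap_places a k = k" using assms(3) by (auto simp: swap_places_def transpose_def)
  then have "E k * (\<Phi> a * E k) = \<Phi> a * E k"
    using weight_E_fix[OF assms(1)] weight_\<Phi>[OF assms(1,2)] by simp
  then show ?thesis
    unfolding \<Phi>_E[OF assms(1,2)] \<beta>_equal[OF assms(3)] by (simp add: distrib_left E_idem[OF assms(1)])
qed

lemma \<beta>_X_flip:
  assumes "k \<in> K" "a \<in> {1..n}" "b \<in> {1..n}" "snd (k a) = snd (k b)" "fst (k a) \<noteq> fst (k b)"
  shows "X a * \<beta> a b k = - (X b * \<beta> b a k)"
proof -
  have "X b * \<beta> a b k - X a * \<beta> a b k = X b * (c (1 - q) * E k)"
    using \<beta>_diff[OF assms] by (simp add: left_diff_distrib c_left)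
  also have "\<dots> = X b * \<beta> a b k + X b * \<beta> b a k"
    unfolding \<beta>_flip[OF assms, symmetric] by (simp add: distrib_left)
  finally have "X a * \<beta> a b k + X b * \<beta> b a k = 0" by (simp add: algebra_simps)
  then show ?thesis by (simp only: eq_neg_iff_add_eq_0)
qed

text \<open>
  At places \<open>a\<close> and \<open>b = a + 1\<close> with equal entries \<open>g\<^sub>a\<close> preserves the weight but does not
  simply exchange \<open>X\<^sub>a\<close> and \<open>X\<^sub>b\<close>, so moving a coefficient past it produces an additional term
  without \<open>g\<^sub>a\<close>. The identities are checked after multiplication by the denominator of the
  coefficient that is moved.
\<close>

lemma \<beta>_g_first:
  assumes k: "k \<in> K" and a: "a \<in> {1..<n}" "b = a + 1" and r: "r \<in> {1..n}" "r \<noteq> a" "r \<noteq> b"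
    and S: "k a = k b" and D: "snd (k a) = snd (k r)" "fst (k a) \<noteq> fst (k r)"
  shows "\<beta> b r k * (g a * E k) = g a * \<beta> a r k + \<beta> r b k * \<beta> a r k"
    and "\<beta> a r k * (g a * E k) = g a * \<beta> b r k - \<beta> r b k * \<beta> a r k"
proof -
  let ?\<kappa> = "c (1 - q)"
  have ab: "a \<in> {1..n}" "b \<in> {1..n}" using a by auto
  have Db: "snd (k b) = snd (k r)" "fst (k b) \<noteq> fst (k r)" using S D by auto
  have Dr: "snd (k r) = snd (k b)" "fst (k r) \<noteq> fst (k b)" using Db by auto
  have EgE: "E k * (g a * E k) = g a * E k" using E_g_equal[OF k a(1)] S a(2) by simp
  have gr: "X r * (g a * y) = g a * (X r * y)" for y
    using g_X_mult[OF a(1) r(1,2)] r(3) a(2) by simp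
  note gX = g_X_fixed[OF k a arg_cong[OF S]]
  note E\<beta> = E_\<beta>[OF k ab(1) r(1)] E_\<beta>[OF k ab(2) r(1)] E_\<beta>[OF k r(1) ab(2)]
  have Eg: "E k * (g a * y) = g a * y" if "E k * y = y" for y
    using arg_cong[OF EgE, of "\<lambda>x. x * y"] that by (simp add: mult.assoc)
  have comm: "\<beta> r b k * \<beta> a r k = \<beta> a r k * \<beta> r b k"
    by (intro Alg_commute \<beta>_in k r ab)
  have E\<beta>\<beta>: "E k * (\<beta> r b k * \<beta> a r k) = \<beta> r b k * \<beta> a r k"
    using E\<beta>(3) by (simp flip: mult.assoc)
  show "\<beta> b r k * (g a * E k) = g a * \<beta> a r k + \<beta> r b k * \<beta> a r k"
  proof (rule diff_cancel[OF k ab(2) r(1) Db(2)])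
    have "(X r - X b) * (g a * \<beta> a r k) = g a * ((X r - X a) * \<beta> a r k) + ?\<kappa> * (X b * \<beta> a r k)"
      using gX(1)[OF E\<beta>(1)] by (simp add: left_diff_distrib right_diff_distrib gr)
    moreover have "(X r - X b) * (\<beta> r b k * \<beta> a r k) = - ((X b - X r) * (\<beta> r b k * \<beta> a r k))"
      by (simp add: left_diff_distrib)
    ultimately show "(X r - X b) * (\<beta> b r k * (g a * E k)) = (X r - X b) * (g a * \<beta> a r k + \<beta> r b k * \<beta> a r k)"
      by (simp only: distrib_left \<beta>_diff_mult[OF k ab(2) r(1) Db] \<beta>_diff_mult[OF k r(1) ab(2) Dr]
          \<beta>_diff[OF k ab(1) r(1) D] EgE E\<beta>) (simp add: gr c_left)
  next
    show "E k * (\<beta> b r k * (g a * E k)) = \<beta> b r k * (g a * E k)"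
      using E\<beta>(2) by (simp flip: mult.assoc)
  qed (simp add: distrib_left Eg E\<beta> E\<beta>\<beta>)
  show "\<beta> a r k * (g a * E k) = g a * \<beta> b r k - \<beta> r b k * \<beta> a r k"
  proof (rule diff_cancel[OF k ab(1) r(1) D(2)])
    have "(X r - X a) * (g a * \<beta> b r k) = g a * ((X r - X b) * \<beta> b r k) - ?\<kappa> * (X b * \<beta> b r k)"
      using gX(2)[OF E\<beta>(2)] by (simp add: left_diff_distrib right_diff_distrib gr)
    then show "(X r - X a) * (\<beta> a r k * (g a * E k)) = (X r - X a) * (g a * \<beta> b r k - \<beta> r b k * \<beta> a r k)"
      by (simp only: right_diff_distrib \<beta>_diff_mult[OF k ab(1) r(1) D] comm \<beta>_X_flip[OF k ab(2) r(1) Db]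
          \<beta>_diff[OF k ab(2) r(1) Db] EgE E\<beta>) (simp add: gr c_left)
  next
    show "E k * (\<beta> a r k * (g a * E k)) = \<beta> a r k * (g a * E k)"
      using E\<beta>(1) by (simp flip: mult.assoc)
  qed (simp add: right_diff_distrib Eg E\<beta> E\<beta>\<beta>)
qed

text \<open>
  The mirror image of the preceding lemma, with the third place on the left.
\<close>

lemma \<beta>_g_second:
  assumes k: "k \<in> K" and b: "b \<in> {1..<n}" "r = b + 1" and a: "a \<in> {1..n}" "a \<noteq> b" "a \<noteq> r"
    and S: "k b = k r" and D: "snd (k a) = snd (k b)" "fst (k a) \<noteq> fst (k b)"
  shows "\<beta> a b k * (g b * E k) = g b * \<beta> a r k + \<beta> b a k * \<beta> a r k"
    and "\<beta> a r k * (g b * E k) = g b * \<beta> a b k - \<beta> b a k * \<beta> a r k"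
proof -
  let ?\<kappa> = "c (1 - q)"
  have br: "b \<in> {1..n}" "r \<in> {1..n}" using b by auto
  have Dr: "snd (k a) = snd (k r)" "fst (k a) \<noteq> fst (k r)" using S D by auto
  have Db: "snd (k b) = snd (k a)" "fst (k b) \<noteq> fst (k a)" using D by auto
  have EgE: "E k * (g b * E k) = g b * E k" using E_g_equal[OF k b(1)] S b(2) by simp
  have ga: "X a * (g b * y) = g b * (X a * y)" for y
    using g_X_mult[OF b(1) a(1,2)] a(3) b(2) by simp
  note gX = g_X_fixed[OF k b arg_cong[OF S]]
  note E\<beta> = E_\<beta>[OF k a(1) br(1)] E_\<beta>[OF k a(1) br(2)] E_\<beta>[OF k br(1) a(1)] E_idem[OF k]
  have Eg: "E k * (g b * y) = g b * y" if "E k * y = y" for y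
    using arg_cong[OF EgE, of "\<lambda>x. x * y"] that by (simp add: mult.assoc)
  have comm: "\<beta> b a k * \<beta> a r k = \<beta> a r k * \<beta> b a k"
    by (intro Alg_commute \<beta>_in k br a)
  have E\<beta>\<beta>: "E k * (\<beta> b a k * \<beta> a r k) = \<beta> b a k * \<beta> a r k"
    using E\<beta>(3) by (simp flip: mult.assoc)
  have diff_ar: "X r * \<beta> a r k = X a * \<beta> a r k + ?\<kappa> * (X r * E k)"
    using \<beta>_diff[OF k a(1) br(2) Dr] by (simp add: left_diff_distrib diff_eq_eq add.commute)
  show "\<beta> a b k * (g b * E k) = g b * \<beta> a r k + \<beta> b a k * \<beta> a r k"
  proof (rule diff_cancel[OF k a(1) br(1) D(2)])
    have "(X b - X a) * (g b * \<beta> a r k) = g b * ((X r - X a) * \<beta> a r k) + ?\<kappa> * (X r * \<beta> a r k)"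
      using gX(2)[OF E\<beta>(2)] by (simp add: left_diff_distrib right_diff_distrib ga)
    moreover have "(X b - X a) * (\<beta> b a k * \<beta> a r k) = - ((X a - X b) * (\<beta> b a k * \<beta> a r k))"
      by (simp add: left_diff_distrib)
    ultimately show "(X b - X a) * (\<beta> a b k * (g b * E k)) = (X b - X a) * (g b * \<beta> a r k + \<beta> b a k * \<beta> a r k)"
      by (simp only: distrib_left \<beta>_diff_mult[OF k a(1) br(1) D] \<beta>_diff_mult[OF k br(1) a(1) Db]
          \<beta>_diff[OF k a(1) br(2) Dr] EgE E\<beta> gX(2)[OF E\<beta>(4)] diff_ar) (simp add: distrib_left c_left)
  next
    show "E k * (\<beta> a b k * (g b * E k)) = \<beta> a b k * (g b * E k)"
      using E\<beta>(1) by (simp flip: mult.assoc)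
  qed (simp add: distrib_left Eg E\<beta> E\<beta>\<beta>)
  show "\<beta> a r k * (g b * E k) = g b * \<beta> a b k - \<beta> b a k * \<beta> a r k"
  proof (rule diff_cancel[OF k a(1) br(2) Dr(2)])
    have "X r * \<beta> a b k + X r * \<beta> b a k = X r * (?\<kappa> * E k)"
      using \<beta>_flip[OF k a(1) br(1) D] by (simp flip: distrib_left)
    then have sum: "X r * \<beta> b a k = ?\<kappa> * (X r * E k) - X r * \<beta> a b k"
      by (simp add: c_left eq_diff_eq add.commute)
    have "(X r - X a) * (g b * \<beta> a b k) = g b * ((X b - X a) * \<beta> a b k) - ?\<kappa> * (X r * \<beta> a b k)"
      using gX(1)[OF E\<beta>(1)] by (simp add: left_diff_distrib right_diff_distrib ga)
    then show "(X r - X a) * (\<beta> a r k * (g b * E k)) = (X r - X a) * (g b * \<beta> a b k - \<beta> b a k * \<beta> a r k)"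
      by (simp only: right_diff_distrib \<beta>_diff_mult[OF k a(1) br(2) Dr] comm
          \<beta>_diff[OF k a(1) br(1) D] EgE E\<beta> gX(1)[OF E\<beta>(4)] sum) (simp add: right_diff_distrib c_left)
  next
    show "E k * (\<beta> a r k * (g b * E k)) = \<beta> a r k * (g b * E k)"
      using E\<beta>(2) by (simp flip: mult.assoc)
  qed (simp add: right_diff_distrib Eg E\<beta> E\<beta>\<beta>)
qed

text \<open>
  The partial fraction identity behind the braid relation. It holds because
  \<open>X\<^sub>r - X\<^sub>a = (X\<^sub>r - X\<^sub>b) + (X\<^sub>b - X\<^sub>a)\<close>.
\<close>

lemma \<beta>_three_terms:
  assumes k: "k \<in> K" and abr: "a \<in> {1..n}" "b \<in> {1..n}" "r \<in> {1..n}"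
    and j: "snd (k a) = snd (k b)" "snd (k b) = snd (k r)"
    and i: "fst (k a) \<noteq> fst (k b)" "fst (k b) \<noteq> fst (k r)" "fst (k a) \<noteq> fst (k r)"
  shows "\<beta> a b k * \<beta> b r k = \<beta> a r k * \<beta> a b k + \<beta> a r k * \<beta> b r k - c (1 - q) * \<beta> a r k"
proof (rule diff_cancel[OF k abr(1,3) i(3)])
  let ?\<kappa> = "c (1 - q)"
  have j13: "snd (k a) = snd (k r)" using j by simp
  note E\<beta> = E_\<beta>[OF k abr(1,2)] E_\<beta>[OF k abr(2,3)] E_\<beta>[OF k abr(1,3)]
  have comm: "\<beta> b r k * \<beta> a b k = \<beta> a b k * \<beta> b r k"
    by (intro Alg_commute \<beta>_in k abr)
  have "(X r - X a) * (\<beta> a b k * \<beta> b r k) = (X r - X b) * (\<beta> b r k * \<beta> a b k) + (X b - X a) * (\<beta> a b k * \<beta> b r k)"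
    by (simp add: comm left_diff_distrib)
  also have "\<dots> = ?\<kappa> * (X r * \<beta> a b k) + ?\<kappa> * (X b * \<beta> b r k)"
    by (simp only: \<beta>_diff_mult[OF k abr(2,3) j(2) i(2)] \<beta>_diff_mult[OF k abr(1,2) j(1) i(1)] E\<beta>)
  also have "X b * \<beta> b r k = X r * \<beta> b r k - ?\<kappa> * (X r * E k)"
    using \<beta>_diff[OF k abr(2,3) j(2) i(2)] by (simp add: left_diff_distrib algebra_simps)
  finally show "(X r - X a) * (\<beta> a b k * \<beta> b r k) =
      (X r - X a) * (\<beta> a r k * \<beta> a b k + \<beta> a r k * \<beta> b r k - ?\<kappa> * \<beta> a r k)"
    by (simp only: distrib_left right_diff_distrib \<beta>_diff_mult[OF k abr(1,3) j13 i(3)] E\<beta>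
        c_comm_left[of "X r - X a"] \<beta>_diff[OF k abr(1,3) j13 i(3)]) simp
next
  note E\<beta> = E_\<beta>[OF k abr(1,2)] E_\<beta>[OF k abr(2,3)] E_\<beta>[OF k abr(1,3)]
  show "E k * (\<beta> a b k * \<beta> b r k) = \<beta> a b k * \<beta> b r k"
    using E\<beta> by (simp flip: mult.assoc)
  have "E k * (\<beta> a r k * y) = \<beta> a r k * y" for y
    using E\<beta> by (simp flip: mult.assoc)
  then show "E k * (\<beta> a r k * \<beta> a b k + \<beta> a r k * \<beta> b r k - c (1 - q) * \<beta> a r k) =
      \<beta> a r k * \<beta> a b k + \<beta> a r k * \<beta> b r k - c (1 - q) * \<beta> a r k"
    using E\<beta>(3) by (simp add: distrib_left right_diff_distrib c_comm_left[of "E k"])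
qed

end

section \<open>The braid relation\<close>

locale consecutive_places = yokonuma_hecke_idempotents c d n q \<xi> g t E
  for c :: "'k::field \<Rightarrow> 'r::ring_1" and d n q \<xi> g t E +
  fixes a b r :: nat
  assumes a: "a \<in> {1..<n}" and b: "b \<in> {1..<n}" and b_eq: "b = a + 1" and r_eq: "r = b + 1"
begin

abbreviation s1 where "s1 \<equiv> swap_places a"
abbreviation s2 where "s2 \<equiv> swap_places b"

lemma places: "a \<in> {1..n}" "b \<in> {1..n}" "r \<in> {1..n}"
  and places_neq: "a \<noteq> b" "b \<noteq> r" "a \<noteq> r" "b \<noteq> a" "r \<noteq> b" "r \<noteq> a"
  using a b b_eq r_eq by auto

lemma s_eval [simp]:
  "s1 k a = k b" "s1 k b = k a" "s1 k r = k r" "s2 k a = k a" "s2 k b = k r" "s2 k r = k b"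
  by (simp_all add: swap_places_def b_eq r_eq)

lemma transpose_eval:
  "transpose a (a + 1) a = b" "transpose a (a + 1) b = a" "transpose a (a + 1) r = r"
  "transpose b (b + 1) a = a" "transpose b (b + 1) b = r" "transpose b (b + 1) r = b"
  by (simp_all add: b_eq r_eq)

lemma s_in_K: "k \<in> K \<Longrightarrow> s1 k \<in> K" "k \<in> K \<Longrightarrow> s2 k \<in> K"
  using swap_in_K a b by auto

lemma \<Phi>_fixed:
  assumes "k \<in> K" "E k * y = y"
  shows "\<Phi> a * y = g a * y + \<beta> a b k * y" and "\<Phi> b * y = g b * y + \<beta> b r k * y"
  using arg_cong[OF \<Phi>_E[OF assms(1) a], of "\<lambda>x. x * y"]
    arg_cong[OF \<Phi>_E[OF assms(1) b], of "\<lambda>x. x * y"] assms(2)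
  by (simp_all only: mult.assoc distrib_right b_eq[symmetric] r_eq[symmetric])

lemma E_\<Phi>_fixed:
  assumes "k \<in> K" "E k * y = y"
  shows "E (s1 k) * (\<Phi> a * y) = \<Phi> a * y" and "E (s2 k) * (\<Phi> b * y) = \<Phi> b * y"
proof -
  have "E (s1 k) * \<Phi> a * y = \<Phi> a * y" "E (s2 k) * \<Phi> b * y = \<Phi> b * y"
    unfolding \<Phi>_E_swap[OF assms(1) a, symmetric] \<Phi>_E_swap[OF assms(1) b, symmetric]
    using assms(2) by (simp_all add: mult.assoc)
  then show "E (s1 k) * (\<Phi> a * y) = \<Phi> a * y" "E (s2 k) * (\<Phi> b * y) = \<Phi> b * y"
    by (simp_all only: mult.assoc)
qed

lemma \<beta>_\<Phi>_first:
  assumes "k \<in> K" "k a \<noteq> k b" "E k * y = y"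
  shows "\<beta> a b (s1 k) * (\<Phi> a * y) = \<Phi> a * (\<beta> b a k * y)"
    "\<beta> b a (s1 k) * (\<Phi> a * y) = \<Phi> a * (\<beta> a b k * y)"
    "\<beta> b r (s1 k) * (\<Phi> a * y) = \<Phi> a * (\<beta> a r k * y)"
    "\<beta> a r (s1 k) * (\<Phi> a * y) = \<Phi> a * (\<beta> b r k * y)"
proof -
  have "\<Phi> a * (\<beta> u v k * y) = \<beta> (transpose a (a + 1) u) (transpose a (a + 1) v) (s1 k) * (\<Phi> a * y)"
    if "u \<in> {1..n}" "v \<in> {1..n}" for u v
    using arg_cong[OF \<Phi>_\<beta>[OF assms(1) a assms(2)[unfolded b_eq] that], of "\<lambda>x. x * y"] assms(3)
    by (simp only: mult.assoc)
  from this[OF places(2,1)] this[OF places(1,2)] this[OF places(1,3)] this[OF places(2,3)]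
  show "\<beta> a b (s1 k) * (\<Phi> a * y) = \<Phi> a * (\<beta> b a k * y)"
    "\<beta> b a (s1 k) * (\<Phi> a * y) = \<Phi> a * (\<beta> a b k * y)"
    "\<beta> b r (s1 k) * (\<Phi> a * y) = \<Phi> a * (\<beta> a r k * y)"
    "\<beta> a r (s1 k) * (\<Phi> a * y) = \<Phi> a * (\<beta> b r k * y)"
    by (simp_all only: transpose_eval)
qed

lemma \<beta>_\<Phi>_second:
  assumes "k \<in> K" "k b \<noteq> k r" "E k * y = y"
  shows "\<beta> b r (s2 k) * (\<Phi> b * y) = \<Phi> b * (\<beta> r b k * y)"
    "\<beta> r b (s2 k) * (\<Phi> b * y) = \<Phi> b * (\<beta> b r k * y)"
    "\<beta> a b (s2 k) * (\<Phi> b * y) = \<Phi> b * (\<beta> a r k * y)"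
    "\<beta> a r (s2 k) * (\<Phi> b * y) = \<Phi> b * (\<beta> a b k * y)"
proof -
  have "\<Phi> b * (\<beta> u v k * y) = \<beta> (transpose b (b + 1) u) (transpose b (b + 1) v) (s2 k) * (\<Phi> b * y)"
    if "u \<in> {1..n}" "v \<in> {1..n}" for u v
    using arg_cong[OF \<Phi>_\<beta>[OF assms(1) b assms(2)[unfolded r_eq] that], of "\<lambda>x. x * y"] assms(3)
    by (simp only: mult.assoc)
  from this[OF places(3,2)] this[OF places(2,3)] this[OF places(1,3)] this[OF places(1,2)]
  show "\<beta> b r (s2 k) * (\<Phi> b * y) = \<Phi> b * (\<beta> r b k * y)"
    "\<beta> r b (s2 k) * (\<Phi> b * y) = \<Phi> b * (\<beta> b r k * y)"
    "\<beta> a b (s2 k) * (\<Phi> b * y) = \<Phi> b * (\<beta> a r k * y)"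
    "\<beta> a r (s2 k) * (\<Phi> b * y) = \<Phi> b * (\<beta> a b k * y)"
    by (simp_all only: transpose_eval)
qed

lemma braid_g: "g a * (g b * (g a * y)) = g b * (g a * (g b * y))"
  using arg_cong[OF g_braid[OF a], of "\<lambda>x. x * y"] b by (simp add: b_eq mult.assoc)

lemma \<beta>s_in:
  assumes "k \<in> K"
  shows "\<beta> a b k \<in> Alg" "\<beta> b a k \<in> Alg" "\<beta> b r k \<in> Alg" "\<beta> r b k \<in> Alg" "\<beta> a r k \<in> Alg"
  using assms places by (simp_all add: \<beta>_in)

lemma E_\<beta>s:
  assumes "k \<in> K"
  shows "E k * (\<beta> a b k * y) = \<beta> a b k * y" "E k * (\<beta> b a k * y) = \<beta> b a k * y"
    "E k * (\<beta> b r k * y) = \<beta> b r k * y" "E k * (\<beta> r b k * y) = \<beta> r b k * y"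
    "E k * (\<beta> a r k * y) = \<beta> a r k * y"
    "\<beta> a b k * E k = \<beta> a b k" "\<beta> b a k * E k = \<beta> b a k" "\<beta> b r k * E k = \<beta> b r k"
    "\<beta> r b k * E k = \<beta> r b k" "\<beta> a r k * E k = \<beta> a r k"
    "E k * \<beta> a b k = \<beta> a b k" "E k * \<beta> b a k = \<beta> b a k" "E k * \<beta> b r k = \<beta> b r k"
    "E k * \<beta> r b k = \<beta> r b k" "E k * \<beta> a r k = \<beta> a r k"
  using assms places by (simp_all add: E_\<beta> \<beta>_E flip: mult.assoc)

text \<open>
  In this and the next three lemmas the leftmost intertwiner is expanded, and its coefficient is
  moved to the right through the other factors.
\<close>

lemma \<Phi>_second_first:
  assumes "k \<in> K" "k a \<noteq> k b"
  shows "\<Phi> b * (\<Phi> a * E k) = g b * (\<Phi> a * E k) + \<Phi> a * \<beta> a r k"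
  using \<Phi>_fixed(2)[OF s_in_K(1) E_\<Phi>_fixed(1)] \<beta>_\<Phi>_first(3) assms E_idem by (simp add: E_\<beta>s)

lemma \<Phi>_first_second:
  assumes "k \<in> K" "k b \<noteq> k r"
  shows "\<Phi> a * (\<Phi> b * E k) = g a * (\<Phi> b * E k) + \<Phi> b * \<beta> a r k"
  using \<Phi>_fixed(1)[OF s_in_K(2) E_\<Phi>_fixed(2)] \<beta>_\<Phi>_second(3) assms E_idem by (simp add: E_\<beta>s)

lemma \<Phi>_first_second_first:
  assumes "k \<in> K" "k a \<noteq> k b" "k a \<noteq> k r"
  shows "\<Phi> a * (\<Phi> b * (\<Phi> a * E k)) = g a * (\<Phi> b * (\<Phi> a * E k)) + \<Phi> b * (\<Phi> a * \<beta> b r k)"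
proof -
  note EE = E_idem[OF assms(1)]
  have 1: "E (s1 k) * (\<Phi> a * E k) = \<Phi> a * E k" by (rule E_\<Phi>_fixed(1)[OF assms(1) EE])
  have 2: "E (s2 (s1 k)) * (\<Phi> b * (\<Phi> a * E k)) = \<Phi> b * (\<Phi> a * E k)"
    by (rule E_\<Phi>_fixed(2)[OF s_in_K(1)[OF assms(1)] 1])
  have "\<beta> a b (s2 (s1 k)) * (\<Phi> b * (\<Phi> a * E k)) = \<Phi> b * (\<beta> a r (s1 k) * (\<Phi> a * E k))"
    by (rule \<beta>_\<Phi>_second(3)[OF s_in_K(1)[OF assms(1)] _ 1]) (use assms(3) in simp)
  also have "\<beta> a r (s1 k) * (\<Phi> a * E k) = \<Phi> a * \<beta> b r k"
    using \<beta>_\<Phi>_first(4)[OF assms(1,2) EE] by (simp add: E_\<beta>s assms(1))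
  finally show ?thesis
    using \<Phi>_fixed(1)[OF s_in_K(2)[OF s_in_K(1)[OF assms(1)]] 2] by simp
qed

lemma \<Phi>_second_first_second:
  assumes "k \<in> K" "k b \<noteq> k r" "k a \<noteq> k r"
  shows "\<Phi> b * (\<Phi> a * (\<Phi> b * E k)) = g b * (\<Phi> a * (\<Phi> b * E k)) + \<Phi> a * (\<Phi> b * \<beta> a b k)"
proof -
  note EE = E_idem[OF assms(1)]
  have 1: "E (s2 k) * (\<Phi> b * E k) = \<Phi> b * E k" by (rule E_\<Phi>_fixed(2)[OF assms(1) EE])
  have 2: "E (s1 (s2 k)) * (\<Phi> a * (\<Phi> b * E k)) = \<Phi> a * (\<Phi> b * E k)"
    by (rule E_\<Phi>_fixed(1)[OF s_in_K(2)[OF assms(1)] 1])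
  have "\<beta> b r (s1 (s2 k)) * (\<Phi> a * (\<Phi> b * E k)) = \<Phi> a * (\<beta> a r (s2 k) * (\<Phi> b * E k))"
    by (rule \<beta>_\<Phi>_first(3)[OF s_in_K(2)[OF assms(1)] _ 1]) (use assms(3) in simp)
  also have "\<beta> a r (s2 k) * (\<Phi> b * E k) = \<Phi> b * \<beta> a b k"
    using \<beta>_\<Phi>_second(4)[OF assms(1,2) EE] by (simp add: E_\<beta>s assms(1))
  finally show ?thesis
    using \<Phi>_fixed(2)[OF s_in_K(1)[OF s_in_K(2)[OF assms(1)]] 2] by simp
qed

lemma \<Phi>_\<beta>_expand:
  assumes "k \<in> K" "E k * y = y"
  shows "\<Phi> a * y = g a * y + \<beta> a b k * y"
    "k a \<noteq> k b \<Longrightarrow> \<Phi> b * (\<Phi> a * y) = g b * (g a * y) + g b * (\<beta> a b k * y) + g a * (\<beta> a r k * y) + \<beta> a b k * (\<beta> a r k * y)"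
    "\<Phi> b * y = g b * y + \<beta> b r k * y"
    "k b \<noteq> k r \<Longrightarrow> \<Phi> a * (\<Phi> b * y) = g a * (g b * y) + g a * (\<beta> b r k * y) + g b * (\<beta> a r k * y) + \<beta> b r k * (\<beta> a r k * y)"
proof -
  show 1: "\<Phi> a * y = g a * y + \<beta> a b k * y" "\<Phi> b * y = g b * y + \<beta> b r k * y"
    by (rule \<Phi>_fixed[OF assms])+
  show "\<Phi> b * (\<Phi> a * y) = g b * (g a * y) + g b * (\<beta> a b k * y) + g a * (\<beta> a r k * y) + \<beta> a b k * (\<beta> a r k * y)"
    if "k a \<noteq> k b"
    using arg_cong[OF \<Phi>_second_first[OF assms(1) that], of "\<lambda>x. x * y"] \<Phi>_fixed(1)[OF assms(1) E_\<beta>s(5)[OF assms(1)], of y]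
    by (simp add: mult.assoc distrib_right assms(2) 1 distrib_left)
  show "\<Phi> a * (\<Phi> b * y) = g a * (g b * y) + g a * (\<beta> b r k * y) + g b * (\<beta> a r k * y) + \<beta> b r k * (\<beta> a r k * y)"
    if "k b \<noteq> k r"
    using arg_cong[OF \<Phi>_first_second[OF assms(1) that], of "\<lambda>x. x * y"] \<Phi>_fixed(2)[OF assms(1) E_\<beta>s(5)[OF assms(1)], of y]
    by (simp add: mult.assoc distrib_right assms(2) 1 distrib_left)
qed

lemma g_g_fixed:
  assumes "k \<in> K" "E k * y = y"
  shows "g a * (g a * y) = c q * y - (if snd (k a) = snd (k b) then c (1 - q) * (g a * y) else 0)"
    and "g b * (g b * y) = c q * y - (if snd (k b) = snd (k r) then c (1 - q) * (g b * y) else 0)"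
  using arg_cong[OF g_g_E[OF assms(1) a], of "\<lambda>x. x * y"] arg_cong[OF g_g_E[OF assms(1) b], of "\<lambda>x. x * y"]
  unfolding b_eq[symmetric] r_eq[symmetric]
  by (simp_all add: mult.assoc distrib_right assms(2) c_q)

lemma \<beta>_comms:
  assumes "k \<in> K"
  shows "\<beta> b r k * \<beta> a b k = \<beta> a b k * \<beta> b r k" "\<beta> a r k * \<beta> a b k = \<beta> a b k * \<beta> a r k"
    "\<beta> b r k * \<beta> a r k = \<beta> a r k * \<beta> b r k"
    "\<beta> b r k * (\<beta> a b k * y) = \<beta> a b k * (\<beta> b r k * y)" "\<beta> a r k * (\<beta> a b k * y) = \<beta> a b k * (\<beta> a r k * y)"
    "\<beta> b r k * (\<beta> a r k * y) = \<beta> a r k * (\<beta> b r k * y)"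
proof -
  show 1: "\<beta> b r k * \<beta> a b k = \<beta> a b k * \<beta> b r k" "\<beta> a r k * \<beta> a b k = \<beta> a b k * \<beta> a r k"
    "\<beta> b r k * \<beta> a r k = \<beta> a r k * \<beta> b r k"
    by (rule Alg_commute; rule \<beta>s_in[OF assms])+
  show "\<beta> b r k * (\<beta> a b k * y) = \<beta> a b k * (\<beta> b r k * y)" "\<beta> a r k * (\<beta> a b k * y) = \<beta> a b k * (\<beta> a r k * y)"
    "\<beta> b r k * (\<beta> a r k * y) = \<beta> a r k * (\<beta> b r k * y)"
    by (simp_all only: 1 mult.assoc[symmetric])
qed

text \<open>
  After expansion both sides agree up to the coefficients of \<open>g\<^sub>a\<close> and \<open>g\<^sub>b\<close>. These agree by the
  partial fraction identity if the second entries of all three places coincide; otherwise so many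
  coefficients vanish that both are zero.
\<close>

lemma braid_distinct:
  assumes k: "k \<in> K" and neq: "k a \<noteq> k b" "k b \<noteq> k r" "k a \<noteq> k r"
  shows "\<Phi> a * (\<Phi> b * (\<Phi> a * E k)) = \<Phi> b * (\<Phi> a * (\<Phi> b * E k))"
proof -
  let ?x = "\<beta> a b k" and ?y = "\<beta> b r k" and ?z = "\<beta> a r k"
  note EE = E_idem[OF k]
  note expand = \<Phi>_\<beta>_expand(2)[OF k EE neq(1)] \<Phi>_\<beta>_expand(2)[OF k E_\<beta>s(13)[OF k] neq(1)]
    \<Phi>_\<beta>_expand(4)[OF k EE neq(2)] \<Phi>_\<beta>_expand(4)[OF k E_\<beta>s(11)[OF k] neq(2)]
  have L: "\<Phi> a * (\<Phi> b * (\<Phi> a * E k)) = g a * (g b * (g a * E k)) + g a * (g b * ?x) + g a * (g a * ?z)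
      + g a * (?x * ?z) + (g b * (g a * ?y) + g b * (?x * ?y) + g a * (?z * ?y) + ?x * (?z * ?y))"
    unfolding \<Phi>_first_second_first[OF k neq(1,3)]
    by (simp only: expand) (simp add: E_\<beta>s[OF k] distrib_left)
  have R: "\<Phi> b * (\<Phi> a * (\<Phi> b * E k)) = g b * (g a * (g b * E k)) + g b * (g a * ?y) + g b * (g b * ?z)
      + g b * (?y * ?z) + (g a * (g b * ?x) + g a * (?y * ?x) + g b * (?z * ?x) + ?y * (?z * ?x))"
    unfolding \<Phi>_second_first_second[OF k neq(2,3)]
    by (simp only: expand) (simp add: E_\<beta>s[OF k] distrib_left)
  note gg = g_g_fixed[OF k E_\<beta>s(15)[OF k]]
  consider "snd (k a) \<noteq> snd (k r)" | "snd (k a) = snd (k r)" "snd (k a) \<noteq> snd (k b)"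
    | "snd (k a) = snd (k b)" "snd (k b) = snd (k r)" by metis
  then show ?thesis
  proof cases
    case 1
    then have "?z = 0" "?x = 0 \<or> ?y = 0" using \<beta>_eq_0 by (auto, metis)
    then show ?thesis unfolding L R by (auto simp: braid_g)
  next
    case 2
    then have "?x = 0" "?y = 0" by (auto simp: \<beta>_eq_0)
    then show ?thesis unfolding L R using 2 by (simp add: braid_g gg)
  next
    case 3
    then have i: "fst (k a) \<noteq> fst (k b)" "fst (k b) \<noteq> fst (k r)" "fst (k a) \<noteq> fst (k r)"
      using neq by (auto simp: prod_eq_iff)
    have tt: "?x * ?y = ?x * ?z + ?z * ?y - c (1 - q) * ?z"
      using \<beta>_three_terms[OF k places 3 i] by (simp add: \<beta>_comms[OF k])
    show ?thesis unfolding L R using 3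
      by (simp add: braid_g gg \<beta>_comms[OF k] tt distrib_left right_diff_distrib c_left)
  qed
qed

text \<open>
  The rightmost \<open>\<Phi>\<^sub>a\<close> is \<open>g\<^sub>a + 1\<close>, and the coefficients of the other two factors are moved past
  that \<open>g\<^sub>a\<close>. The product of the two coefficients commutes with \<open>g\<^sub>a\<close>, being symmetric in \<open>X\<^sub>a\<close> and
  \<open>X\<^sub>b\<close>.
\<close>

lemma braid_first_equal:
  assumes k: "k \<in> K" and eq: "k a = k b" and neq: "k b \<noteq> k r"
  shows "\<Phi> a * (\<Phi> b * (\<Phi> a * E k)) = \<Phi> b * (\<Phi> a * (\<Phi> b * E k))"
proof -
  let ?y = "\<beta> b r k" and ?z = "\<beta> a r k" and ?w = "\<beta> r b k"
  have neq': "k a \<noteq> k r" using eq neq by simp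
  note EE = E_idem[OF k] and Eg = E_g_equal[OF k a, folded b_eq, OF eq]
  have \<Phi>E: "\<Phi> a * E k = g a * E k + E k" using \<Phi>_fixed(1)[OF k EE] EE by (simp add: \<beta>_equal[of k a b] eq)
  have L: "\<Phi> a * (\<Phi> b * (\<Phi> a * E k)) = g a * (g b * (g a * E k)) + g a * (?y * (g a * E k)) + g b * (?z * (g a * E k))
      + ?y * (?z * (g a * E k)) + \<Phi> a * (\<Phi> b * E k)"
    unfolding \<Phi>E distrib_left using \<Phi>_\<beta>_expand(4)[OF k Eg neq] by simp
  have R: "\<Phi> b * (\<Phi> a * (\<Phi> b * E k)) = g b * (g a * (g b * E k)) + g b * (g a * ?y) + g b * (g b * ?z)
      + g b * (?y * ?z) + \<Phi> a * (\<Phi> b * E k)"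
    unfolding \<Phi>_second_first_second[OF k neq neq'] \<beta>_equal[of k a b, OF eq]
    using \<Phi>_\<beta>_expand(4)[OF k EE neq] by (simp add: distrib_left E_\<beta>s[OF k])
  show ?thesis
  proof (cases "snd (k b) = snd (k r)")
    case False
    then have "?y = 0" "?z = 0" using eq by (simp_all add: \<beta>_eq_0)
    then show ?thesis unfolding L R by (simp add: braid_g)
  next
    case True
    then have D: "snd (k a) = snd (k r)" "fst (k a) \<noteq> fst (k r)" "snd (k b) = snd (k r)" "fst (k b) \<noteq> fst (k r)"
      using eq neq by (auto simp: prod_eq_iff)
    note first = \<beta>_g_first[OF k a b_eq places(3) places_neq(6,5) eq D(1,2)]
    have yz: "?y * (?z * (g a * E k)) = g a * (?y * ?z)"
    proof -
      have "?z * (g a * (E k * v)) = g a * (?y * v) - ?w * (?z * v)" for v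
        using arg_cong[OF first(2), of "\<lambda>x. x * v"] by (simp add: mult.assoc left_diff_distrib)
      from this[of ?y] have 1: "?z * (g a * ?y) = g a * (?y * ?y) - ?w * (?z * ?y)" by (simp add: E_\<beta>s[OF k])
      have "?y * (g a * (E k * v)) = g a * (?z * v) + ?w * (?z * v)" for v
        using arg_cong[OF first(1), of "\<lambda>x. x * v"] by (simp add: mult.assoc distrib_right)
      from this[of ?y] have 2: "?y * (g a * ?y) = g a * (?z * ?y) + ?w * (?z * ?y)" by (simp add: E_\<beta>s[OF k])
      have "?y * (?z * (g a * E k)) = ?y * (g a * ?y) - ?y * (?w * ?z)"
        unfolding first(2) by (simp add: right_diff_distrib)
      also have "?y * (?w * ?z) = ?w * (?z * ?y)"
        using Alg_commute[OF Alg_mult[OF \<beta>s_in(4,5)[OF k]] \<beta>s_in(3)[OF k]] by (simp add: mult.assoc)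
      finally show ?thesis unfolding 2 by (simp add: \<beta>_comms[OF k])
    qed
    have sum: "?w * ?z = c (1 - q) * ?z - ?z * ?y"
      using arg_cong[OF \<beta>_flip[OF k places(2,3) D(3,4)], of "\<lambda>x. x * ?z"]
      by (simp add: distrib_right E_\<beta>s[OF k] mult.assoc \<beta>_comms[OF k] eq_diff_eq add.commute)
    have gg: "g a * (g a * ?z) = c q * ?z - c (1 - q) * (g a * ?z)" "g b * (g b * ?z) = c q * ?z - c (1 - q) * (g b * ?z)"
      using g_g_fixed[OF k E_\<beta>s(15)[OF k]] eq D(3) by simp_all
    show ?thesis unfolding L R yz unfolding first
      by (simp add: braid_g gg sum distrib_left right_diff_distrib c_left \<beta>_comms[OF k])
  qed
qed

text \<open>
  The mirror image of the preceding lemma.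
\<close>

lemma braid_second_equal:
  assumes k: "k \<in> K" and eq: "k b = k r" and neq: "k a \<noteq> k b"
  shows "\<Phi> a * (\<Phi> b * (\<Phi> a * E k)) = \<Phi> b * (\<Phi> a * (\<Phi> b * E k))"
proof -
  let ?x = "\<beta> a b k" and ?z = "\<beta> a r k" and ?w = "\<beta> b a k"
  have neq': "k a \<noteq> k r" using eq neq by simp
  note EE = E_idem[OF k] and Eg = E_g_equal[OF k b, folded r_eq, OF eq]
  have \<Phi>E: "\<Phi> b * E k = g b * E k + E k" using \<Phi>_fixed(2)[OF k EE] EE by (simp add: \<beta>_equal[of k b r] eq)
  have R: "\<Phi> b * (\<Phi> a * (\<Phi> b * E k)) = g b * (g a * (g b * E k)) + g b * (?x * (g b * E k)) + g a * (?z * (g b * E k))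
      + ?x * (?z * (g b * E k)) + \<Phi> b * (\<Phi> a * E k)"
    unfolding \<Phi>E distrib_left using \<Phi>_\<beta>_expand(2)[OF k Eg neq] by simp
  have L: "\<Phi> a * (\<Phi> b * (\<Phi> a * E k)) = g a * (g b * (g a * E k)) + g a * (g b * ?x) + g a * (g a * ?z)
      + g a * (?x * ?z) + \<Phi> b * (\<Phi> a * E k)"
    unfolding \<Phi>_first_second_first[OF k neq neq'] \<beta>_equal[of k b r, OF eq]
    using \<Phi>_\<beta>_expand(2)[OF k EE neq] by (simp add: distrib_left E_\<beta>s[OF k])
  show ?thesis
  proof (cases "snd (k a) = snd (k b)")
    case False
    then have "?x = 0" "?z = 0" using eq by (simp_all add: \<beta>_eq_0)
    then show ?thesis unfolding L R by (simp add: braid_g)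
  next
    case True
    then have D: "snd (k a) = snd (k b)" "fst (k a) \<noteq> fst (k b)" using neq by (auto simp: prod_eq_iff)
    note second = \<beta>_g_second[OF k b r_eq places(1) places_neq(1,3) eq D]
    have xz: "?x * (?z * (g b * E k)) = g b * (?x * ?z)"
    proof -
      have "?x * (g b * (E k * v)) = g b * (?z * v) + ?w * (?z * v)" for v
        using arg_cong[OF second(1), of "\<lambda>x. x * v"] by (simp add: mult.assoc distrib_right)
      from this[of ?x] have 2: "?x * (g b * ?x) = g b * (?z * ?x) + ?w * (?z * ?x)" by (simp add: E_\<beta>s[OF k])
      have "?x * (?z * (g b * E k)) = ?x * (g b * ?x) - ?x * (?w * ?z)"
        unfolding second(2) by (simp add: right_diff_distrib)
      also have "?x * (?w * ?z) = ?w * (?z * ?x)"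
        using Alg_commute[OF Alg_mult[OF \<beta>s_in(2,5)[OF k]] \<beta>s_in(1)[OF k]] by (simp add: mult.assoc)
      finally show ?thesis unfolding 2 by (simp add: \<beta>_comms[OF k])
    qed
    have sum: "?w * ?z = c (1 - q) * ?z - ?x * ?z"
      using arg_cong[OF \<beta>_flip[OF k places(1,2) D], of "\<lambda>x. x * ?z"]
      by (simp add: distrib_right E_\<beta>s[OF k] mult.assoc eq_diff_eq add.commute)
    have gg: "g a * (g a * ?z) = c q * ?z - c (1 - q) * (g a * ?z)" "g b * (g b * ?z) = c q * ?z - c (1 - q) * (g b * ?z)"
      using g_g_fixed[OF k E_\<beta>s(15)[OF k]] eq D(1) by simp_all
    show ?thesis unfolding L R xz unfolding second
      by (simp add: braid_g gg sum distrib_left right_diff_distrib c_left \<beta>_comms[OF k])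
  qed
qed

text \<open>
  After the first intertwiner the two equal entries are adjacent, so the middle intertwiner is
  \<open>g + 1\<close>. The summand \<open>1\<close> leaves the square of an outer intertwiner, whence the terms
  \<open>\<beta>\<^sub>a\<^sub>b \<beta>\<^sub>b\<^sub>a\<close> and \<open>\<beta>\<^sub>b\<^sub>r \<beta>\<^sub>r\<^sub>b\<close>; the additional terms for moving a coefficient past the middle \<open>g\<close>
  give the products of three coefficients.
\<close>

lemma braid_outer_equal:
  assumes k: "k \<in> K" and eq: "k a = k r" and neq: "k a \<noteq> k b"
  shows "\<Phi> a * (\<Phi> b * (\<Phi> a * E k)) = \<Phi> b * (\<Phi> a * (\<Phi> b * E k)) +
    (\<beta> a b k - \<beta> b r k) * (\<beta> a b k * \<beta> b r k) + \<beta> a b k * \<beta> b a k - \<beta> b r k * \<beta> r b k"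
proof -
  let ?x = "\<beta> a b k" and ?y = "\<beta> b r k"
  have neq': "k b \<noteq> k r" using eq neq by simp
  note EE = E_idem[OF k] and K1 = s_in_K(1)[OF k] and K2 = s_in_K(2)[OF k]
  let ?u = "\<Phi> a * E k" and ?v = "\<Phi> b * E k"
  have Eu: "E (s1 k) * ?u = ?u" by (rule E_\<Phi>_fixed(1)[OF k EE])
  have Ev: "E (s2 k) * ?v = ?v" by (rule E_\<Phi>_fixed(2)[OF k EE])
  have u: "?u = g a * E k + ?x" and v: "?v = g b * E k + ?y"
    using \<Phi>_fixed[OF k EE] by (simp_all add: E_\<beta>s[OF k])
  have S1: "s1 k b = s1 k r" and S2: "s2 k a = s2 k b" using eq by simp_all
  have \<Phi>u: "\<Phi> b * ?u = g b * ?u + ?u"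
    using \<Phi>_fixed(2)[OF K1 Eu] Eu unfolding \<beta>_equal[OF S1] by simp
  have \<Phi>v: "\<Phi> a * ?v = g a * ?v + ?v"
    using \<Phi>_fixed(1)[OF K2 Ev] Ev unfolding \<beta>_equal[OF S2] by simp
  have Egu: "E (s1 k) * (g b * ?u) = g b * ?u"
    using arg_cong[OF E_g_equal[OF K1 b, folded r_eq, OF S1], of "\<lambda>x. x * ?u"] Eu by (simp add: mult.assoc)
  have Egv: "E (s2 k) * (g a * ?v) = g a * ?v"
    using arg_cong[OF E_g_equal[OF K2 a, folded b_eq, OF S2], of "\<lambda>x. x * ?v"] Ev by (simp add: mult.assoc)
  \<comment> \<open>The equal entries of \<open>\<sigma>\<^sub>a k\<close> are in places \<open>b\<close> and \<open>r\<close>, those of \<open>\<sigma>\<^sub>b k\<close> in places \<open>a\<close> and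
    \<open>b\<close>; the remaining coefficient is moved past the \<open>g\<close> at these places and then past the
    first intertwiner.\<close>
  have move: "\<beta> a b (s1 k) * (g b * ?u) = g b * (\<Phi> a * ?y) + \<Phi> a * (?x * ?y) \<and>
     \<beta> b r (s2 k) * (g a * ?v) = g a * (\<Phi> b * ?x) + \<Phi> b * (?x * ?y)"
  proof (cases "snd (k a) = snd (k b)")
    case False
    then have "?x = 0" "?y = 0" "\<beta> a b (s1 k) = 0" "\<beta> b r (s2 k) = 0" using eq by (simp_all add: \<beta>_eq_0)
    then show ?thesis by simp
  next
    case True
    then have D: "snd (k a) = snd (k b)" "fst (k a) \<noteq> fst (k b)" using neq by (auto simp: prod_eq_iff)
    have "\<beta> a b (s1 k) * (g b * ?u) = (g b * \<beta> a r (s1 k) + \<beta> b a (s1 k) * \<beta> a r (s1 k)) * ?u"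
      using arg_cong[OF \<beta>_g_second(1)[OF K1 b r_eq places(1) places_neq(1,3) S1], of "\<lambda>x. x * ?u"] D Eu
      by (simp add: mult.assoc)
    also have "\<dots> = g b * (\<Phi> a * ?y) + \<Phi> a * (?x * ?y)"
      using \<beta>_\<Phi>_first(4)[OF k neq EE] \<beta>_\<Phi>_first(2)[OF k neq E_\<beta>s(13)[OF k]]
      by (simp add: distrib_right mult.assoc E_\<beta>s[OF k])
    finally have 1: "\<beta> a b (s1 k) * (g b * ?u) = g b * (\<Phi> a * ?y) + \<Phi> a * (?x * ?y)" .
    have "\<beta> b r (s2 k) * (g a * ?v) = (g a * \<beta> a r (s2 k) + \<beta> r b (s2 k) * \<beta> a r (s2 k)) * ?v"
      using arg_cong[OF \<beta>_g_first(1)[OF K2 a b_eq places(3) places_neq(6,5) S2], of "\<lambda>x. x * ?v"] D eq Ev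
      by (simp add: mult.assoc)
    also have "\<dots> = g a * (\<Phi> b * ?x) + \<Phi> b * (?x * ?y)"
      using \<beta>_\<Phi>_second(4)[OF k neq' EE] \<beta>_\<Phi>_second(2)[OF k neq' E_\<beta>s(11)[OF k]]
      by (simp add: distrib_right mult.assoc E_\<beta>s[OF k] \<beta>_comms[OF k])
    finally show ?thesis using 1 by simp
  qed
  have \<Phi>\<beta>: "\<Phi> a * y = g a * y + ?x * y" "\<Phi> b * y = g b * y + ?y * y" if "E k * y = y" for y
    by (rule \<Phi>_fixed[OF k that])+
  have "\<Phi> a * (\<Phi> b * ?u) = g a * (g b * ?u) + (g b * (\<Phi> a * ?y) + \<Phi> a * (?x * ?y)) + \<Phi> a * ?u"
    unfolding \<Phi>u distrib_left \<Phi>_fixed(1)[OF K1 Egu] using move by simp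
  also have "g a * (g b * ?u) = g a * (g b * (g a * E k)) + g a * (g b * ?x)"
    unfolding u by (simp add: distrib_left)
  also have "\<Phi> a * ?u = c q * E k + ?x * \<beta> b a k"
    using \<Phi>_square[OF k a] neq by (simp add: b_eq)
  finally have L: "\<Phi> a * (\<Phi> b * ?u) = g a * (g b * (g a * E k)) + g a * (g b * ?x) +
      (g b * (g a * ?y) + g b * (?x * ?y) + (g a * (?x * ?y) + ?x * (?x * ?y))) + (c q * E k + ?x * \<beta> b a k)"
    by (simp add: \<Phi>\<beta> E_\<beta>s[OF k] distrib_left)
  have "\<Phi> b * (\<Phi> a * ?v) = g b * (g a * ?v) + (g a * (\<Phi> b * ?x) + \<Phi> b * (?x * ?y)) + \<Phi> b * ?v"
    unfolding \<Phi>v distrib_left \<Phi>_fixed(2)[OF K2 Egv] using move by simp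
  also have "g b * (g a * ?v) = g b * (g a * (g b * E k)) + g b * (g a * ?y)"
    unfolding v by (simp add: distrib_left)
  also have "\<Phi> b * ?v = c q * E k + ?y * \<beta> r b k"
    using \<Phi>_square[OF k b] neq' by (simp add: r_eq)
  finally have R: "\<Phi> b * (\<Phi> a * ?v) = g b * (g a * (g b * E k)) + g b * (g a * ?y) +
      (g a * (g b * ?x) + g a * (?x * ?y) + (g b * (?x * ?y) + ?y * (?x * ?y))) + (c q * E k + ?y * \<beta> r b k)"
    by (simp add: \<Phi>\<beta> E_\<beta>s[OF k] distrib_left \<beta>_comms[OF k])
  show ?thesis unfolding L R braid_g by (simp add: left_diff_distrib)
qed

text \<open>
  Here \<open>\<Phi>\<^sub>a = g\<^sub>a + 1\<close> and \<open>\<Phi>\<^sub>b = g\<^sub>b + 1\<close> throughout, and the expansions of the two triple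
  products differ by \<open>g\<^sub>a\<^sup>2 + g\<^sub>a - g\<^sub>b\<^sup>2 - g\<^sub>b = q (g\<^sub>a - g\<^sub>b)\<close>.
\<close>

lemma braid_all_equal:
  assumes k: "k \<in> K" and eq: "k a = k b" "k b = k r"
  shows "\<Phi> a * (\<Phi> b * (\<Phi> a * E k)) = \<Phi> b * (\<Phi> a * (\<Phi> b * E k)) + c q * (\<Phi> a * E k) - c q * (\<Phi> b * E k)"
proof -
  note EE = E_idem[OF k]
  have \<Phi>: "\<Phi> a * y = g a * y + y" "\<Phi> b * y = g b * y + y" if "E k * y = y" for y
    using \<Phi>_fixed[OF k that] that by (simp_all add: \<beta>_equal[of k a b] \<beta>_equal[of k b r] eq)
  have Eg: "E k * (g a * y) = g a * y" "E k * (g b * y) = g b * y" if "E k * y = y" for y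
    using arg_cong[OF E_g_equal[OF k a], of "\<lambda>x. x * y"] arg_cong[OF E_g_equal[OF k b], of "\<lambda>x. x * y"] that eq
    by (simp_all add: mult.assoc b_eq r_eq)
  have gg: "g a * (g a * E k) = c q * E k - c (1 - q) * (g a * E k)" "g b * (g b * E k) = c q * E k - c (1 - q) * (g b * E k)"
    using g_g_fixed[OF k EE] eq by simp_all
  show ?thesis
    by (simp add: \<Phi> Eg EE distrib_left)
       (simp add: braid_g gg c_diff c_1 left_diff_distrib distrib_left distrib_right)
qed

end

section \<open>Coefficients as fractions\<close>

context yokonuma_hecke_idempotents
begin

lemma Alg_left_commute: "x \<in> Alg \<Longrightarrow> y \<in> Alg \<Longrightarrow> x * (y * z) = y * (x * z)"
  using Alg_commute[of x y] by (simp flip: mult.assoc)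

lemma \<beta>_diff_flip:
  "k \<in> K \<Longrightarrow> a \<in> {1..n} \<Longrightarrow> b \<in> {1..n} \<Longrightarrow> snd (k a) = snd (k b) \<Longrightarrow> fst (k a) \<noteq> fst (k b) \<Longrightarrow>
    (X b - X a) * \<beta> b a k = - (c (1 - q) * (X a * E k))"
  using \<beta>_diff[of k b a] by (simp add: left_diff_distrib algebra_simps)

text \<open>
  With \<open>u = X\<^sub>a\<close> and \<open>v = X\<^sub>b\<close>, multiplication by \<open>(u - v)\<^sup>2\<close> reduces the claim to
  \<open>q (u - v)\<^sup>2 - (1 - q)\<^sup>2 u v = (q u - v) (u - q v)\<close>; this factor is then
  cancelled again, one \<open>u - v\<close> at a time.
\<close>

lemma square_fraction:
  assumes k: "k \<in> K" and ab: "a \<in> {1..n}" "b \<in> {1..n}"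
    and D: "snd (k a) = snd (k b)" "fst (k a) \<noteq> fst (k b)"
    and w: "E k * w = w" "(X a - X b) ^ 2 * w = E k"
  shows "c q * E k + \<beta> a b k * \<beta> b a k = (c q * X a - X b) * (X a - c q * X b) * w"
proof -
  let ?\<beta> = "\<beta> a b k" and ?\<beta>' = "\<beta> b a k"
  define U where "U = X b - X a"
  have mem: "U \<in> Alg" "?\<beta> \<in> Alg" "?\<beta>' \<in> Alg" "X a \<in> Alg" "X b \<in> Alg" "E k \<in> Alg" "\<And>x. c x \<in> Alg"
    using k ab by (simp_all add: U_def Alg_closed \<beta>_in)
  let ?p = "(c q * X a - X b) * (X a - c q * X b)"
  have EE: "E k * E k = E k" "E k * (E k * y) = E k * y" for y
    using E_idem[OF k] by (simp_all flip: mult.assoc)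
  have "U * (U * (?\<beta> * ?\<beta>')) = (U * ?\<beta>) * (U * ?\<beta>')"
    using mem by (simp add: Alg_commute Alg_left_commute mult.assoc)
  also have "\<dots> = - (c (1 - q) * (c (1 - q) * (X b * (X a * E k))))"
    unfolding U_def \<beta>_diff[OF k ab D] \<beta>_diff_flip[OF k ab D]
    using mem by (simp add: Alg_commute Alg_left_commute mult.assoc EE)
  finally have "U * (U * (c q * E k + ?\<beta> * ?\<beta>')) = ?p * E k"
    using mem unfolding distrib_left
    by (simp add: c_diff c_1 U_def Alg_commute Alg_left_commute mult.assoc left_diff_distrib right_diff_distrib distrib_left)
  also have "\<dots> = ?p * ((X a - X b) ^ 2 * w)" by (simp only: w(2))
  also have "(X a - X b) ^ 2 = U * U" by (simp add: U_def power2_eq_square algebra_simps)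
  also have "?p * (U * U * w) = U * (U * (?p * w))"
    using Alg_commute[of ?p "U * U"] mem by (simp add: Alg_mult Alg_diff flip: mult.assoc)
  finally have eq: "U * (U * (c q * E k + ?\<beta> * ?\<beta>')) = U * (U * (?p * w))" .
  have fix1: "E k * (c q * E k + ?\<beta> * ?\<beta>') = c q * E k + ?\<beta> * ?\<beta>'"
    using assoc_left[OF E_\<beta>[OF k ab]] by (simp add: distrib_left c_comm_left[of "E k"] EE)
  have fix2: "E k * (?p * w) = ?p * w"
    using Alg_left_commute[of "E k" ?p] mem w(1) by (simp add: Alg_mult Alg_diff)
  have fixU: "E k * (U * y) = U * y" if "E k * y = y" for y
    using Alg_left_commute[of "E k" U] mem that by simp
  have "U * (c q * E k + ?\<beta> * ?\<beta>') = U * (?p * w)"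
    using diff_cancel[OF k ab D(2) fixU[OF fix1] fixU[OF fix2]] eq by (simp add: U_def)
  then show ?thesis using diff_cancel[OF k ab D(2) fix1 fix2] by (simp add: U_def)
qed

text \<open>
  Both sides are multiplied by all denominators, which reduces the claim to an identity of
  polynomials in \<open>X\<^sub>a\<close>, \<open>X\<^sub>b\<close>, \<open>X\<^sub>r\<close>, and the denominators are cancelled again one factor at a time.
\<close>

lemma braid_fraction:
  assumes k: "k \<in> K" and abr: "a \<in> {1..n}" "b \<in> {1..n}" "r \<in> {1..n}"
    and eq: "k a = k r" and D: "snd (k a) = snd (k b)" "fst (k a) \<noteq> fst (k b)"
    and w: "E k * w = w" "(X a - X b) ^ 2 * (X b - X r) ^ 2 * w = E k"
  shows "(\<beta> a b k - \<beta> b r k) * (\<beta> a b k * \<beta> b r k) + \<beta> a b k * \<beta> b a k - \<beta> b r k * \<beta> r b k =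
    c ((1 - q) ^ 2) * (X a * X r - X b ^ 2) * (X a * X b - c q * X b * X r) * w"
    (is "?lhs = ?p * w")
proof -
  let ?x = "\<beta> a b k" and ?x' = "\<beta> b a k" and ?y = "\<beta> b r k" and ?y' = "\<beta> r b k"
  define U V where "U = X b - X a" and "V = X r - X b"
  have D': "snd (k b) = snd (k r)" "fst (k b) \<noteq> fst (k r)" using D eq by auto
  have mem: "U \<in> Alg" "V \<in> Alg" "?x \<in> Alg" "?x' \<in> Alg" "?y \<in> Alg" "?y' \<in> Alg"
    "X a \<in> Alg" "X b \<in> Alg" "X r \<in> Alg" "E k \<in> Alg" "\<And>x. c x \<in> Alg"
    using k abr by (simp_all add: U_def V_def Alg_closed \<beta>_in)
  have memp: "?p \<in> Alg" using k abr by (simp add: Alg_closed)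
  have q2: "c ((1 - q) ^ 2) = (1 - c q) * (1 - c q)"
    by (simp add: power2_eq_square c_mult c_diff c_1)
  have EE: "E k * E k = E k" "E k * (E k * y) = E k * y" for y
    using E_idem[OF k] by (simp_all flip: mult.assoc)
  have Ux: "U * ?x = c (1 - q) * (X b * E k)" "U * ?x' = - (c (1 - q) * (X a * E k))"
    unfolding U_def using \<beta>_diff[OF k abr(1,2) D] \<beta>_diff_flip[OF k abr(1,2) D] by simp_all
  have Vy: "V * ?y = c (1 - q) * (X r * E k)" "V * ?y' = - (c (1 - q) * (X b * E k))"
    unfolding V_def using \<beta>_diff[OF k abr(2,3) D'] \<beta>_diff_flip[OF k abr(2,3) D'] by simp_all
  let ?M = "U * (U * (V * V))"
  have "?M * ?lhs = (U * ?x) * ((U * ?x) * ((V * ?y) * V)) - (U * ?x) * ((V * ?y) * ((V * ?y) * U))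
      + (U * ?x) * ((U * ?x') * (V * V)) - (V * ?y) * ((V * ?y') * (U * U))"
    using mem by (simp add: Alg_commute Alg_left_commute mult.assoc distrib_left right_diff_distrib left_diff_distrib)
  also have "\<dots> = ?p * E k"
    unfolding Ux Vy q2 using mem
    by (simp add: U_def V_def c_diff c_1 power2_eq_square Alg_commute Alg_left_commute mult.assoc
        distrib_left right_diff_distrib left_diff_distrib EE)
  also have "\<dots> = ?p * ((X a - X b) ^ 2 * (X b - X r) ^ 2 * w)" by (simp only: w(2))
  also have "(X a - X b) ^ 2 = U * U" by (simp add: U_def power2_eq_square algebra_simps)
  also have "(X b - X r) ^ 2 = V * V" by (simp add: V_def power2_eq_square algebra_simps)
  also have "?p * (U * U * (V * V) * w) = ?M * (?p * w)"
    using Alg_left_commute[of ?p ?M w] mem memp by (simp only: Alg_mult mult.assoc)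
  finally have eq: "U * (U * (V * (V * ?lhs))) = U * (U * (V * (V * (?p * w))))" by (simp only: mult.assoc)
  have fix1: "E k * ?lhs = ?lhs"
    using E_\<beta>[OF k abr(1,2)] E_\<beta>[OF k abr(2,3)] by (simp only: distrib_left right_diff_distrib left_diff_distrib mult.assoc[symmetric])
  have fix2: "E k * (?p * w) = ?p * w"
    using Alg_left_commute[of "E k" ?p] mem memp w(1) by simp
  have fixU: "E k * (U * y) = U * y" "E k * (V * y) = V * y" if "E k * y = y" for y
    using Alg_left_commute[of "E k" U] Alg_left_commute[of "E k" V] mem that by simp_all
  have cancel: "x = y" if "U * x = U * y \<or> V * x = V * y" "E k * x = x" "E k * y = y" for x y
    using diff_cancel[OF k abr(1,2) D(2) that(2,3)] diff_cancel[OF k abr(2,3) D'(2) that(2,3)] that(1)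
    by (auto simp: U_def V_def)
  note fxl = fix1 fixU(2)[OF fix1] fixU(2)[OF fixU(2)[OF fix1]] fixU(1)[OF fixU(2)[OF fixU(2)[OF fix1]]]
    and fxr = fix2 fixU(2)[OF fix2] fixU(2)[OF fixU(2)[OF fix2]] fixU(1)[OF fixU(2)[OF fixU(2)[OF fix2]]]
  have "U * (V * (V * ?lhs)) = U * (V * (V * (?p * w)))"
    by (rule cancel[OF disjI1[OF eq] fxl(4) fxr(4)])
  then have "V * (V * ?lhs) = V * (V * (?p * w))"
    by (intro cancel[OF disjI1 fxl(3) fxr(3)])
  then have "V * ?lhs = V * (?p * w)"
    by (intro cancel[OF disjI2 fxl(2) fxr(2)])
  then show ?thesis
    by (intro cancel[OF disjI2 fxl(1) fxr(1)])
qed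

lemma diff_inv_square:
  assumes "k \<in> K" "a \<in> {1..n}" "b \<in> {1..n}" "fst (k a) \<noteq> fst (k b)"
  shows "(X a - X b) ^ 2 * (diff_inv a b k * (diff_inv a b k * y)) = E k * y"
proof -
  let ?D = "diff_inv a b k"
  note D = diff_inv[OF assms]
  have "(X b - X a) * (?D * z) = E k * z" for z
    using D(2) by (simp flip: mult.assoc)
  then have "(X b - X a) * ((X b - X a) * (?D * (?D * y))) = (X b - X a) * (?D * y)"
    using D(3) by (simp flip: mult.assoc)
  also have "\<dots> = E k * y" using D(2) by (simp flip: mult.assoc)
  also have "(X b - X a) * ((X b - X a) * (?D * (?D * y))) = (X a - X b) ^ 2 * (?D * (?D * y))"
    by (simp add: power2_eq_square mult.assoc[symmetric]) (simp add: algebra_simps)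
  finally show ?thesis .
qed

end

section \<open>Free algebras\<close>

lemma poly_mapping_sum_single: "f = (\<Sum>w\<in>Poly_Mapping.keys f. Poly_Mapping.single w (Poly_Mapping.lookup f w))"
  by (rule poly_mapping_eqI)
     (simp add: lookup_sum lookup_single when_def in_keys_iff sum.delta)

lemma letters_simps: "letters 0 = []" "letters (u + v) = letters u @ letters v"
  by (simp_all add: zero_free_monoid_def plus_free_monoid_def)

lemma nc_const_commute: "nc_const c * f = f * (nc_const c :: ('x, 'k::comm_ring_1) nc_poly)"
proof -
  have "nc_const c * Poly_Mapping.single w x = Poly_Mapping.single w x * (nc_const c :: ('x, 'k) nc_poly)" for w x
    by (simp add: nc_const_def mult_single mult.commute)
  then have "nc_const c * (\<Sum>w\<in>Poly_Mapping.keys f. Poly_Mapping.single w (Poly_Mapping.lookup f w)) =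
      (\<Sum>w\<in>Poly_Mapping.keys f. Poly_Mapping.single w (Poly_Mapping.lookup f w)) * nc_const c"
    by (simp only: sum_distrib_left sum_distrib_right)
  then show ?thesis by (simp only: poly_mapping_sum_single[symmetric])
qed

lemma nc_const_simps:
  "nc_const (x + y) = nc_const x + nc_const y" "nc_const (x * y) = nc_const x * nc_const y"
  "nc_const 0 = 0" "nc_const 1 = 1" "nc_const (- x) = - nc_const x" "nc_const (x - y) = nc_const x - nc_const y"
  by (simp_all add: nc_const_def single_add mult_single single_uminus single_diff)

text \<open>
  The linear extension of a map on words; for multiplicative \<open>m\<close> this is the homomorphism given by
  the universal property of the free algebra.
\<close>

definition word_extension :: "('k \<Rightarrow> 'a) \<Rightarrow> ('x free_monoid \<Rightarrow> 'a) \<Rightarrow> ('x, 'k::comm_ring_1) nc_poly \<Rightarrow> 'a::ring_1"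
  where "word_extension c m f = (\<Sum>w\<in>Poly_Mapping.keys f. c (Poly_Mapping.lookup f w) * m w)"

locale word_hom =
  fixes c :: "'k::comm_ring_1 \<Rightarrow> 'a::ring_1" and m :: "'x free_monoid \<Rightarrow> 'a"
  assumes c_add: "c (x + y) = c x + c y" and c_mult: "c (x * y) = c x * c y" and c_1: "c 1 = 1"
    and c_comm: "c x * r = r * c x"
    and m_0: "m 0 = 1" and m_add: "m (u + v) = m u * m v"
begin

abbreviation "ext \<equiv> word_extension c m"

lemma c_0: "c 0 = 0"
  using c_add[of 0 0] by simp

lemma ext_add: "ext (f + h) = ext f + ext h"
  unfolding word_extension_def
  by (rule setsum_keys_plus_distrib) (simp_all add: c_0 c_add distrib_right)

lemma ext_0: "ext 0 = 0"
  by (simp add: word_extension_def)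

lemma ext_sum: "ext (sum f S) = (\<Sum>s\<in>S. ext (f s))"
  by (induction S rule: infinite_finite_induct) (simp_all add: ext_0 ext_add)

lemma ext_single: "ext (Poly_Mapping.single w x) = c x * m w"
  by (simp add: word_extension_def c_0)

lemma ext_mult: "ext (f * h) = ext f * ext h"
proof -
  have 1: "ext (Poly_Mapping.single u x * Poly_Mapping.single v y) =
      ext (Poly_Mapping.single u x) * ext (Poly_Mapping.single v y)" for u v x y
  proof -
    have "m u * (c y * m v) = c y * (m u * m v)" by (metis c_comm mult.assoc)
    then show ?thesis by (simp add: mult_single ext_single c_mult m_add mult.assoc)
  qed
  have "ext (f * h) = ext ((\<Sum>u\<in>Poly_Mapping.keys f. Poly_Mapping.single u (Poly_Mapping.lookup f u)) *
      (\<Sum>v\<in>Poly_Mapping.keys h. Poly_Mapping.single v (Poly_Mapping.lookup h v)))"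
    by (simp only: poly_mapping_sum_single[symmetric])
  also have "\<dots> = ext (\<Sum>u\<in>Poly_Mapping.keys f. Poly_Mapping.single u (Poly_Mapping.lookup f u)) *
      ext (\<Sum>v\<in>Poly_Mapping.keys h. Poly_Mapping.single v (Poly_Mapping.lookup h v))"
    by (simp only: sum_product ext_sum 1)
  finally show ?thesis by (simp only: poly_mapping_sum_single[symmetric])
qed

lemma ext_1: "ext 1 = 1"
  using ext_single[of 0 1] by (simp add: c_1 m_0)

lemma ext_const: "ext (nc_const x) = c x"
  by (simp add: nc_const_def ext_single m_0)

lemma ext_gen: "ext (nc_gen x) = m (Word [x])"
  by (simp add: nc_gen_def ext_single c_1)

lemma ext_diff: "ext (f - h) = ext f - ext h"
  using ext_add[of "f - h" h] by (simp add: algebra_simps)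

lemma ext_power: "ext (f ^ N) = ext f ^ N"
  by (induction N) (simp_all add: ext_1 ext_mult)

end

text \<open>
  The homomorphism that sends the letters outside \<open>S\<close> to zero; it retracts the free algebra on all
  letters to the one on \<open>S\<close>.
\<close>

definition kill_letters :: "'x set \<Rightarrow> ('x, 'k::comm_ring_1) nc_poly \<Rightarrow> ('x, 'k) nc_poly"
  where "kill_letters S = word_extension nc_const
    (\<lambda>w. if set (letters w) \<subseteq> S then Poly_Mapping.single w 1 else 0)"

lemma kill_letters_hom:
  "word_hom (nc_const :: 'k \<Rightarrow> ('x, 'k::comm_ring_1) nc_poly)
     (\<lambda>w. if set (letters w) \<subseteq> S then Poly_Mapping.single w 1 else 0)"
  by (intro word_hom.intro nc_const_simps nc_const_commute)
     (auto simp: letters_simps mult_single)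

lemmas kill_letters_add = word_hom.ext_add[OF kill_letters_hom, folded kill_letters_def]
  and kill_letters_mult = word_hom.ext_mult[OF kill_letters_hom, folded kill_letters_def]
  and kill_letters_const = word_hom.ext_const[OF kill_letters_hom, folded kill_letters_def]

lemma in_free_algebra_iff:
  "f \<in> carrier (free_algebra S) \<longleftrightarrow> (\<forall>w\<in>Poly_Mapping.keys f. set (letters w) \<subseteq> S)"
  by (simp add: free_algebra_def)

lemma free_algebra_ops [simp]:
  "mult (free_algebra S) = (*)" "one (free_algebra S) = 1" "zero (free_algebra S) = 0" "add (free_algebra S) = (+)"
  by (simp_all add: free_algebra_def)

lemma kill_letters_free: "f \<in> carrier (free_algebra S) \<Longrightarrow> kill_letters S f = f"
proof -
  assume f: "f \<in> carrier (free_algebra S)"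
  have "kill_letters S f = (\<Sum>w\<in>Poly_Mapping.keys f. Poly_Mapping.single w (Poly_Mapping.lookup f w))"
    unfolding kill_letters_def word_extension_def
    by (rule sum.cong) (use f in \<open>auto simp: in_free_algebra_iff nc_const_def mult_single\<close>)
  then show ?thesis by (simp only: poly_mapping_sum_single[symmetric])
qed

lemma kill_letters_in: "kill_letters S f \<in> carrier (free_algebra S)"
proof -
  have "Poly_Mapping.keys (kill_letters S f) \<subseteq> (\<Union>w\<in>Poly_Mapping.keys f. Poly_Mapping.keys
      (nc_const (Poly_Mapping.lookup f w) * (if set (letters w) \<subseteq> S then Poly_Mapping.single w 1 else 0)))"
    unfolding kill_letters_def word_extension_def by (rule keys_sum)
  also have "\<dots> \<subseteq> {w. set (letters w) \<subseteq> S}"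
    by (auto simp: nc_const_def mult_single split: if_splits)
  finally show ?thesis by (auto simp: in_free_algebra_iff)
qed

lemma free_algebra_const: "nc_const x \<in> carrier (free_algebra S)"
  by (auto simp: in_free_algebra_iff nc_const_def letters_simps split: if_splits)

lemma free_algebra_0_1: "0 \<in> carrier (free_algebra S)" "1 \<in> carrier (free_algebra S)"
  using free_algebra_const[of 0 S] free_algebra_const[of 1 S] by (simp_all add: nc_const_simps)

lemma free_algebra_gen: "s \<in> S \<Longrightarrow> nc_gen s \<in> carrier (free_algebra S)"
  by (auto simp: in_free_algebra_iff nc_gen_def)

lemma free_algebra_mult:
  "f \<in> carrier (free_algebra S) \<Longrightarrow> h \<in> carrier (free_algebra S) \<Longrightarrow> f * h \<in> carrier (free_algebra S)"
  using keys_mult[of f h] by (fastforce simp: in_free_algebra_iff letters_simps)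

lemma free_algebra_add:
  "f \<in> carrier (free_algebra S) \<Longrightarrow> h \<in> carrier (free_algebra S) \<Longrightarrow> f + h \<in> carrier (free_algebra S)"
  using keys_add[of f h] by (auto simp: in_free_algebra_iff)

lemma free_algebra_uminus: "f \<in> carrier (free_algebra S) \<Longrightarrow> - f \<in> carrier (free_algebra S)"
  using free_algebra_mult[OF free_algebra_const[of "- 1" S]] by (simp add: nc_const_simps)

lemmas free_algebra_closed = free_algebra_0_1 free_algebra_const free_algebra_gen free_algebra_add
  free_algebra_mult free_algebra_uminus

lemma free_algebra_diff:
  "f \<in> carrier (free_algebra S) \<Longrightarrow> h \<in> carrier (free_algebra S) \<Longrightarrow> f - h \<in> carrier (free_algebra S)"
  using free_algebra_add[of f S "- h"] free_algebra_uminus[of h S] by simp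

lemma free_algebra_power: "f \<in> carrier (free_algebra S) \<Longrightarrow> f ^ N \<in> carrier (free_algebra S)"
  by (induction N) (simp_all add: free_algebra_closed)

lemma free_algebra_sum: "(\<And>x. x \<in> A \<Longrightarrow> f x \<in> carrier (free_algebra S)) \<Longrightarrow> sum f A \<in> carrier (free_algebra S)"
  by (induction A rule: infinite_finite_induct) (simp_all add: free_algebra_closed)

lemma ring_free_algebra: "ring (free_algebra S)"
proof (rule ringI)
  show "abelian_group (free_algebra S)"
  proof (rule abelian_groupI)
    fix x assume "x \<in> carrier (free_algebra S)"
    then show "\<exists>y\<in>carrier (free_algebra S). y \<oplus>\<^bsub>free_algebra S\<^esub> x = \<zero>\<^bsub>free_algebra S\<^esub>"
      by (intro bexI[of _ "- x"]) (auto simp: free_algebra_closed)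
  qed (auto simp: free_algebra_closed algebra_simps)
  show "monoid (free_algebra S)"
    by (rule monoidI) (auto simp: free_algebra_closed algebra_simps)
qed (auto simp: algebra_simps)

lemma free_algebra_minus:
  assumes "f \<in> carrier (free_algebra S)" "h \<in> carrier (free_algebra S)"
  shows "f \<ominus>\<^bsub>free_algebra S\<^esub> h = f - h"
proof -
  interpret ring "free_algebra S" by (rule ring_free_algebra)
  have "\<ominus>\<^bsub>free_algebra S\<^esub> h = - h"
    by (rule minus_equality) (use assms in \<open>auto simp: free_algebra_closed\<close>)
  then show ?thesis by (simp add: a_minus_def)
qed

section \<open>A faithful unital representation of an augmented quotient\<close>

text \<open>
  Linear endomorphisms of the space of all noncommutative polynomials form a ring at the level of
  types, unlike the free algebra on a set of letters and its quotients, which are carrier sets.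
\<close>

typedef (overloaded) ('x, 'k) linear_map =
  "{f :: ('x, 'k::field) nc_poly \<Rightarrow> ('x, 'k) nc_poly.
     (\<forall>v w. f (v + w) = f v + f w) \<and> (\<forall>x v. f (nc_const x * v) = nc_const x * f v)}"
  morphisms apply_map Linear_map
  by (rule exI[of _ "\<lambda>_. 0"]) simp

setup_lifting type_definition_linear_map

instantiation linear_map :: (type, field) ring_1
begin

lift_definition zero_linear_map :: "('a, 'b) linear_map" is "\<lambda>_. 0"
  by simp

lift_definition one_linear_map :: "('a, 'b) linear_map" is "\<lambda>v. v"
  by simp

lift_definition plus_linear_map :: "('a, 'b) linear_map \<Rightarrow> ('a, 'b) linear_map \<Rightarrow> ('a, 'b) linear_map"
  is "\<lambda>f h v. f v + h v"
  by (simp add: distrib_left add_ac)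

lift_definition uminus_linear_map :: "('a, 'b) linear_map \<Rightarrow> ('a, 'b) linear_map"
  is "\<lambda>f v. - f v"
  by simp

lift_definition minus_linear_map :: "('a, 'b) linear_map \<Rightarrow> ('a, 'b) linear_map \<Rightarrow> ('a, 'b) linear_map"
  is "\<lambda>f h v. f v - h v"
  by (simp add: right_diff_distrib)

lift_definition times_linear_map :: "('a, 'b) linear_map \<Rightarrow> ('a, 'b) linear_map \<Rightarrow> ('a, 'b) linear_map"
  is "\<lambda>f h v. f (h v)"
  by simp

instance
proof
  show "(0 :: ('a, 'b) linear_map) \<noteq> 1"
    by transfer (metis one_neq_zero)
qed (transfer; simp add: fun_eq_iff add_ac)+

end

text \<open>
  Every subspace has a complement.
\<close>

lemma exists_projection:
  fixes J :: "('x, 'k::field) nc_poly set"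
  assumes "0 \<in> J" and "\<And>v w. v \<in> J \<Longrightarrow> w \<in> J \<Longrightarrow> v + w \<in> J"
    and "\<And>x v. v \<in> J \<Longrightarrow> nc_const x * v \<in> J"
  obtains R where "\<And>v w. R (v + w) = R v + R w" "\<And>x v. R (nc_const x * v) = nc_const x * R v"
    "\<And>v. R v \<in> J" "\<And>v. v \<in> J \<Longrightarrow> R v = v"
proof -
  let ?s = "\<lambda>x (v :: ('x, 'k) nc_poly). nc_const x * v"
  interpret V: vector_space ?s
    by standard (simp_all add: nc_const_simps distrib_left distrib_right mult.assoc)
  interpret VV: vector_space_pair ?s ?s ..
  have "V.subspace J" using assms by (simp add: V.subspace_def)
  then obtain R where R: "range R \<subseteq> J" "Vector_Spaces.linear ?s ?s R" "\<forall>v\<in>J. R v = v"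
    using VV.linear_exists_left_inverse_on[of "\<lambda>v. v" J] V.linear_ident by (auto simp: inj_on_def)
  interpret R: Vector_Spaces.linear ?s ?s R by (rule R(2))
  show ?thesis
    by (rule that[of R]) (use R R.add R.scale in auto)
qed

text \<open>
  The character of the quotient provides the scalars by which the representation constructed below
  acts on a complement of the regular representation.
\<close>

locale augmented_quotient =
  fixes S :: "'x set" and I :: "('x, 'k::field) nc_poly set" and \<chi> :: "('x, 'k) nc_poly \<Rightarrow> 'k"
  assumes I: "ideal I (free_algebra S)"
    and \<chi>_add: "\<chi> (f + h) = \<chi> f + \<chi> h" and \<chi>_mult: "\<chi> (f * h) = \<chi> f * \<chi> h"
    and \<chi>_const: "\<chi> (nc_const x) = x"
    and \<chi>_ideal: "f \<in> I \<Longrightarrow> \<chi> f = 0"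
begin

abbreviation "F \<equiv> free_algebra S"

sublocale ideal I F by (rule I)

text \<open>
  The preimage of the ideal under the retraction, so that the space of all polynomials modulo \<open>J\<close>
  is the quotient by \<open>I\<close>, and left multiplication by the free algebra on \<open>S\<close> respects \<open>J\<close>.
\<close>

definition J :: "('x, 'k) nc_poly set" where "J = {v. kill_letters S v \<in> I}"

lemma J_props: "0 \<in> J" "v \<in> J \<Longrightarrow> w \<in> J \<Longrightarrow> v + w \<in> J" "f \<in> carrier F \<Longrightarrow> v \<in> J \<Longrightarrow> f * v \<in> J"
  "f \<in> I \<Longrightarrow> f * w \<in> J"
proof -
  have "kill_letters S (0 :: ('x, 'k) nc_poly) = 0"
    using kill_letters_const[of S "0::'k"] by (simp add: nc_const_simps)
  then show "0 \<in> J" using additive_subgroup.zero_closed[OF is_additive_subgroup] by (simp add: J_def)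
  show "v \<in> J \<Longrightarrow> w \<in> J \<Longrightarrow> v + w \<in> J"
    using additive_subgroup.a_closed[OF is_additive_subgroup, of "kill_letters S v" "kill_letters S w"] by (simp add: J_def kill_letters_add)
  show "f \<in> carrier F \<Longrightarrow> v \<in> J \<Longrightarrow> f * v \<in> J"
    using I_l_closed[of "kill_letters S v" f] by (simp add: J_def kill_letters_mult kill_letters_free)
  show "f \<in> I \<Longrightarrow> f * w \<in> J"
    using I_r_closed[of f "kill_letters S w"] kill_letters_in[of S w] Icarr[of f]
    by (simp add: J_def kill_letters_mult kill_letters_free)
qed

lemma J_free: "f \<in> carrier F \<Longrightarrow> f \<in> J \<longleftrightarrow> f \<in> I"
  by (simp add: J_def kill_letters_free)

text \<open>
  A linear projection onto \<open>J\<close>; the image of the complementary projection \<open>cpl\<close> is a copy of the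
  quotient by \<open>I\<close>.
\<close>

definition proj :: "('x, 'k) nc_poly \<Rightarrow> ('x, 'k) nc_poly" where
  "proj = (SOME R. (\<forall>v w. R (v + w) = R v + R w) \<and> (\<forall>x v. R (nc_const x * v) = nc_const x * R v) \<and>
     (\<forall>v. R v \<in> J) \<and> (\<forall>v\<in>J. R v = v))"

lemma proj: "proj (v + w) = proj v + proj w" "proj (nc_const x * v) = nc_const x * proj v"
  "proj v \<in> J" "v \<in> J \<Longrightarrow> proj v = v"
proof -
  have "\<exists>R. (\<forall>v w. R (v + w) = R v + R w) \<and> (\<forall>x v. R (nc_const x * v) = nc_const x * R v) \<and>
     (\<forall>v. R v \<in> J) \<and> (\<forall>v\<in>J. R v = v)"
    by (rule exists_projection[OF J_props(1,2) J_props(3)[OF free_algebra_const]]) (assumption | blast)+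
  from someI_ex[OF this, folded proj_def]
  have P: "\<forall>v w. proj (v + w) = proj v + proj w" "\<forall>x v. proj (nc_const x * v) = nc_const x * proj v"
    "\<forall>v. proj v \<in> J" "\<forall>v\<in>J. proj v = v" by - (elim conjE; assumption)+
  show "proj (v + w) = proj v + proj w" by (rule P(1)[rule_format])
  show "proj (nc_const x * v) = nc_const x * proj v" by (rule P(2)[rule_format])
  show "proj v \<in> J" by (rule P(3)[rule_format])
  show "v \<in> J \<Longrightarrow> proj v = v" by (rule P(4)[rule_format])
qed

definition cpl :: "('x, 'k) nc_poly \<Rightarrow> ('x, 'k) nc_poly" where "cpl v = v - proj v"

lemma proj_diff: "proj (v - w) = proj v - proj w"
  using proj(1)[of "v - w" w] by (simp add: algebra_simps)

lemma cpl: "cpl (v + w) = cpl v + cpl w" "cpl (nc_const x * v) = nc_const x * cpl v"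
  "v \<in> J \<Longrightarrow> cpl v = 0" "cpl (cpl v) = cpl v" "proj (cpl v) = 0"
  by (simp_all add: cpl_def proj proj_diff right_diff_distrib)

lemma cpl_cong: "f \<in> carrier F \<Longrightarrow> cpl (f * cpl v) = cpl (f * v)"
proof -
  assume f: "f \<in> carrier F"
  have "cpl (f * v) = cpl (f * cpl v + f * proj v)"
    by (simp add: cpl_def flip: distrib_left)
  also have "\<dots> = cpl (f * cpl v)"
    using cpl(3)[OF J_props(3)[OF f proj(3)]] by (simp only: cpl(1)) simp
  finally show ?thesis ..
qed

text \<open>
  The left regular representation on the copy of the quotient, and the character on the
  complementary subspace \<open>J\<close>. Without the second part, one would act as the projection \<open>cpl\<close> and
  not as the identity.
\<close>

definition rep :: "('x, 'k) nc_poly \<Rightarrow> ('x, 'k) linear_map"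
  where "rep f = Linear_map (\<lambda>v. cpl (f * cpl v) + nc_const (\<chi> f) * proj v)"

lemma apply_rep: "apply_map (rep f) v = cpl (f * cpl v) + nc_const (\<chi> f) * proj v"
proof -
  have move: "h * (nc_const x * w) = nc_const x * (h * w)" for x and h w :: "('x, 'k) nc_poly"
    using arg_cong[OF nc_const_commute[of x h], of "\<lambda>u. u * w"] by (simp add: mult.assoc)
  have "cpl (f * cpl (v + w)) + nc_const (\<chi> f) * proj (v + w) =
      cpl (f * cpl v) + nc_const (\<chi> f) * proj v + (cpl (f * cpl w) + nc_const (\<chi> f) * proj w)" for v w
    by (simp only: cpl(1) proj(1) distrib_left add_ac)
  moreover have "cpl (f * cpl (nc_const x * v)) + nc_const (\<chi> f) * proj (nc_const x * v) =
      nc_const x * (cpl (f * cpl v) + nc_const (\<chi> f) * proj v)" for x v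
    by (simp only: cpl(2) proj(2) distrib_left move[of f] move[of "nc_const (\<chi> f)" x "proj v"])
  ultimately show ?thesis
    unfolding rep_def by (subst Linear_map_inverse) auto
qed

lemma rep_eqI: "(\<And>v. apply_map x v = apply_map y v) \<Longrightarrow> x = y"
  by (simp add: apply_map_inject[symmetric] fun_eq_iff)

lemma rep_add: "rep (f + h) = rep f + rep h"
  by (rule rep_eqI) (simp add: apply_rep plus_linear_map.rep_eq \<chi>_add nc_const_simps distrib_right cpl)

lemma rep_mult: "f \<in> carrier F \<Longrightarrow> rep (f * h) = rep f * rep h"
proof (rule rep_eqI)
  fix v assume f: "f \<in> carrier F"
  have c: "cpl (nc_const x * proj v) = 0" for x by (simp add: cpl cpl_def[of "proj v"] proj)
  have p: "proj (nc_const x * proj v) = nc_const x * proj v" for x by (simp add: proj)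
  have "apply_map (rep f * rep h) v = cpl (f * cpl (cpl (h * cpl v) + nc_const (\<chi> h) * proj v)) +
      nc_const (\<chi> f) * proj (cpl (h * cpl v) + nc_const (\<chi> h) * proj v)"
    by (simp only: times_linear_map.rep_eq apply_rep)
  also have "\<dots> = cpl (f * (h * cpl v)) + nc_const (\<chi> f) * (nc_const (\<chi> h) * proj v)"
    by (simp only: cpl(1,4,5) c p proj(1) add_0_left add_0_right cpl_cong[OF f])
  finally show "apply_map (rep (f * h)) v = apply_map (rep f * rep h) v"
    by (simp add: apply_rep \<chi>_mult nc_const_simps mult.assoc)
qed

lemma apply_rep_const: "apply_map (rep (nc_const x)) v = nc_const x * v"
  by (simp add: apply_rep cpl(2,4) \<chi>_const) (simp add: cpl_def flip: distrib_left)

lemma rep_1: "rep 1 = 1"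
  by (rule rep_eqI) (use apply_rep_const[of 1] in \<open>simp add: nc_const_simps one_linear_map.rep_eq\<close>)

lemma rep_const_commute: "rep (nc_const x) * y = y * rep (nc_const x)"
  by (rule rep_eqI) (use apply_map[of y] in \<open>simp add: times_linear_map.rep_eq apply_rep_const\<close>)

text \<open>
  Faithfulness of the left regular representation: an element of the kernel sends one to an
  element of \<open>J\<close>.
\<close>

lemma rep_eq_0_iff: "f \<in> carrier F \<Longrightarrow> rep f = 0 \<longleftrightarrow> f \<in> I"
proof
  assume f: "f \<in> carrier F"
  {
    assume "f \<in> I"
    then show "rep f = 0"
      by (intro rep_eqI) (simp add: apply_rep zero_linear_map.rep_eq cpl(3)[OF J_props(4)] \<chi>_ideal nc_const_simps)
  next
    assume "rep f = 0"
    then have "cpl (f * cpl 1) + nc_const (\<chi> f) * proj 1 = 0"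
      using apply_rep[of f 1] by (simp add: zero_linear_map.rep_eq)
    moreover have "cpl (cpl (f * cpl 1) + nc_const (\<chi> f) * proj 1) = cpl (f * cpl 1)"
      by (simp only: cpl(1,2,4) cpl(3)[OF proj(3)]) simp
    ultimately have "cpl (f * cpl 1) = 0" using cpl(3)[OF J_props(1)] by simp
    then have "cpl (f * 1) = 0" by (simp only: cpl_cong[OF f])
    then have "f = proj f" by (simp add: cpl_def)
    then show "f \<in> I" using J_free[OF f] proj(3)[of f] by simp
  }
qed

lemma rep_diff: "rep (f - h) = rep f - rep h"
  using rep_add[of "f - h" h] by (simp add: algebra_simps)

lemma rep_power: "f \<in> carrier F \<Longrightarrow> rep (f ^ N) = rep f ^ N"
  by (induction N) (simp_all add: rep_1 rep_mult)

lemma rep_sum: "rep (sum f A) = (\<Sum>s\<in>A. rep (f s))"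
proof -
  have "rep 0 = 0" using rep_add[of 0 0] by simp
  then show ?thesis by (induction A rule: infinite_finite_induct) (simp_all add: rep_add)
qed

text \<open>
  Any representative of a coset may be chosen, since \<open>rep\<close> vanishes on the ideal.
\<close>

definition class_rep :: "('x, 'k) nc_poly set \<Rightarrow> ('x, 'k) linear_map"
  where "class_rep A = rep (SOME f. f \<in> carrier F \<and> A = I +>\<^bsub>F\<^esub> f)"

lemma coset_eq_iff: "f \<in> carrier F \<Longrightarrow> h \<in> carrier F \<Longrightarrow> I +>\<^bsub>F\<^esub> f = I +>\<^bsub>F\<^esub> h \<longleftrightarrow> rep f = rep h"
  using quotient_eq_iff_same_a_r_cos[OF I, of f h] rep_eq_0_iff[of "f - h"]
  by (simp add: free_algebra_minus free_algebra_diff rep_diff)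

lemma class_rep: "f \<in> carrier F \<Longrightarrow> class_rep (I +>\<^bsub>F\<^esub> f) = rep f"
proof -
  assume f: "f \<in> carrier F"
  let ?h = "SOME h. h \<in> carrier F \<and> I +>\<^bsub>F\<^esub> f = I +>\<^bsub>F\<^esub> h"
  have "?h \<in> carrier F \<and> I +>\<^bsub>F\<^esub> f = I +>\<^bsub>F\<^esub> ?h" by (rule someI[of _ f]) (simp add: f)
  then show ?thesis using coset_eq_iff[OF f, of ?h] by (simp add: class_rep_def)
qed

lemma carrier_quot: "carrier (F Quot I) = (\<lambda>f. I +>\<^bsub>F\<^esub> f) ` carrier F"
  by (auto simp: FactRing_def A_RCOSETS_def')

lemma class_rep_hom: "x \<in> carrier (F Quot I) \<Longrightarrow> y \<in> carrier (F Quot I) \<Longrightarrow>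
    class_rep (x \<otimes>\<^bsub>F Quot I\<^esub> y) = class_rep x * class_rep y"
  "x \<in> carrier (F Quot I) \<Longrightarrow> y \<in> carrier (F Quot I) \<Longrightarrow>
    class_rep (x \<oplus>\<^bsub>F Quot I\<^esub> y) = class_rep x + class_rep y"
  "class_rep \<one>\<^bsub>F Quot I\<^esub> = 1"
proof -
  note hom = rcos_ring_hom
  have carrierE: "\<exists>f\<in>carrier F. x = I +>\<^bsub>F\<^esub> f" if "x \<in> carrier (F Quot I)" for x
    using that by (simp only: carrier_quot image_iff)
  show "class_rep (x \<otimes>\<^bsub>F Quot I\<^esub> y) = class_rep x * class_rep y"
    if xy: "x \<in> carrier (F Quot I)" "y \<in> carrier (F Quot I)"
  proof -
    obtain f h where fh: "f \<in> carrier F" "h \<in> carrier F" and x: "x = I +>\<^bsub>F\<^esub> f" and y: "y = I +>\<^bsub>F\<^esub> h"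
      using carrierE[OF xy(1)] carrierE[OF xy(2)] by (elim bexE)
    show ?thesis
      unfolding x y ring_hom_mult[OF hom fh, symmetric]
      by (simp only: free_algebra_ops class_rep free_algebra_mult rep_mult fh)
  qed
  show "class_rep (x \<oplus>\<^bsub>F Quot I\<^esub> y) = class_rep x + class_rep y"
    if xy: "x \<in> carrier (F Quot I)" "y \<in> carrier (F Quot I)"
  proof -
    obtain f h where fh: "f \<in> carrier F" "h \<in> carrier F" and x: "x = I +>\<^bsub>F\<^esub> f" and y: "y = I +>\<^bsub>F\<^esub> h"
      using carrierE[OF xy(1)] carrierE[OF xy(2)] by (elim bexE)
    show ?thesis
      unfolding x y ring_hom_add[OF hom fh, symmetric]
      by (simp only: free_algebra_ops class_rep free_algebra_add rep_add fh)
  qed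
  have "I +>\<^bsub>F\<^esub> 1 = \<one>\<^bsub>F Quot I\<^esub>"
    using ring_hom_one[OF hom] by (simp only: free_algebra_ops)
  then show "class_rep \<one>\<^bsub>F Quot I\<^esub> = 1"
    using class_rep[OF free_algebra_0_1(2)] by (simp only: rep_1)
qed

lemma class_rep_inj: "inj_on class_rep (carrier (F Quot I))"
  unfolding inj_on_def carrier_quot by (auto simp: class_rep coset_eq_iff)

end

section \<open>The Yokonuma--Hecke algebra inside a ring of linear maps\<close>

fun letter_value :: "'k \<Rightarrow> yh_gen \<Rightarrow> 'k::comm_ring_1" where
  "letter_value q (G a) = q"
| "letter_value q (T a) = 1"

text \<open>
  The one-dimensional representation with \<open>g\<^sub>a \<mapsto> q\<close> and \<open>t\<^sub>a \<mapsto> 1\<close>.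
\<close>

definition trivial_char :: "'k::field \<Rightarrow> (yh_gen, 'k) nc_poly \<Rightarrow> 'k"
  where "trivial_char q = word_extension (\<lambda>x. x) (\<lambda>w. prod_list (map (letter_value q) (letters w)))"

lemma trivial_char_hom: "word_hom (\<lambda>x. x) (\<lambda>w. prod_list (map (letter_value q) (letters w)))" for q :: "'k::field"
  by standard (auto simp: letters_simps)

lemmas trivial_char_simps =
  word_hom.ext_add[OF trivial_char_hom, folded trivial_char_def]
  word_hom.ext_mult[OF trivial_char_hom, folded trivial_char_def]
  word_hom.ext_const[OF trivial_char_hom, folded trivial_char_def]
  word_hom.ext_diff[OF trivial_char_hom, folded trivial_char_def]
  word_hom.ext_1[OF trivial_char_hom, folded trivial_char_def]
  word_hom.ext_0[OF trivial_char_hom, folded trivial_char_def]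
  word_hom.ext_power[OF trivial_char_hom, folded trivial_char_def]
  word_hom.ext_sum[OF trivial_char_hom, folded trivial_char_def]
  word_hom.ext_gen[OF trivial_char_hom, folded trivial_char_def]

lemma trivial_char_relators:
  assumes "of_nat d \<noteq> (0 :: 'k::field)" and "f \<in> yh_relators d n (q :: 'k)"
  shows "trivial_char q f = 0"
proof -
  have "trivial_char q (yh_e d a) = 1" for a
    using assms(1) by (simp add: yh_e_def trivial_char_simps)
  then show ?thesis
    using assms(2) unfolding yh_relators_def Let_def
    by (auto simp: trivial_char_simps power2_eq_square left_diff_distrib right_diff_distrib mult.commute)
qed

lemma gens: "a \<in> {1..<n} \<Longrightarrow> nc_gen (G a) \<in> carrier (free_algebra (yh_gens n))"
  "b \<in> {1..n} \<Longrightarrow> nc_gen (T b) \<in> carrier (free_algebra (yh_gens n))"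
  by (auto intro!: free_algebra_gen simp: yh_gens_def)

lemma yh_e_in: "a \<in> {1..<n} \<Longrightarrow> yh_e d a \<in> carrier (free_algebra (yh_gens n))"
  unfolding yh_e_def
  by (intro free_algebra_mult free_algebra_const free_algebra_sum free_algebra_power gens) auto

lemma relators_in: "yh_relators d n (q :: 'k::field) \<subseteq> carrier (free_algebra (yh_gens n))"
proof -
  have "transpose b (b + 1) a \<in> {1..n}" if "a \<in> {1..n}" "b \<in> {1..<n}" for a b :: nat
    using that by (auto simp: transpose_def)
  then show ?thesis
    unfolding yh_relators_def Let_def
    by (auto intro!: free_algebra_diff free_algebra_mult free_algebra_add free_algebra_power free_algebra_const
        free_algebra_0_1 gens yh_e_in simp del: One_nat_def add_Suc_right add_0_right)
qed

lemma ideal_yh_ideal: "ideal (yh_ideal d n (q :: 'k::field)) (free_algebra (yh_gens n))"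
  unfolding yh_ideal_def by (rule ring.genideal_ideal[OF ring_free_algebra relators_in])

lemma relators_in_ideal: "yh_relators d n (q :: 'k::field) \<subseteq> yh_ideal d n q"
  unfolding yh_ideal_def by (rule ring.genideal_self[OF ring_free_algebra relators_in])

lemma trivial_char_ideal:
  assumes "of_nat d \<noteq> (0 :: 'k::field)" and "f \<in> yh_ideal d n (q :: 'k)"
  shows "trivial_char q f = 0"
proof -
  let ?F = "free_algebra (yh_gens n) :: (yh_gen, 'k) nc_poly ring"
  let ?N = "{f \<in> carrier ?F. trivial_char q f = 0}"
  interpret F: ring ?F by (rule ring_free_algebra)
  have "ideal ?N ?F"
  proof (rule idealI[OF F.ring_axioms])
    show "subgroup ?N (add_monoid ?F)"
    proof (rule F.add.subgroupI)
      fix f assume f: "f \<in> ?N"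
      have "\<ominus>\<^bsub>?F\<^esub> f = - f"
        by (rule F.minus_equality) (use f in \<open>auto simp: free_algebra_closed\<close>)
      then show "\<ominus>\<^bsub>?F\<^esub> f \<in> ?N"
        using f trivial_char_simps(4)[of q 0 f] by (simp add: free_algebra_closed trivial_char_simps)
    qed (auto simp: trivial_char_simps free_algebra_closed intro: exI[of _ 0])
  qed (auto simp: trivial_char_simps free_algebra_closed)
  moreover have "yh_relators d n q \<subseteq> ?N"
    using relators_in trivial_char_relators[OF assms(1)] by blast
  ultimately have "yh_ideal d n q \<subseteq> ?N"
    unfolding yh_ideal_def by (rule F.genideal_minimal)
  then show ?thesis using assms(2) by blast
qed

locale yh_parameters =
  fixes d n :: nat and q \<xi> :: "'k::field" and Y :: "(yh_gen, 'k) nc_poly set ring" (structure)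
  assumes d_pos: "d \<ge> 1" and d_char: "of_nat d \<noteq> (0::'k)"
    and \<xi>_primitive: "primitive_root_of_unity d \<xi>" and q_neq: "q \<noteq> 0" "q \<noteq> 1"
    and Y_eq: "Y = yh_algebra d n q"
begin

sublocale aug: augmented_quotient "yh_gens n" "yh_ideal d n q" "trivial_char q"
  by (intro augmented_quotient.intro ideal_yh_ideal trivial_char_ideal[OF d_char])
     (simp_all add: trivial_char_simps)

abbreviation "\<rho> \<equiv> aug.class_rep"
abbreviation "c0 x \<equiv> aug.rep (nc_const x)"
abbreviation "g0 a \<equiv> aug.rep (nc_gen (G a))"
abbreviation "t0 a \<equiv> aug.rep (nc_gen (T a))"

lemma rep_relator: "f - h \<in> yh_relators d n q \<Longrightarrow> aug.rep f = aug.rep h"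
proof -
  assume "f - h \<in> yh_relators d n q"
  then have "aug.rep (f - h) = 0"
    using aug.rep_eq_0_iff[OF subsetD[OF relators_in], of "f - h"] relators_in_ideal by blast
  then show "aug.rep f = aug.rep h" by (simp add: aug.rep_diff)
qed

sublocale hecke: yokonuma_hecke c0 d n q \<xi> g0 t0
proof
  note rep = aug.rep_mult aug.rep_power aug.rep_1 aug.rep_sum aug.rep_add
    free_algebra_mult free_algebra_power free_algebra_const gens
  show "c0 (x + y) = c0 x + c0 y" "c0 (x * y) = c0 x * c0 y" "c0 1 = 1" for x y
    by (simp_all add: nc_const_simps aug.rep_add aug.rep_mult free_algebra_const aug.rep_1)
  show "c0 x * r = r * c0 x" for x r
    by (rule aug.rep_const_commute)
  show "t0 a ^ d = 1" if "a \<in> {1..n}" for a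
  proof -
    have "aug.rep (nc_gen (T a) ^ d) = aug.rep 1"
      by (rule rep_relator) (use that in \<open>unfold yh_relators_def Let_def, blast\<close>)
    then show ?thesis using that by (simp add: rep)
  qed
  show "t0 a * t0 b = t0 b * t0 a" if "a \<in> {1..n}" "b \<in> {1..n}" for a b
  proof -
    have "aug.rep (nc_gen (T a) * nc_gen (T b)) = aug.rep (nc_gen (T b) * nc_gen (T a))"
      by (rule rep_relator) (use that in \<open>unfold yh_relators_def Let_def, blast\<close>)
    then show ?thesis using that by (simp add: rep)
  qed
  show "t0 a * g0 b = g0 b * t0 (transpose b (b + 1) a)" if "a \<in> {1..n}" "b \<in> {1..<n}" for a b
  proof -
    have "aug.rep (nc_gen (T a) * nc_gen (G b)) = aug.rep (nc_gen (G b) * nc_gen (T (transpose b (b + 1) a)))"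
      by (rule rep_relator) (use that in \<open>unfold yh_relators_def Let_def, blast\<close>)
    then show ?thesis using that by (simp add: rep)
  qed
  show "g0 a * g0 a = c0 q + c0 (q - 1) * (c0 (1 / of_nat d) * (\<Sum>r<d. t0 a ^ r * t0 (a + 1) ^ (d - r))) * g0 a"
    if "a \<in> {1..<n}" for a
  proof -
    have a: "a \<in> {1..n}" "a + 1 \<in> {1..n}" using that by auto
    have "aug.rep (nc_gen (G a) ^ 2) = aug.rep (nc_const q + nc_const (q - 1) * yh_e d a * nc_gen (G a))"
      by (rule rep_relator) (use that in \<open>unfold yh_relators_def Let_def, blast\<close>)
    moreover have "aug.rep (yh_e d a) = c0 (1 / of_nat d) * (\<Sum>r<d. t0 a ^ r * t0 (a + 1) ^ (d - r))"
      unfolding yh_e_def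
      by (simp only: aug.rep_mult[OF free_algebra_const] aug.rep_sum
          aug.rep_mult[OF free_algebra_power[OF gens(2)[OF a(1)]]]
          aug.rep_power[OF gens(2)[OF a(1)]] aug.rep_power[OF gens(2)[OF a(2)]])
    ultimately show ?thesis
      by (simp only: power2_eq_square aug.rep_add aug.rep_mult[OF gens(1)[OF that]]
          aug.rep_mult[OF free_algebra_mult[OF free_algebra_const yh_e_in[OF that]]]
          aug.rep_mult[OF free_algebra_const])
  qed
  show "g0 a * g0 (a + 1) * g0 a = g0 (a + 1) * g0 a * g0 (a + 1)" if "a \<in> {1..<n}" "a + 1 \<in> {1..<n}" for a
  proof -
    have "\<bar>int a - int (a + 1)\<bar> = 1" by simp
    then have "aug.rep (nc_gen (G a) * nc_gen (G (a + 1)) * nc_gen (G a)) =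
        aug.rep (nc_gen (G (a + 1)) * nc_gen (G a) * nc_gen (G (a + 1)))"
      by (intro rep_relator) (use that in \<open>unfold yh_relators_def Let_def, blast\<close>)
    then show ?thesis
      by (simp only: aug.rep_mult[OF gens(1)[OF that(1)]] aug.rep_mult[OF gens(1)[OF that(2)]]
          aug.rep_mult[OF free_algebra_mult[OF gens(1)[OF that(1)] gens(1)[OF that(2)]]]
          aug.rep_mult[OF free_algebra_mult[OF gens(1)[OF that(2)] gens(1)[OF that(1)]]])
  qed
  show "g0 a * g0 b = g0 b * g0 a" if "a \<in> {1..<n}" "b \<in> {1..<n}" "a + 1 < b" for a b
  proof -
    have "\<bar>int a - int b\<bar> > 1" using that(3) by simp
    then have "aug.rep (nc_gen (G a) * nc_gen (G b)) = aug.rep (nc_gen (G b) * nc_gen (G a))"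
      by (intro rep_relator) (use that in \<open>unfold yh_relators_def Let_def, blast\<close>)
    then show ?thesis using that by (simp add: rep)
  qed
qed (use d_pos d_char \<xi>_primitive q_neq in auto)

sublocale Y: ring Y
  unfolding Y_eq yh_algebra_def by (rule aug.quotient_is_ring)

lemma \<rho>_class: "f \<in> carrier (free_algebra (yh_gens n)) \<Longrightarrow> yh_class d n q f \<in> carrier Y \<and> \<rho> (yh_class d n q f) = aug.rep f"
  unfolding Y_eq yh_algebra_def aug.carrier_quot yh_class_def by (auto simp: aug.class_rep)

lemma \<rho>_mult: "x \<in> carrier Y \<Longrightarrow> y \<in> carrier Y \<Longrightarrow> \<rho> (x \<otimes> y) = \<rho> x * \<rho> y"
  and \<rho>_add: "x \<in> carrier Y \<Longrightarrow> y \<in> carrier Y \<Longrightarrow> \<rho> (x \<oplus> y) = \<rho> x + \<rho> y"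
  and \<rho>_1: "\<rho> \<one> = 1"
  unfolding Y_eq yh_algebra_def by (rule aug.class_rep_hom; assumption)+

lemma \<rho>_eqI: "\<rho> x = \<rho> y \<Longrightarrow> x \<in> carrier Y \<Longrightarrow> y \<in> carrier Y \<Longrightarrow> x = y"
  unfolding Y_eq yh_algebra_def by (rule inj_onD[OF aug.class_rep_inj])

lemma \<rho>_0: "\<rho> \<zero> = 0"
  using \<rho>_add[of "\<zero>" "\<zero>"] by simp

lemma \<rho>_minus: "x \<in> carrier Y \<Longrightarrow> y \<in> carrier Y \<Longrightarrow> \<rho> (x \<ominus> y) = \<rho> x - \<rho> y"
proof -
  assume xy: "x \<in> carrier Y" "y \<in> carrier Y"
  then have "\<rho> y + \<rho> (\<ominus> y) = 0" using \<rho>_add[of y "\<ominus> y"] by (simp add: Y.r_neg \<rho>_0)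
  then show ?thesis using xy by (simp add: a_minus_def \<rho>_add eq_neg_iff_add_eq_0 add.commute)
qed

lemma \<rho>_pow: "x \<in> carrier Y \<Longrightarrow> \<rho> (x [^] (N::nat)) = \<rho> x ^ N"
  by (induction N) (simp_all add: \<rho>_1 \<rho>_mult power_commutes)

lemma \<rho>_finsum: "(\<And>s. s \<in> S \<Longrightarrow> f s \<in> carrier Y) \<Longrightarrow> \<rho> (finsum Y f S) = (\<Sum>s\<in>S. \<rho> (f s))"
proof (induction S rule: infinite_finite_induct)
  case (insert s S)
  then show ?case by (subst Y.finsum_insert) (auto simp: \<rho>_add)
qed (simp_all add: \<rho>_0)

lemmas \<rho>_simps = \<rho>_mult \<rho>_add \<rho>_1 \<rho>_0 \<rho>_minus \<rho>_pow

lemma \<rho>_const: "yh_const d n q x \<in> carrier Y" "\<rho> (yh_const d n q x) = c0 x"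
  using \<rho>_class[OF free_algebra_const] by (auto simp: yh_const_def)

lemma \<rho>_g: "a \<in> {1..<n} \<Longrightarrow> yh_g d n q a \<in> carrier Y" "a \<in> {1..<n} \<Longrightarrow> \<rho> (yh_g d n q a) = g0 a"
  using \<rho>_class[OF gens(1)] by (auto simp: yh_g_def)

lemma \<rho>_t: "a \<in> {1..n} \<Longrightarrow> yh_t d n q a \<in> carrier Y" "a \<in> {1..n} \<Longrightarrow> \<rho> (yh_t d n q a) = t0 a"
  using \<rho>_class[OF gens(2)] by (auto simp: yh_t_def)

lemma \<rho>_X': "a \<le> n \<Longrightarrow> yh_X d n q a \<in> carrier Y \<and> \<rho> (yh_X d n q a) = hecke.X a"
proof (induction a rule: hecke.X.induct)
  case (3 a)
  then have a: "Suc a \<in> {1..<n}" by auto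
  show ?case using 3 \<rho>_g[OF a] by (simp add: Y_eq[symmetric] \<rho>_const \<rho>_simps)
qed (simp_all add: Y_eq[symmetric] \<rho>_1)

lemma \<rho>_X: "a \<in> {1..n} \<Longrightarrow> yh_X d n q a \<in> carrier Y" "a \<in> {1..n} \<Longrightarrow> \<rho> (yh_X d n q a) = hecke.X a"
  using \<rho>_X'[of a] by auto

text \<open>
  The inverse of \<open>\<rho>\<close> on its range. Elements that are constructed in the ring of linear maps, such
  as the weight idempotents and local inverses, are polynomials in images of generators, so they
  can be lifted.
\<close>

definition lift :: "(yh_gen, 'k) linear_map \<Rightarrow> (yh_gen, 'k) nc_poly set"
  where "lift = the_inv_into (carrier Y) \<rho>"

lemma lift:
  assumes "x \<in> \<rho> ` carrier Y"
  shows "lift x \<in> carrier Y" and "\<rho> (lift x) = x"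
proof -
  have inj: "inj_on \<rho> (carrier Y)" using \<rho>_eqI by (auto intro: inj_onI)
  show "lift x \<in> carrier Y" unfolding lift_def by (rule the_inv_into_into[OF inj assms]) simp
  show "\<rho> (lift x) = x" unfolding lift_def by (rule f_the_inv_into_f[OF inj assms])
qed

lemma subalgebra_range:
  assumes "x \<in> hecke.subalgebra B" and "B \<subseteq> \<rho> ` carrier Y"
  shows "x \<in> \<rho> ` carrier Y"
  using assms(1)
proof induction
  case (scalar x)
  then show ?case using \<rho>_const by (metis imageI)
next
  case (add x y)
  then show ?case by (auto simp: \<rho>_add[symmetric])
next
  case (mult x y)
  then show ?case by (auto simp: \<rho>_mult[symmetric])
qed (use assms(2) in auto)

lemma generator_in_range:
  "a \<in> {1..n} \<Longrightarrow> hecke.X a \<in> \<rho> ` carrier Y" "a \<in> {1..<n} \<Longrightarrow> g0 a \<in> \<rho> ` carrier Y"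
  "a \<in> {1..n} \<Longrightarrow> t0 a \<in> \<rho> ` carrier Y"
  by (metis \<rho>_X imageI, metis \<rho>_g imageI, metis \<rho>_t imageI)

lemma Alg_range: "x \<in> hecke.Alg \<Longrightarrow> x \<in> \<rho> ` carrier Y"
  unfolding hecke.Alg_def
  by (erule subalgebra_range) (use generator_in_range in blast)

lemma generators_range:
  assumes "x \<in> hecke.subalgebra (g0 ` {1..<n} \<union> t0 ` {1..n})"
  shows "x \<in> \<rho> ` carrier Y"
  using assms by (rule subalgebra_range) (use generator_in_range in blast)

lemma X_inv_range: "a \<in> {1..n} \<Longrightarrow> hecke.X_inv a \<in> \<rho> ` carrier Y"
proof (rule generators_range, induction a rule: hecke.X.induct)
  case (3 a)
  have a: "Suc a \<in> {1..<n}" "Suc a \<in> {1..n}" "Suc (Suc a) \<in> {1..n}" using 3(2) by auto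
  note gen = hecke.subalgebra.gen[of _ "g0 ` {1..<n} \<union> t0 ` {1..n}"]
  have "hecke.e (Suc a) \<in> hecke.subalgebra (g0 ` {1..<n} \<union> t0 ` {1..n})"
    unfolding hecke.e_def using a
    by (intro hecke.subalgebra.mult hecke.subalgebra.scalar hecke.subalgebra_sum hecke.subalgebra_power gen) auto
  moreover have "g0 (Suc a) \<in> hecke.subalgebra (g0 ` {1..<n} \<union> t0 ` {1..n})"
    by (rule gen) (use a in blast)
  ultimately have "hecke.h (Suc a) \<in> hecke.subalgebra (g0 ` {1..<n} \<union> t0 ` {1..n})"
    unfolding hecke.h_def by (intro hecke.subalgebra_diff hecke.subalgebra.mult hecke.subalgebra.scalar)
  then show ?case using 3(1)[OF a(2)]
    by (simp only: hecke.X_inv.simps) (intro hecke.subalgebra.mult hecke.subalgebra.scalar)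
qed (simp_all add: hecke.subalgebra_1)

lemma \<rho>_X_inv:
  assumes "a \<in> {1..n}"
  shows "inv\<^bsub>Y\<^esub> yh_X d n q a \<in> carrier Y" "\<rho> (inv\<^bsub>Y\<^esub> yh_X d n q a) = hecke.X_inv a"
proof -
  let ?y = "lift (hecke.X_inv a)"
  note X = \<rho>_X[OF assms] and y = lift[OF X_inv_range[OF assms]]
  have "yh_X d n q a \<otimes> ?y = \<one>" "?y \<otimes> yh_X d n q a = \<one>"
    by (rule \<rho>_eqI; use X y hecke.X_X_inv[OF assms] in \<open>simp add: \<rho>_simps\<close>)+
  then have "?y = inv\<^bsub>Y\<^esub> yh_X d n q a" by (intro Y.inv_unique'[OF X(1) y(1)])
  then show "inv\<^bsub>Y\<^esub> yh_X d n q a \<in> carrier Y" "\<rho> (inv\<^bsub>Y\<^esub> yh_X d n q a) = hecke.X_inv a"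
    using y by simp_all
qed

end

section \<open>Weight idempotents and local inverses in the quotient\<close>

context yh_parameters
begin

abbreviation "K \<equiv> yh_K d n q"

definition E0 :: "(nat \<Rightarrow> int \<times> int) \<Rightarrow> (yh_gen, 'k) linear_map" where
  "E0 = (SOME E. (\<forall>k\<in>K. E k \<in> hecke.Alg \<and>
      (\<exists>N. \<forall>a\<in>{1..n}. (hecke.X a - c0 (q powi fst (k a))) ^ N * E k = 0 \<and>
      (t0 a - c0 (\<xi> powi snd (k a))) * E k = 0)) \<and>
    finite {k\<in>K. E k \<noteq> 0} \<and> (\<Sum>k\<in>{k\<in>K. E k \<noteq> 0}. E k) = 1)"

sublocale W: yokonuma_hecke_idempotents c0 d n q \<xi> g0 t0 E0
proof -
  note P = someI_ex[OF hecke.idempotents_exist, folded E0_def]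
  show "yokonuma_hecke_idempotents c0 d n q \<xi> g0 t0 E0"
    by (intro yokonuma_hecke_idempotents.intro hecke.yokonuma_hecke_axioms yokonuma_hecke_idempotents_axioms.intro)
      (use P in blast)+
qed

definition E :: "(nat \<Rightarrow> int \<times> int) \<Rightarrow> (yh_gen, 'k) nc_poly set"
  where "E k = (if k \<in> K then lift (E0 k) else undefined)"

lemma \<rho>_E: "k \<in> K \<Longrightarrow> E k \<in> carrier Y" "k \<in> K \<Longrightarrow> \<rho> (E k) = E0 k"
  using lift[OF Alg_range[OF W.E_in]] by (simp_all add: E_def)

lemma E_eq_0_iff: "k \<in> K \<Longrightarrow> E k = \<zero> \<longleftrightarrow> E0 k = 0"
  using \<rho>_E \<rho>_0 \<rho>_eqI Y.zero_closed by metis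

lemma support_E: "{k \<in> K. E k \<noteq> \<zero>} = {k \<in> K. E0 k \<noteq> 0}"
  using E_eq_0_iff by auto

lemma in_l_coset_iff:
  assumes "f \<in> carrier Y" and "f \<otimes> f = f"
  shows "x \<in> f <# carrier Y \<longleftrightarrow> x \<in> carrier Y \<and> f \<otimes> x = x"
proof
  assume "x \<in> f <# carrier Y"
  then obtain y where y: "y \<in> carrier Y" "x = f \<otimes> y" by (auto simp: l_coset_def)
  then show "x \<in> carrier Y \<and> f \<otimes> x = x"
    using assms by (simp add: Y.m_assoc[symmetric])
next
  assume "x \<in> carrier Y \<and> f \<otimes> x = x"
  then show "x \<in> f <# carrier Y" by (force simp: l_coset_def)
qed

text \<open>
  The weight space is the set fixed by the idempotent: an element fixed by it inherits the
  eigenvalues, and conversely the other idempotents annihilate an element of weight \<open>k\<close>.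
\<close>

lemma weight_space_iff:
  assumes "k \<in> K"
  shows "x \<in> yh_weight_space d n q \<xi> k \<longleftrightarrow> x \<in> carrier Y \<and> E0 k * \<rho> x = \<rho> x"
proof -
  have term_eq: "(yh_X d n q a \<ominus> yh_const d n q (q powi fst (k a))) [^] N \<otimes> x = \<zero> \<longleftrightarrow>
      (hecke.X a - c0 (q powi fst (k a))) ^ N * \<rho> x = 0"
    "(yh_t d n q a \<ominus> yh_const d n q (\<xi> powi snd (k a))) \<otimes> x = \<zero> \<longleftrightarrow>
      (t0 a - c0 (\<xi> powi snd (k a))) * \<rho> x = 0"
    if "x \<in> carrier Y" "a \<in> {1..n}" for a N
  proof -
    note cl = \<rho>_X[OF that(2)] \<rho>_t[OF that(2)] \<rho>_const that(1)
    have eq0: "y = \<zero> \<longleftrightarrow> \<rho> y = 0" if "y \<in> carrier Y" for y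
      using that \<rho>_0 \<rho>_eqI Y.zero_closed by metis
    show "(yh_X d n q a \<ominus> yh_const d n q (q powi fst (k a))) [^] N \<otimes> x = \<zero> \<longleftrightarrow>
        (hecke.X a - c0 (q powi fst (k a))) ^ N * \<rho> x = 0"
      using cl by (subst eq0) (simp_all add: \<rho>_simps)
    show "(yh_t d n q a \<ominus> yh_const d n q (\<xi> powi snd (k a))) \<otimes> x = \<zero> \<longleftrightarrow>
        (t0 a - c0 (\<xi> powi snd (k a))) * \<rho> x = 0"
      using cl by (subst eq0) (simp_all add: \<rho>_simps)
  qed
  have "x \<in> yh_weight_space d n q \<xi> k \<longleftrightarrow> x \<in> carrier Y \<and>
      (\<exists>N0. \<forall>N\<ge>N0. \<forall>a\<in>{1..n}. (hecke.X a - c0 (q powi fst (k a))) ^ N * \<rho> x = 0 \<and>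
        (t0 a - c0 (\<xi> powi snd (k a))) * \<rho> x = 0)"
    unfolding yh_weight_space_def Let_def mem_Collect_eq Y_eq[symmetric] using term_eq by (intro conj_cong refl) simp
  also have "\<dots> \<longleftrightarrow> x \<in> carrier Y \<and> W.weight k (\<rho> x)"
  proof (intro conj_cong refl iffI)
    assume "\<exists>N0. \<forall>N\<ge>N0. \<forall>a\<in>{1..n}. (hecke.X a - c0 (q powi fst (k a))) ^ N * \<rho> x = 0 \<and>
        (t0 a - c0 (\<xi> powi snd (k a))) * \<rho> x = 0"
    then show "W.weight k (\<rho> x)" unfolding W.weight_def by blast
  next
    assume "W.weight k (\<rho> x)"
    then obtain N0 where N0: "\<forall>a\<in>{1..n}. (hecke.X a - c0 (q powi fst (k a))) ^ N0 * \<rho> x = 0 \<and>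
        (t0 a - c0 (\<xi> powi snd (k a))) * \<rho> x = 0"
      unfolding W.weight_def by blast
    have "(hecke.X a - c0 (q powi fst (k a))) ^ N * \<rho> x = 0" if "N \<ge> N0" "a \<in> {1..n}" for N a
    proof -
      have "(hecke.X a - c0 (q powi fst (k a))) ^ N =
          (hecke.X a - c0 (q powi fst (k a))) ^ (N - N0) * (hecke.X a - c0 (q powi fst (k a))) ^ N0"
        using that(1) by (simp flip: power_add)
      then show ?thesis using N0 that(2) by (simp add: mult.assoc)
    qed
    then show "\<exists>N0. \<forall>N\<ge>N0. \<forall>a\<in>{1..n}. (hecke.X a - c0 (q powi fst (k a))) ^ N * \<rho> x = 0 \<and>
        (t0 a - c0 (\<xi> powi snd (k a))) * \<rho> x = 0"
      using N0 by blast
  qed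
  also have "\<dots> \<longleftrightarrow> x \<in> carrier Y \<and> E0 k * \<rho> x = \<rho> x"
    using W.weight_E_fix[OF assms] W.weight_mult[OF W.weight_E[OF assms], of "\<rho> x"] by auto
  finally show ?thesis .
qed

lemma E_mult: "k \<in> K \<Longrightarrow> l \<in> K \<Longrightarrow> E k \<otimes> E l = (if k = l then E k else \<zero>)"
  by (rule \<rho>_eqI) (auto simp: \<rho>_simps \<rho>_E W.E_idem W.E_orth)

lemma E_family: "yh_idempotent_family d n q \<xi> E"
  unfolding yh_idempotent_family_def Let_def Y_eq[symmetric]
proof (intro conjI ballI)
  show "E \<in> K \<rightarrow>\<^sub>E carrier Y" using \<rho>_E(1) by (auto simp: E_def)
  show "E k \<otimes> E l = (if k = l then E k else \<zero>)" if "k \<in> K" "l \<in> K" for k l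
    by (rule E_mult[OF that])
  show "finite {k \<in> K. E k \<noteq> \<zero>}" unfolding support_E by (rule W.E_finite)
  have "\<rho> (finsum Y E {k \<in> K. E k \<noteq> \<zero>}) = (\<Sum>k\<in>{k \<in> K. E k \<noteq> \<zero>}. E0 k)"
    by (subst \<rho>_finsum) (auto simp: \<rho>_E intro!: sum.cong)
  also have "\<dots> = 1" unfolding support_E by (rule W.E_sum)
  finally show "finsum Y E {k \<in> K. E k \<noteq> \<zero>} = \<one>"
    by (intro \<rho>_eqI) (auto simp: \<rho>_1 intro!: Y.finsum_closed \<rho>_E)
  show "E k <# carrier Y = yh_weight_space d n q \<xi> k" if k: "k \<in> K" for k
  proof (rule Set.set_eqI)
    fix x
    have "E k \<otimes> x = x \<longleftrightarrow> E0 k * \<rho> x = \<rho> x" if "x \<in> carrier Y"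
      using \<rho>_eqI[OF _ Y.m_closed[OF \<rho>_E(1)[OF k] that] that] \<rho>_mult[OF \<rho>_E(1)[OF k] that] \<rho>_E(2)[OF k]
      by metis
    then show "x \<in> E k <# carrier Y \<longleftrightarrow> x \<in> yh_weight_space d n q \<xi> k"
      unfolding weight_space_iff[OF k] using in_l_coset_iff[OF \<rho>_E(1)[OF k]] E_mult[OF k k] by auto
  qed
qed

text \<open>
  Both families fix the same weight spaces, so \<open>E k = E k (\<Sum>l. H l) = H k\<close>.
\<close>

lemma idempotent_family_unique:
  assumes "yh_idempotent_family d n q \<xi> H"
  shows "H = E"
proof -
  from assms have HK: "H \<in> K \<rightarrow>\<^sub>E carrier Y"
    and HH: "\<And>k. k \<in> K \<Longrightarrow> H k \<otimes> H k = H k"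
    and fin: "finite {k \<in> K. H k \<noteq> \<zero>}" and sum: "finsum Y H {k \<in> K. H k \<noteq> \<zero>} = \<one>"
    and ws: "\<And>k. k \<in> K \<Longrightarrow> H k <# carrier Y = yh_weight_space d n q \<xi> k"
    unfolding yh_idempotent_family_def Let_def Y_eq[symmetric] by simp_all
  have Hc: "H k \<in> carrier Y" if "k \<in> K" for k using HK that by auto
  have EH: "E0 k * \<rho> (H k) = \<rho> (H k)" if "k \<in> K" for k
    using in_l_coset_iff[OF Hc[OF that] HH[OF that], of "H k"] Hc[OF that] HH[OF that]
    unfolding ws[OF that] weight_space_iff[OF that] by simp
  have sum0: "(\<Sum>l\<in>{k \<in> K. H k \<noteq> \<zero>}. \<rho> (H l)) = 1"
    using arg_cong[OF sum, of \<rho>] Hc by (subst (asm) \<rho>_finsum) (auto simp: \<rho>_1)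
  have "H k = E k" if k: "k \<in> K" for k
  proof (rule \<rho>_eqI[OF _ Hc[OF k] \<rho>_E(1)[OF k]])
    have "E0 k = (\<Sum>l\<in>{k \<in> K. H k \<noteq> \<zero>}. E0 k * \<rho> (H l))"
      using arg_cong[OF sum0, of "\<lambda>x. E0 k * x"] by (simp add: sum_distrib_left)
    also have "\<dots> = (\<Sum>l\<in>{k \<in> K. H k \<noteq> \<zero>}. if l = k then \<rho> (H k) else 0)"
    proof (rule sum.cong[OF refl])
      fix l assume l: "l \<in> {k \<in> K. H k \<noteq> \<zero>}"
      show "E0 k * \<rho> (H l) = (if l = k then \<rho> (H k) else 0)"
      proof (cases "l = k")
        case False
        then have "E0 k * (E0 l * \<rho> (H l)) = 0"
          using W.E_orth[OF k, of l] l by (simp flip: mult.assoc)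
        then show ?thesis using EH[of l] l False by simp
      qed (simp add: EH[OF k])
    qed
    also have "\<dots> = \<rho> (H k)" using fin k by (auto simp: \<rho>_0)
    finally show "\<rho> (H k) = \<rho> (E k)" using \<rho>_E(2)[OF k] by simp
  qed
  moreover have "E \<in> K \<rightarrow>\<^sub>E carrier Y" using \<rho>_E(1) by (auto simp: E_def)
  ultimately show ?thesis using HK by (intro PiE_ext[of H K "\<lambda>_. carrier Y" E]) auto
qed

lemma yh_idem_eq: "yh_idem d n q \<xi> = E"
  unfolding yh_idem_def using E_family idempotent_family_unique by (rule the_equality)

text \<open>
  A two-sided inverse relative to the idempotent makes left multiplication by \<open>u\<close> injective on its
  right ideal, so the inverse image of the idempotent is determined.
\<close>

lemma local_inv_eqI:
  assumes "k \<in> K" "u \<in> carrier Y" "w \<in> carrier Y"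
    and "E0 k * \<rho> w = \<rho> w" "\<rho> u * \<rho> w = E0 k" "\<rho> w * \<rho> u = E0 k"
  shows "local_inv Y u (E k) = w"
proof -
  note Ek = \<rho>_E[OF assms(1)] and EE = E_mult[OF assms(1,1), simplified]
  have "inj_on (\<lambda>x. u \<otimes> x) (E k <# carrier Y)"
  proof (rule inj_onI)
    fix x y assume "x \<in> E k <# carrier Y" "y \<in> E k <# carrier Y" and eq: "u \<otimes> x = u \<otimes> y"
    then have xy: "x \<in> carrier Y" "y \<in> carrier Y" "E k \<otimes> x = x" "E k \<otimes> y = y"
      using in_l_coset_iff[OF Ek(1) EE] by auto
    have "\<rho> w * (\<rho> u * \<rho> x) = \<rho> w * (\<rho> u * \<rho> y)"
      using arg_cong[OF eq, of \<rho>] assms(2) xy by (simp add: \<rho>_simps)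
    then have "E0 k * \<rho> x = E0 k * \<rho> y" by (simp add: assms(6) flip: mult.assoc)
    moreover have "E0 k * \<rho> x = \<rho> x" "E0 k * \<rho> y = \<rho> y"
      using xy(3,4) \<rho>_mult[OF Ek(1) xy(1)] \<rho>_mult[OF Ek(1) xy(2)] Ek(2) by simp_all
    ultimately show "x = y" using xy by (intro \<rho>_eqI) simp_all
  qed
  moreover have "w \<in> E k <# carrier Y"
    unfolding in_l_coset_iff[OF Ek(1) EE]
    by (intro conjI assms(3) \<rho>_eqI) (use assms Ek in \<open>simp_all add: \<rho>_simps\<close>)
  moreover have "u \<otimes> w = E k"
    by (rule \<rho>_eqI) (use assms Ek in \<open>auto simp: \<rho>_simps\<close>)
  ultimately show ?thesis
    unfolding local_inv_def using the_inv_into_f_f[of "\<lambda>x. u \<otimes> x"] by metis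
qed

lemma local_inv_Alg:
  assumes "k \<in> K" "u \<in> carrier Y" "\<rho> u \<in> hecke.Alg" "w \<in> hecke.Alg" "E0 k * w = w" "\<rho> u * w = E0 k"
  shows "local_inv Y u (E k) \<in> carrier Y" "\<rho> (local_inv Y u (E k)) = w"
proof -
  note w = lift[OF Alg_range[OF assms(4)]]
  have "local_inv Y u (E k) = lift w"
    by (rule local_inv_eqI) (use assms w hecke.Alg_commute[OF assms(3,4)] in auto)
  then show "local_inv Y u (E k) \<in> carrier Y" "\<rho> (local_inv Y u (E k)) = w" using w by auto
qed

lemma X_inv_commute:
  assumes "a \<in> {1..n}" "x \<in> hecke.Alg"
  shows "hecke.X_inv a * x = x * hecke.X_inv a"
proof -
  have inv: "hecke.X a * hecke.X_inv a = 1" "hecke.X_inv a * hecke.X a = 1"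
    using hecke.X_X_inv[OF assms(1)] by simp_all
  have "hecke.X_inv a * x = hecke.X_inv a * (x * hecke.X a) * hecke.X_inv a"
    using inv(1) by (simp add: mult.assoc)
  also have "x * hecke.X a = hecke.X a * x"
    by (rule hecke.Alg_commute[OF assms(2) W.X_in[OF assms(1)]])
  also have "hecke.X_inv a * (hecke.X a * x) * hecke.X_inv a = x * hecke.X_inv a"
    using inv(2) by (simp flip: mult.assoc)
  finally show ?thesis .
qed

lemma \<rho>_local_inv_ratio:
  assumes k: "k \<in> K" and ab: "a \<in> {1..n}" "b \<in> {1..n}" and neq: "fst (k a) \<noteq> fst (k b)"
  defines "u \<equiv> \<one> \<ominus> yh_X d n q a \<otimes> inv\<^bsub>Y\<^esub> yh_X d n q b"
  shows "local_inv Y u (E k) \<in> carrier Y" "\<rho> (local_inv Y u (E k)) = hecke.X b * W.diff_inv a b k"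
proof -
  let ?D = "W.diff_inv a b k" and ?Xa = "hecke.X a" and ?Xb = "hecke.X b" and ?i = "hecke.X_inv b"
  note D = W.diff_inv[OF k ab neq]
  note X = \<rho>_X[OF ab(1)] \<rho>_X[OF ab(2)] \<rho>_X_inv[OF ab(2)]
  have u: "u \<in> carrier Y" "\<rho> u = 1 - ?Xa * ?i"
    using X by (simp_all add: u_def \<rho>_simps)
  have wA: "?Xb * ?D \<in> hecke.Alg" using D(1) W.X_in[OF ab(2)] by (rule hecke.Alg_mult[rotated])
  note w = lift[OF Alg_range[OF wA]]
  have "?Xa * ?i * (?Xb * ?D) = ?Xa * ((?i * ?Xb) * ?D)" by (simp only: mult.assoc)
  then have 1: "\<rho> u * (?Xb * ?D) = E0 k"
    using D(2) hecke.X_X_inv[OF ab(2)] by (simp add: u left_diff_distrib)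
  have "(?Xb * ?D) * (?Xa * ?i) = (?Xa * ?i) * (?Xb * ?D)"
    by (rule intertwine_mult[OF hecke.Alg_commute[OF wA W.X_in[OF ab(1)]] X_inv_commute[OF ab(2) wA, symmetric]])
  then have 2: "(?Xb * ?D) * \<rho> u = E0 k"
    using 1 by (simp add: u left_diff_distrib right_diff_distrib)
  have 3: "E0 k * (?Xb * ?D) = ?Xb * ?D"
    using W.Alg_left_commute[OF W.E_in[OF k] W.X_in[OF ab(2)]] D(3) by simp
  have "local_inv Y u (E k) = lift (?Xb * ?D)"
    by (rule local_inv_eqI[OF k u(1) w(1)]) (use w(2) 1 2 3 in simp_all)
  then show "local_inv Y u (E k) \<in> carrier Y" "\<rho> (local_inv Y u (E k)) = ?Xb * ?D"
    using w by simp_all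
qed

lemma \<rho>_Phi:
  assumes a: "a \<in> {1..<n}"
  shows "yh_Phi d n q \<xi> a \<in> carrier Y" "\<rho> (yh_Phi d n q \<xi> a) = W.\<Phi> a"
proof -
  have ab: "a \<in> {1..n}" "a + 1 \<in> {1..n}" using a by auto
  define supp where "supp = {k \<in> K. E k \<noteq> \<zero>}"
  define D where "D = {k \<in> supp. fst (k a) \<noteq> fst (k (a + 1)) \<and> snd (k a) = snd (k (a + 1))}"
  define S where "S = {k \<in> supp. fst (k a) = fst (k (a + 1)) \<and> snd (k a) = snd (k (a + 1))}"
  let ?li = "\<lambda>k. local_inv Y (\<one> \<ominus> yh_X d n q a \<otimes> inv\<^bsub>Y\<^esub> yh_X d n q (a + 1)) (E k)"
  have Phi: "yh_Phi d n q \<xi> a = yh_g d n q a \<oplus> yh_const d n q (1 - q) \<otimes> finsum Y ?li D \<oplus> finsum Y E S"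
    unfolding yh_Phi_def Let_def yh_idem_eq D_def S_def supp_def Y_eq[symmetric] ..
  have li: "?li k \<in> carrier Y" "\<rho> (?li k) = hecke.X (a + 1) * W.diff_inv a (a + 1) k" if "k \<in> D" for k
    using \<rho>_local_inv_ratio[OF _ ab, of k] that by (auto simp: D_def supp_def)
  have ES: "E k \<in> carrier Y" "\<rho> (E k) = E0 k" if "k \<in> S" for k
    using \<rho>_E that by (auto simp: S_def supp_def)
  have cl: "finsum Y ?li D \<in> carrier Y" "finsum Y E S \<in> carrier Y"
    using li(1) ES(1) by (auto intro!: Y.finsum_closed)
  show "yh_Phi d n q \<xi> a \<in> carrier Y"
    unfolding Phi using cl \<rho>_g[OF a] \<rho>_const by simp
  have sumD: "\<rho> (finsum Y ?li D) = (\<Sum>k\<in>D. hecke.X (a + 1) * W.diff_inv a (a + 1) k)"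
    using li by (subst \<rho>_finsum) (auto intro!: sum.cong)
  have sumS: "\<rho> (finsum Y E S) = (\<Sum>k\<in>S. E0 k)"
    using ES by (subst \<rho>_finsum) (auto intro!: sum.cong)
  have fin: "finite supp" using W.E_finite by (simp add: supp_def support_E)
  have "(\<Sum>k\<in>supp. W.\<beta> a (a + 1) k) = (\<Sum>k\<in>D \<union> S. W.\<beta> a (a + 1) k)"
    by (rule sum.mono_neutral_right) (use fin in \<open>auto simp: D_def S_def W.\<beta>_def\<close>)
  also have "\<dots> = (\<Sum>k\<in>D. W.\<beta> a (a + 1) k) + (\<Sum>k\<in>S. W.\<beta> a (a + 1) k)"
    by (rule sum.union_disjoint) (use fin in \<open>auto simp: D_def S_def\<close>)
  also have "(\<Sum>k\<in>D. W.\<beta> a (a + 1) k) = (\<Sum>k\<in>D. c0 (1 - q) * (hecke.X (a + 1) * W.diff_inv a (a + 1) k))"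
    by (rule sum.cong) (auto simp: D_def W.\<beta>_def)
  also have "(\<Sum>k\<in>S. W.\<beta> a (a + 1) k) = (\<Sum>k\<in>S. E0 k)"
    by (rule sum.cong) (auto simp: S_def W.\<beta>_def)
  finally have \<beta>: "(\<Sum>k\<in>supp. W.\<beta> a (a + 1) k) =
      c0 (1 - q) * (\<Sum>k\<in>D. hecke.X (a + 1) * W.diff_inv a (a + 1) k) + (\<Sum>k\<in>S. E0 k)"
    by (simp add: sum_distrib_left)
  have "\<rho> (yh_Phi d n q \<xi> a) = g0 a + c0 (1 - q) * \<rho> (finsum Y ?li D) + \<rho> (finsum Y E S)"
    unfolding Phi using cl \<rho>_g[OF a] \<rho>_const by (simp add: \<rho>_simps)
  also have "\<dots> = g0 a + (\<Sum>k\<in>supp. W.\<beta> a (a + 1) k)"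
    by (simp only: sumD sumS \<beta> add.assoc)
  also have "\<dots> = W.\<Phi> a" unfolding W.\<Phi>_def supp_def support_E ..
  finally show "\<rho> (yh_Phi d n q \<xi> a) = W.\<Phi> a" .
qed

end

section \<open>Relations in the quotient\<close>

context yh_parameters
begin

text \<open>
  The residues are the contents \<open>c - r\<close> and the component numbers of the nodes, reduced modulo
  the orders of \<open>q\<close> and \<open>\<xi>\<close>; they are unique by the definition of these orders. The class is
  nonempty, so its definite description is satisfied.
\<close>

lemma tab_residue_in_K:
  assumes "\<T> \<in> std_multitableaux d n // tab_equiv d n q \<xi>"
  shows "tab_residue d n q \<xi> \<T> \<in> K"
proof -
  obtain s where s: "s \<in> std_multitableaux d n" "\<T> = tab_equiv d n q \<xi> `` {s}"
    using assms by (rule quotientE)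
  have sT: "s \<in> \<T>" using s by (auto simp: tab_equiv_def)
  have same: "tab_content n q \<xi> u a = tab_content n q \<xi> s a" if "u \<in> \<T>" "a \<in> {1..2 * n}" for u a
    using that s(2) by (auto simp: tab_equiv_def)
  have q_mod: "q powi (z mod int (quantum_char q)) = q powi z" for z
    by (subst powi_eq_iff[OF q_neq(1) quantum_char_power_eq_1_iff[OF q_neq(2)]])
       (simp add: mod_eq_dvd_iff[symmetric])
  have \<xi>_mod: "\<xi> powi (z mod int d) = \<xi> powi z" for z
    by (subst powi_eq_iff[OF hecke.\<xi>_neq_0 primitive_root_power_eq_1_iff[OF d_pos \<xi>_primitive]])
       (simp add: mod_eq_dvd_iff[symmetric])
  let ?P = "\<lambda>k. k \<in> K \<and> (\<forall>u\<in>\<T>. \<forall>a\<in>{1..n}. tab_content n q \<xi> u a = q powi fst (k a) \<and>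
      tab_content n q \<xi> u (n + a) = \<xi> powi snd (k a))"
  define k where "k = (\<lambda>a\<in>{1..n}. case node_of s a of (r, c, p) \<Rightarrow>
      ((int c - int r) mod int (quantum_char q), int p mod int d))"
  have "tab_content n q \<xi> s a = q powi fst (k a)" "tab_content n q \<xi> s (n + a) = \<xi> powi snd (k a)"
    if "a \<in> {1..n}" for a
    using that by (auto simp: tab_content_def k_def q_mod \<xi>_mod split: prod.splits)
  moreover have "k \<in> K"
    by (auto simp: k_def yh_K_def mod_in_zmod_reps split: prod.splits)
  ultimately have Pk: "?P k" using same by auto
  have uniq: "l = k" if "?P l" for l
  proof (rule PiE_ext)
    show "l \<in> {1..n} \<rightarrow>\<^sub>E zmod_reps (quantum_char q) \<times> zmod_reps d"
      "k \<in> {1..n} \<rightarrow>\<^sub>E zmod_reps (quantum_char q) \<times> zmod_reps d"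
      using that Pk by (simp_all add: yh_K_def)
    fix a assume a: "a \<in> {1..n}"
    have "q powi fst (l a) = q powi fst (k a)" "\<xi> powi snd (l a) = \<xi> powi snd (k a)"
      using conjunct2[OF that, rule_format, OF sT a] conjunct2[OF Pk, rule_format, OF sT a] by metis+
    moreover have "l \<in> K" "k \<in> K" using that Pk by blast+
    ultimately show "l a = k a"
      using hecke.q_powi_inj hecke.\<xi>_powi_inj W.K_reps[OF _ a] by (intro prod_eqI) blast+
  qed
  have "tab_residue d n q \<xi> \<T> = k"
    unfolding tab_residue_def using Pk uniq by (rule the_equality)
  then show ?thesis using Pk by simp
qed

lemma intertwiner_relations:
  assumes k: "k \<in> K" and a: "1 \<le> a" "a < n"
    and "i = (\<lambda>b. fst (k b))" and "j = (\<lambda>b. snd (k b))"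
    and "X = yh_X d n q"
    and "\<Phi> = yh_Phi d n q \<xi>"
    and "\<kappa> = yh_const d n q"
  shows
    "(\<Phi> a \<otimes> E k = E (swap_places a k) \<otimes> \<Phi> a)
   \<and> (\<forall>b\<in>{1..n}. b \<noteq> a \<and> b \<noteq> a + 1 \<longrightarrow> \<Phi> a \<otimes> X b = X b \<otimes> \<Phi> a)
   \<and> (\<forall>b\<in>{1..<n}. \<bar>int a - int b\<bar> > 1 \<longrightarrow> \<Phi> a \<otimes> \<Phi> b = \<Phi> b \<otimes> \<Phi> a)"
  (is ?A)
    "(k a \<noteq> k (a + 1) \<longrightarrow> \<Phi> a \<otimes> X (a + 1) \<otimes> E k = X a \<otimes> \<Phi> a \<otimes> E k)
   \<and> (k a = k (a + 1) \<longrightarrow>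
        \<Phi> a \<otimes> X (a + 1) \<otimes> E k = (X a \<otimes> \<Phi> a \<oplus> \<kappa> q \<otimes> X (a + 1) \<ominus> X a) \<otimes> E k)
   \<and> (k a \<noteq> k (a + 1) \<longrightarrow> X (a + 1) \<otimes> \<Phi> a \<otimes> E k = \<Phi> a \<otimes> X a \<otimes> E k)
   \<and> (k a = k (a + 1) \<longrightarrow>
        X (a + 1) \<otimes> \<Phi> a \<otimes> E k = (\<Phi> a \<otimes> X a \<oplus> \<kappa> q \<otimes> X (a + 1) \<ominus> X a) \<otimes> E k)"
    (is ?B)
    "(i a \<noteq> i (a + 1) \<and> j a = j (a + 1) \<longrightarrow>
        \<Phi> a [^] (2::nat) \<otimes> E k =
          (\<kappa> q \<otimes> X a \<ominus> X (a + 1)) \<otimes> (X a \<ominus> \<kappa> q \<otimes> X (a + 1))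
            \<otimes> local_inv Y ((X a \<ominus> X (a + 1)) [^] (2::nat)) (E k))
   \<and> (k a = k (a + 1) \<longrightarrow>
        \<Phi> a [^] (2::nat) \<otimes> E k = \<kappa> (q + 1) \<otimes> \<Phi> a \<otimes> E k)
   \<and> (j a \<noteq> j (a + 1) \<longrightarrow>
        \<Phi> a [^] (2::nat) \<otimes> E k = \<kappa> q \<otimes> E k)"
    (is ?C)
proof -
  have a': "a \<in> {1..<n}" and ab: "a \<in> {1..n}" "a + 1 \<in> {1..n}" using a by auto
  note cl = \<rho>_Phi[OF a'] \<rho>_X[OF ab(1)] \<rho>_X[OF ab(2)] \<rho>_E[OF k] \<rho>_const
    \<rho>_E[OF W.swap_in_K[OF k a']]
  note push = \<rho>_simps cl Y.nat_pow_closed Y.m_closed Y.minus_closed Y.a_closed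
  show ?A
  proof (intro conjI ballI impI)
    show "\<Phi> a \<otimes> E k = E (swap_places a k) \<otimes> \<Phi> a"
      unfolding assms by (rule \<rho>_eqI; simp only: push W.\<Phi>_E_swap[OF k a'])
    show "\<Phi> a \<otimes> X b = X b \<otimes> \<Phi> a" if "b \<in> {1..n}" "b \<noteq> a \<and> b \<noteq> a + 1" for b
    proof -
      have "W.\<Phi> a * hecke.X b = hecke.X b * W.\<Phi> a"
        by (rule W.\<Phi>_X_far[OF a' that(1)]) (use that(2) in auto)
      then show ?thesis unfolding assms by (intro \<rho>_eqI; simp only: push \<rho>_X[OF that(1)])
    qed
    show "\<Phi> a \<otimes> \<Phi> b = \<Phi> b \<otimes> \<Phi> a" if "b \<in> {1..<n}" "\<bar>int a - int b\<bar> > 1" for b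
    proof -
      have "W.\<Phi> a * W.\<Phi> b = W.\<Phi> b * W.\<Phi> a"
        by (rule W.\<Phi>_commute_far[OF a' that(1)]) (use that(2) in linarith)
      then show ?thesis
        unfolding assms by (intro \<rho>_eqI; simp only: push \<rho>_Phi[OF that(1)])
    qed
  qed
  show ?B
  proof (intro conjI impI)
    show "\<Phi> a \<otimes> X (a + 1) \<otimes> E k = X a \<otimes> \<Phi> a \<otimes> E k" if "k a \<noteq> k (a + 1)"
      unfolding assms by (rule \<rho>_eqI; simp only: push mult.assoc W.\<Phi>_X_next[OF k a' that])
    show "\<Phi> a \<otimes> X (a + 1) \<otimes> E k = (X a \<otimes> \<Phi> a \<oplus> \<kappa> q \<otimes> X (a + 1) \<ominus> X a) \<otimes> E k"
      if "k a = k (a + 1)"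
      unfolding assms
      by (rule \<rho>_eqI; simp only: push mult.assoc W.\<Phi>_X_next_equal[OF k a' that] distrib_right left_diff_distrib add_diff_eq)
    show "X (a + 1) \<otimes> \<Phi> a \<otimes> E k = \<Phi> a \<otimes> X a \<otimes> E k" if "k a \<noteq> k (a + 1)"
      unfolding assms by (rule \<rho>_eqI; simp only: push mult.assoc W.\<Phi>_X_same[OF k a' that])
    show "X (a + 1) \<otimes> \<Phi> a \<otimes> E k = (\<Phi> a \<otimes> X a \<oplus> \<kappa> q \<otimes> X (a + 1) \<ominus> X a) \<otimes> E k"
      if "k a = k (a + 1)"
      unfolding assms
      by (rule \<rho>_eqI; simp only: push mult.assoc W.\<Phi>_X_same_equal[OF k a' that] distrib_right left_diff_distrib add_diff_eq)
  qed
  show ?C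
  proof (intro conjI impI)
    assume "i a \<noteq> i (a + 1) \<and> j a = j (a + 1)"
    then have D: "snd (k a) = snd (k (a + 1))" "fst (k a) \<noteq> fst (k (a + 1))" and neq: "k a \<noteq> k (a + 1)"
      unfolding assms by auto
    let ?D = "W.diff_inv a (a + 1) k"
    let ?u = "(yh_X d n q a \<ominus> yh_X d n q (a + 1)) [^] (2::nat)"
    note DD = W.diff_inv[OF k ab D(2)]
    have u: "?u \<in> carrier Y" "\<rho> ?u = (hecke.X a - hecke.X (a + 1)) ^ 2" by (simp_all only: push)
    have w: "?D * ?D \<in> hecke.Alg" "E0 k * (?D * ?D) = ?D * ?D"
      using DD(1) hecke.Alg_mult assoc_left[OF DD(3)] by simp_all
    have uw: "(hecke.X a - hecke.X (a + 1)) ^ 2 * (?D * ?D) = E0 k"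
      using W.diff_inv_square[OF k ab D(2), of 1] by simp
    note li = local_inv_Alg[OF k u(1) _ w, unfolded u(2), OF _ uw]
    have uA: "(hecke.X a - hecke.X (a + 1)) ^ 2 \<in> hecke.Alg"
      using ab by (simp add: W.Alg_closed)
    show "\<Phi> a [^] (2::nat) \<otimes> E k =
          (\<kappa> q \<otimes> X a \<ominus> X (a + 1)) \<otimes> (X a \<ominus> \<kappa> q \<otimes> X (a + 1))
            \<otimes> local_inv Y ((X a \<ominus> X (a + 1)) [^] (2::nat)) (E k)"
      unfolding assms
      by (rule \<rho>_eqI; simp only: push li[OF uA] power2_eq_square[of "W.\<Phi> a"] mult.assoc[of "W.\<Phi> a"]
          W.\<Phi>_square[OF k a' neq] W.square_fraction[OF k ab D w(2) uw])
  next
    assume "k a = k (a + 1)"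
    then show "\<Phi> a [^] (2::nat) \<otimes> E k = \<kappa> (q + 1) \<otimes> \<Phi> a \<otimes> E k"
      unfolding assms using W.\<Phi>_square_equal[OF k a']
      by (intro \<rho>_eqI; simp only: push power2_eq_square mult.assoc)
  next
    assume j: "j a \<noteq> j (a + 1)"
    then have neq: "k a \<noteq> k (a + 1)" and N: "snd (k a) \<noteq> snd (k (a + 1))" unfolding assms by auto
    show "\<Phi> a [^] (2::nat) \<otimes> E k = \<kappa> q \<otimes> E k"
      unfolding assms
      by (rule \<rho>_eqI; simp only: push power2_eq_square mult.assoc W.\<Phi>_square[OF k a' neq]
          W.\<beta>_eq_0[OF N] mult_zero_left add_0_right)
  qed
qed

lemma braid_relation:
  assumes k: "k \<in> K" and a: "1 \<le> a" "a + 2 \<le> n" and br: "b = a + 1" "r = a + 2"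
    and defs: "i = (\<lambda>b. fst (k b))" "j = (\<lambda>b. snd (k b))"
    "X = yh_X d n q"
    "\<Phi> = yh_Phi d n q \<xi>"
    "\<kappa> = yh_const d n q"
  shows "\<Phi> a \<otimes> \<Phi> b \<otimes> \<Phi> a \<otimes> E k =
          (if i a = i b \<and> i b = i r \<and> j a = j b \<and> j b = j r
           then (\<Phi> b \<otimes> \<Phi> a \<otimes> \<Phi> b \<oplus> \<kappa> q \<otimes> \<Phi> a \<ominus> \<kappa> q \<otimes> \<Phi> b) \<otimes> E k
           else if i a = i r \<and> i r \<noteq> i b \<and> j a = j b \<and> j b = j r
           then \<Phi> b \<otimes> \<Phi> a \<otimes> \<Phi> b \<otimes> E k
             \<oplus> \<kappa> ((1 - q) ^ 2)
               \<otimes> (X a \<otimes> X r \<ominus> X b [^] (2::nat))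
               \<otimes> (X a \<otimes> X b \<ominus> \<kappa> q \<otimes> X b \<otimes> X r)
               \<otimes> local_inv Y ((X a \<ominus> X b) [^] (2::nat)
                                 \<otimes> (X b \<ominus> X r) [^] (2::nat)) (E k)
           else \<Phi> b \<otimes> \<Phi> a \<otimes> \<Phi> b \<otimes> E k)"
proof -
  interpret C: consecutive_places c0 d n q \<xi> g0 t0 E0 a b r
    by unfold_locales (use a br in auto)
  note cl = \<rho>_Phi[OF C.a] \<rho>_Phi[OF C.b] \<rho>_X[OF C.places(1)] \<rho>_X[OF C.places(2)] \<rho>_X[OF C.places(3)]
    \<rho>_E[OF k] \<rho>_const
  note push = \<rho>_simps cl Y.nat_pow_closed Y.m_closed Y.minus_closed Y.a_closed
  have k_eq: "k x = k y \<longleftrightarrow> i x = i y \<and> j x = j y" for x y unfolding defs by (auto simp: prod_eq_iff)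
  consider "k a = k b" "k b = k r" | "k a = k r" "k r \<noteq> k b" "j a = j b"
    | "\<not> (k a = k b \<and> k b = k r)" "\<not> (k a = k r \<and> k r \<noteq> k b \<and> j a = j b)" by blast
  then show ?thesis
  proof cases
    case 1
    then have c: "i a = i b \<and> i b = i r \<and> j a = j b \<and> j b = j r" unfolding defs by auto
    show ?thesis
      unfolding if_P[OF c] unfolding defs
      by (rule \<rho>_eqI; simp only: push mult.assoc C.braid_all_equal[OF k 1] distrib_right left_diff_distrib)
  next
    case 2
    then have c: "\<not> (i a = i b \<and> i b = i r \<and> j a = j b \<and> j b = j r)"
      "i a = i r \<and> i r \<noteq> i b \<and> j a = j b \<and> j b = j r" using k_eq by metis+
    have D: "snd (k a) = snd (k b)" "fst (k a) \<noteq> fst (k b)" "snd (k b) = snd (k r)" "fst (k b) \<noteq> fst (k r)"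
      and neq: "k a \<noteq> k b"
      using c(2) unfolding defs by auto
    note ab = C.places(1,2) and bp = C.places(2,3)
    let ?D = "W.diff_inv a b k" and ?D' = "W.diff_inv b r k"
    let ?w = "?D * (?D * (?D' * ?D'))"
    let ?u = "(yh_X d n q a \<ominus> yh_X d n q b) [^] (2::nat) \<otimes> (yh_X d n q b \<ominus> yh_X d n q r) [^] (2::nat)"
    let ?U = "(hecke.X a - hecke.X b) ^ 2" and ?V = "(hecke.X b - hecke.X r) ^ 2"
    note DD = W.diff_inv[OF k ab D(2)] and DD' = W.diff_inv[OF k bp D(4)]
    have u: "?u \<in> carrier Y" "\<rho> ?u = ?U * ?V" by (simp_all only: push)
    have w: "?w \<in> hecke.Alg" "E0 k * ?w = ?w"
      using DD(1) DD'(1) hecke.Alg_mult assoc_left[OF DD(3)] by simp_all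
    have UV: "?U \<in> hecke.Alg" "?V \<in> hecke.Alg" using C.places by (simp_all add: W.Alg_closed)
    have "?U * ?V * ?w = ?V * (?U * ?w)"
      using hecke.Alg_commute[OF UV] by (simp flip: mult.assoc)
    also have "\<dots> = ?V * (?D' * (?D' * 1))"
      unfolding W.diff_inv_square[OF k ab D(2)] using assoc_left[OF DD'(3)] by simp
    also have "\<dots> = E0 k" unfolding W.diff_inv_square[OF k bp D(4)] by simp
    finally have uw: "?U * ?V * ?w = E0 k" .
    note li = local_inv_Alg[OF k u(1) _ w, unfolded u(2), OF hecke.Alg_mult[OF UV] uw]
    note braid = C.braid_outer_equal[OF k 2(1) neq]
      and frac = W.braid_fraction[OF k C.places 2(1) D(1,2) w(2) uw]
    have L: "W.\<Phi> a * (W.\<Phi> b * (W.\<Phi> a * E0 k)) = W.\<Phi> b * (W.\<Phi> a * (W.\<Phi> b * E0 k)) +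
        c0 ((1 - q) ^ 2) * (hecke.X a * hecke.X r - hecke.X b ^ 2) *
        (hecke.X a * hecke.X b - c0 q * hecke.X b * hecke.X r) * ?w"
      unfolding frac[symmetric] braid by (simp only: add_diff_eq add.assoc)
    show ?thesis
      unfolding if_not_P[OF c(1)] if_P[OF c(2)] unfolding defs
      by (rule \<rho>_eqI; simp only: push li) (simp only: mult.assoc[of "W.\<Phi> a"] mult.assoc[of "W.\<Phi> b"] L)
  next
    case 3
    then have c: "\<not> (i a = i b \<and> i b = i r \<and> j a = j b \<and> j b = j r)"
      "\<not> (i a = i r \<and> i r \<noteq> i b \<and> j a = j b \<and> j b = j r)" using k_eq by metis+
    have "W.\<Phi> a * (W.\<Phi> b * (W.\<Phi> a * E0 k)) = W.\<Phi> b * (W.\<Phi> a * (W.\<Phi> b * E0 k))"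
    proof -
      consider "k a = k b" "k b \<noteq> k r" | "k a \<noteq> k b" "k b = k r" | "k a \<noteq> k b" "k b \<noteq> k r" "k a \<noteq> k r"
        | "k a = k r" "k a \<noteq> k b" using 3(1) by metis
      then show ?thesis
      proof cases
        case 4
        then have "snd (k a) \<noteq> snd (k b)" "snd (k b) \<noteq> snd (k r)" using 3(2) unfolding defs by auto
        then show ?thesis using C.braid_outer_equal[OF k 4] by (simp add: W.\<beta>_eq_0)
      qed (simp_all add: C.braid_first_equal[OF k] C.braid_second_equal[OF k] C.braid_distinct[OF k])
    qed
    then show ?thesis
      unfolding if_not_P[OF c(1)] if_not_P[OF c(2)] unfolding defs
      by (intro \<rho>_eqI; simp only: push mult.assoc)
  qed
qed

end

lemma of_nat_neq_0:
  assumes "d \<ge> 1" and "CHAR('k::field) = 0 \<or> coprime d CHAR('k)"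
  shows "of_nat d \<noteq> (0::'k)"
proof
  assume "of_nat d = (0::'k)"
  then have "CHAR('k) dvd d" by (simp add: of_nat_eq_0_iff_char_dvd)
  then have "CHAR('k) = 1" using assms by (auto dest: coprime_common_divisor_nat)
  then show False using CHAR_not_1[where ?'a = 'k] by simp
qed

theorem theorem23:
  fixes d n a :: nat and q \<xi> :: "'k::field"
    and Y :: "(yh_gen, 'k) nc_poly set ring" (structure)
    and \<T> :: "multitableau set" and k :: "nat \<Rightarrow> int \<times> int" and i j :: "nat \<Rightarrow> int"
    and X \<Phi> :: "nat \<Rightarrow> (yh_gen, 'k) nc_poly set"
    and E :: "(nat \<Rightarrow> int \<times> int) \<Rightarrow> (yh_gen, 'k) nc_poly set"
    and \<kappa> :: "'k \<Rightarrow> (yh_gen, 'k) nc_poly set"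
  assumes "d \<ge> 1" and "n \<ge> 1"
    and "CHAR('k) = 0 \<or> coprime d CHAR('k)"
    and "primitive_root_of_unity d \<xi>"
    and "q \<noteq> 0" and "q \<noteq> 1"
    and "\<T> \<in> std_multitableaux d n // tab_equiv d n q \<xi>"
    and "k = tab_residue d n q \<xi> \<T>"
    and "i = (\<lambda>b. fst (k b))" and "j = (\<lambda>b. snd (k b))"
    and "1 \<le> a" and "a < n"
    and "Y = yh_algebra d n q"
    and "X = yh_X d n q"
    and "E = yh_idem d n q \<xi>"
    and "\<Phi> = yh_Phi d n q \<xi>"
    and "\<kappa> = yh_const d n q"
  shows
    "(\<Phi> a \<otimes> E k = E (swap_places a k) \<otimes> \<Phi> a)
   \<and> (\<forall>b\<in>{1..n}. b \<noteq> a \<and> b \<noteq> a + 1 \<longrightarrow> \<Phi> a \<otimes> X b = X b \<otimes> \<Phi> a)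
   \<and> (\<forall>b\<in>{1..<n}. \<bar>int a - int b\<bar> > 1 \<longrightarrow> \<Phi> a \<otimes> \<Phi> b = \<Phi> b \<otimes> \<Phi> a)
   \<and> ((i a \<noteq> i (a + 1) \<and> j a = j (a + 1)) \<or> j a \<noteq> j (a + 1) \<longrightarrow>
        \<Phi> a \<otimes> X (a + 1) \<otimes> E k = X a \<otimes> \<Phi> a \<otimes> E k)
   \<and> (i a = i (a + 1) \<and> j a = j (a + 1) \<longrightarrow>
        \<Phi> a \<otimes> X (a + 1) \<otimes> E k = (X a \<otimes> \<Phi> a \<oplus> \<kappa> q \<otimes> X (a + 1) \<ominus> X a) \<otimes> E k)
   \<and> ((i a \<noteq> i (a + 1) \<and> j a = j (a + 1)) \<or> j a \<noteq> j (a + 1) \<longrightarrow>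
        X (a + 1) \<otimes> \<Phi> a \<otimes> E k = \<Phi> a \<otimes> X a \<otimes> E k)
   \<and> (i a = i (a + 1) \<and> j a = j (a + 1) \<longrightarrow>
        X (a + 1) \<otimes> \<Phi> a \<otimes> E k = (\<Phi> a \<otimes> X a \<oplus> \<kappa> q \<otimes> X (a + 1) \<ominus> X a) \<otimes> E k)
   \<and> (i a \<noteq> i (a + 1) \<and> j a = j (a + 1) \<longrightarrow>
        \<Phi> a [^] (2::nat) \<otimes> E k =
          (\<kappa> q \<otimes> X a \<ominus> X (a + 1)) \<otimes> (X a \<ominus> \<kappa> q \<otimes> X (a + 1))
            \<otimes> local_inv Y ((X a \<ominus> X (a + 1)) [^] (2::nat)) (E k))
   \<and> (i a = i (a + 1) \<and> j a = j (a + 1) \<longrightarrow>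
        \<Phi> a [^] (2::nat) \<otimes> E k = \<kappa> (q + 1) \<otimes> \<Phi> a \<otimes> E k)
   \<and> (j a \<noteq> j (a + 1) \<longrightarrow>
        \<Phi> a [^] (2::nat) \<otimes> E k = \<kappa> q \<otimes> E k)
   \<and> (a + 2 \<le> n \<longrightarrow>
        \<Phi> a \<otimes> \<Phi> (a + 1) \<otimes> \<Phi> a \<otimes> E k =
          (if i a = i (a + 1) \<and> i (a + 1) = i (a + 2) \<and> j a = j (a + 1) \<and> j (a + 1) = j (a + 2)
           then (\<Phi> (a + 1) \<otimes> \<Phi> a \<otimes> \<Phi> (a + 1) \<oplus> \<kappa> q \<otimes> \<Phi> a \<ominus> \<kappa> q \<otimes> \<Phi> (a + 1)) \<otimes> E k
           else if i a = i (a + 2) \<and> i (a + 2) \<noteq> i (a + 1) \<and> j a = j (a + 1) \<and> j (a + 1) = j (a + 2)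
           then \<Phi> (a + 1) \<otimes> \<Phi> a \<otimes> \<Phi> (a + 1) \<otimes> E k
             \<oplus> \<kappa> ((1 - q) ^ 2)
               \<otimes> (X a \<otimes> X (a + 2) \<ominus> X (a + 1) [^] (2::nat))
               \<otimes> (X a \<otimes> X (a + 1) \<ominus> \<kappa> q \<otimes> X (a + 1) \<otimes> X (a + 2))
               \<otimes> local_inv Y ((X a \<ominus> X (a + 1)) [^] (2::nat)
                                 \<otimes> (X (a + 1) \<ominus> X (a + 2)) [^] (2::nat)) (E k)
           else \<Phi> (a + 1) \<otimes> \<Phi> a \<otimes> \<Phi> (a + 1) \<otimes> E k))"
proof -
  interpret P: yh_parameters d n q \<xi> Y
    by unfold_locales (use assms of_nat_neq_0 in auto)
  have k: "k \<in> yh_K d n q" using P.tab_residue_in_K assms by simp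
  have EP: "E = P.E" using assms by (simp add: P.yh_idem_eq)
  have k_eq: "k x = k y \<longleftrightarrow> i x = i y \<and> j x = j y" for x y
    unfolding assms(9,10) by (auto simp: prod_eq_iff)
  note rest = assms(9,10,14,16,17)
  note main = P.intertwiner_relations[OF k assms(11,12) rest, folded EP, unfolded k_eq]
  have neq: "(i a \<noteq> i (a + 1) \<and> j a = j (a + 1)) \<or> j a \<noteq> j (a + 1) \<longleftrightarrow>
      \<not> (i a = i (a + 1) \<and> j a = j (a + 1))"
    by blast
  show ?thesis
    unfolding neq
    by (intro conjI; (use main in blast)?)
      (intro impI, rule P.braid_relation[OF k assms(11) _ refl refl rest, folded EP])
qed

end
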